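(* Let $f:M\to N$ be a holomorphic map from a compact complex manifold $M$ to a complex manifold $N$. If the line bundle $\mathcal O_{T^*_M}(-1)$ over $\mathbb P(T_M)$ is RC-positive, and $N$ has (i.e. carries a Hermitian metric with) non-positive holomorphic bisectional curvature, then $f$ is a constant map.
   Context: Manifolds are connected. $\mathbb P(T_M)\to M$ is the bundle whose fiber over $p$ is the set of complex lines in $T_pM=T^{1,0}_pM$. $\mathcal O_{T^*_M}(-1)$ is the tautological line bundle on $\mathbb P(T_M)$ whose fiber at $(p,[W])$ is the line $\mathbb C W\subset T_pM$; $\mathcal O_{T^*_M}(1)$ is its dual. A holomorphic line bundle $\mathscr L$ over a complex manifold $X$ is RC-positive if it admits a smooth Hermitian metric $h^{\mathscr L}$ such that its Chern curvature $-\sqrt{-1}\,\partial\bar\partial\log h^{\mathscr L}$ has at least one positive eigenvalue at every point of $X$. A Hermitian metric $g$ on $N$ has non-positive holomorphic bisectional curvature if its Chern curvature tensor satisfies $R_{i\bar jk\bar\ell}u^i\bar u^jv^k\bar v^\ell\le0$ for all $(1,0)$-vectors $u,v$ at every point, where $R_{i\bar jk\bar\ell}=-\frac{\partial^2g_{k\bar\ell}}{\partial\eta^i\partial\bar\eta^j}+g^{p\bar q}\frac{\partial g_{k\bar q}}{\partial\eta^i}\frac{\partial g_{p\bar\ell}}{\partial\bar\eta^j}$. *)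

theory Defs
  imports "HOL-Analysis.Analysis" "HOL-Library.Function_Algebras"
begin

section \<open>Calculus on open subsets of coordinate spaces\<close>

text \<open>
  The space of dimension n is rendered as the coordinate subspace of \<open>complex^'d\<close> spanned by n of the
  coordinates. The index type \<open>'d\<close> only has to be large enough. This allows every dimension (0
  included), and the dimension 2n - 1 of a projectivized tangent bundle, for which there is no
  index type depending on that of the base.
\<close>

definition coord_space :: "'d::finite set \<Rightarrow> (complex^'d) set"
  where "coord_space I = {z. \<forall>k. k \<notin> I \<longrightarrow> z $ k = 0}"

text \<open>
  Complex differentiability (several variables) on a set that is relatively open in a coordinate
  space. Off that space the derivative is not determined, whence the existential.
\<close>

definition cholomorphic :: "(complex^'d) set \<Rightarrow> (complex^'d \<Rightarrow> complex^'e) \<Rightarrow> bool"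
  where "cholomorphic S F \<longleftrightarrow>
    (\<forall>x\<in>S. \<exists>D. (F has_derivative D) (at x within S) \<and> (\<forall>a v. D (a *s v) = a *s D v))"

definition dirderiv :: "(complex^'d \<Rightarrow> 'b::real_normed_vector) \<Rightarrow> complex^'d \<Rightarrow> complex^'d \<Rightarrow> 'b"
  where "dirderiv F v x = vector_derivative (\<lambda>t::real. F (x + t *\<^sub>R v)) (at 0)"

primrec Ck_on :: "nat \<Rightarrow> 'd::finite set \<Rightarrow> (complex^'d) set \<Rightarrow> (complex^'d \<Rightarrow> complex) \<Rightarrow> bool"
  where
    "Ck_on 0 I S F \<longleftrightarrow> continuous_on S F"
  | "Ck_on (Suc k) I S F \<longleftrightarrow> continuous_on S F \<and>
      (\<forall>v\<in>coord_space I. (\<forall>x\<in>S. (\<lambda>t::real. F (x + t *\<^sub>R v)) differentiable (at 0)) \<and>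
         Ck_on k I S (dirderiv F v))"

definition smooth_fun_on :: "'d::finite set \<Rightarrow> (complex^'d) set \<Rightarrow> (complex^'d \<Rightarrow> complex) \<Rightarrow> bool"
  where "smooth_fun_on I S F \<longleftrightarrow> (\<forall>k. Ck_on k I S F)"

text \<open>The Wirtinger derivatives with respect to the k-th coordinate and its conjugate.\<close>

definition d_dz :: "'d::finite \<Rightarrow> (complex^'d \<Rightarrow> complex) \<Rightarrow> complex^'d \<Rightarrow> complex"
  where "d_dz k F z = (dirderiv F (axis k 1) z - \<i> * dirderiv F (axis k \<i>) z) / 2"

definition d_dzbar :: "'d::finite \<Rightarrow> (complex^'d \<Rightarrow> complex) \<Rightarrow> complex^'d \<Rightarrow> complex"
  where "d_dzbar k F z = (dirderiv F (axis k 1) z + \<i> * dirderiv F (axis k \<i>) z) / 2"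


section \<open>Complex manifolds\<close>

text \<open>
  A chart has a domain, a set of indices of the coordinates in use, and a coordinate map
  (irrelevant outside the domain). A manifold is given by an atlas, its points being those covered
  by the charts.
\<close>

datatype ('a, 'd::finite) chart =
  Chart (chart_dom: "'a set") (chart_idx: "'d set") (chart_map: "'a \<Rightarrow> complex^'d")

definition carrier_of :: "('a, 'd::finite) chart set \<Rightarrow> 'a set"
  where "carrier_of A = (\<Union>c\<in>A. chart_dom c)"

definition chart_inv :: "('a, 'd::finite) chart \<Rightarrow> complex^'d \<Rightarrow> 'a"
  where "chart_inv c = inv_into (chart_dom c) (chart_map c)"

definition transition :: "('a, 'd::finite) chart \<Rightarrow> ('a, 'd) chart \<Rightarrow> complex^'d \<Rightarrow> complex^'d"
  where "transition c d = chart_map d \<circ> chart_inv c"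

definition atlas_topology :: "('a, 'd::finite) chart set \<Rightarrow> 'a topology"
  where "atlas_topology A =
    topology_generated_by {{p \<in> chart_dom c. chart_map c p \<in> W} | c W. c \<in> A \<and> open W}"

definition has_countable_base :: "'a topology \<Rightarrow> bool"
  where "has_countable_base X \<longleftrightarrow>
    (\<exists>\<B>. countable \<B> \<and> (\<forall>V\<in>\<B>. openin X V) \<and>
      (\<forall>U x. openin X U \<and> x \<in> U \<longrightarrow> (\<exists>V\<in>\<B>. x \<in> V \<and> V \<subseteq> U)))"

definition complex_manifold :: "nat \<Rightarrow> ('a, 'd::finite) chart set \<Rightarrow> bool"
  where "complex_manifold n A \<longleftrightarrow>
    (\<forall>c\<in>A. card (chart_idx c) = n \<and> inj_on (chart_map c) (chart_dom c) \<and>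
       openin (top_of_set (coord_space (chart_idx c))) (chart_map c ` chart_dom c)) \<and>
    (\<forall>c\<in>A. \<forall>d\<in>A.
       openin (top_of_set (coord_space (chart_idx c))) (chart_map c ` (chart_dom c \<inter> chart_dom d)) \<and>
       cholomorphic (chart_map c ` (chart_dom c \<inter> chart_dom d)) (transition c d)) \<and>
    Hausdorff_space (atlas_topology A) \<and>
    has_countable_base (atlas_topology A) \<and>
    connected_space (atlas_topology A)"

definition holomorphic_map ::
    "('a, 'd::finite) chart set \<Rightarrow> ('b, 'e::finite) chart set \<Rightarrow> ('a \<Rightarrow> 'b) \<Rightarrow> bool"
  where "holomorphic_map A B f \<longleftrightarrow>
    continuous_map (atlas_topology A) (atlas_topology B) f \<and>
    (\<forall>c\<in>A. \<forall>d\<in>B. cholomorphic (chart_map c ` {p \<in> chart_dom c. f p \<in> chart_dom d})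
                       (chart_map d \<circ> f \<circ> chart_inv c))"


section \<open>Holomorphic tangent vectors\<close>

text \<open>
  A (1,0)-vector at p is given by its component vectors in all charts around p, which transform by
  the Jacobian matrices of the coordinate changes. It is made 0 at all other charts, so that equal
  vectors are equal functions.
\<close>

type_synonym ('a, 'd) tangent = "('a, 'd) chart \<Rightarrow> complex^'d"

definition tangent_space :: "('a, 'd::finite) chart set \<Rightarrow> 'a \<Rightarrow> ('a, 'd) tangent set"
  where "tangent_space A p = {W.
    (\<forall>c. c \<notin> A \<or> p \<notin> chart_dom c \<longrightarrow> W c = 0) \<and>
    (\<forall>c\<in>A. p \<in> chart_dom c \<longrightarrow> W c \<in> coord_space (chart_idx c)) \<and>
    (\<forall>c\<in>A. \<forall>d\<in>A. p \<in> chart_dom c \<inter> chart_dom d \<longrightarrow>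
       W d = dirderiv (transition c d) (W c) (chart_map c p))}"

definition tscale :: "complex \<Rightarrow> ('a, 'd::finite) tangent \<Rightarrow> ('a, 'd) tangent"
  where "tscale a W = (\<lambda>c. a *s W c)"

text \<open>The tangent vector at p with component vector a in the chart c.\<close>

definition tangent_vec ::
    "('a, 'd::finite) chart set \<Rightarrow> ('a, 'd) chart \<Rightarrow> 'a \<Rightarrow> complex^'d \<Rightarrow> ('a, 'd) tangent"
  where "tangent_vec A c p a =
    (\<lambda>d. if d \<in> A \<and> p \<in> chart_dom d then dirderiv (transition c d) a (chart_map c p) else 0)"

definition hermitian_inner ::
    "(complex \<Rightarrow> 'v \<Rightarrow> 'v::ab_group_add) \<Rightarrow> 'v set \<Rightarrow> ('v \<Rightarrow> 'v \<Rightarrow> complex) \<Rightarrow> bool"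
  where "hermitian_inner sc V h \<longleftrightarrow>
    (\<forall>u\<in>V. \<forall>v\<in>V. \<forall>w\<in>V. h (u + v) w = h u w + h v w) \<and>
    (\<forall>a. \<forall>u\<in>V. \<forall>v\<in>V. h (sc a u) v = a * h u v) \<and>
    (\<forall>u\<in>V. \<forall>v\<in>V. h v u = cnj (h u v)) \<and>
    (\<forall>u\<in>V. u \<noteq> 0 \<longrightarrow> 0 < Re (h u u))"


section \<open>Hermitian metrics on manifolds and bisectional curvature\<close>

text \<open>The component with indices k and l (the latter conjugated), as a function of the coordinates.\<close>

definition metric_comp ::
    "('a, 'd::finite) chart set \<Rightarrow> ('a \<Rightarrow> ('a, 'd) tangent \<Rightarrow> ('a, 'd) tangent \<Rightarrow> complex) \<Rightarrow>
     ('a, 'd) chart \<Rightarrow> 'd \<Rightarrow> 'd \<Rightarrow> complex^'d \<Rightarrow> complex"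
  where "metric_comp A g c k l z =
    g (chart_inv c z) (tangent_vec A c (chart_inv c z) (axis k 1))
                      (tangent_vec A c (chart_inv c z) (axis l 1))"

definition hermitian_metric ::
    "('a, 'd::finite) chart set \<Rightarrow> ('a \<Rightarrow> ('a, 'd) tangent \<Rightarrow> ('a, 'd) tangent \<Rightarrow> complex) \<Rightarrow> bool"
  where "hermitian_metric A g \<longleftrightarrow>
    (\<forall>p\<in>carrier_of A. hermitian_inner tscale (tangent_space A p) (g p)) \<and>
    (\<forall>c\<in>A. \<forall>k\<in>chart_idx c. \<forall>l\<in>chart_idx c.
       smooth_fun_on (chart_idx c) (chart_map c ` chart_dom c) (metric_comp A g c k l))"

text \<open>
  Raised indices: the matrix H with the sum over q of H p q * G k q equal to the Kronecker delta of
  p and k, where the second index of both is the conjugated one.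
\<close>

definition inverse_metric :: "'d::finite set \<Rightarrow> ('d \<Rightarrow> 'd \<Rightarrow> complex) \<Rightarrow> 'd \<Rightarrow> 'd \<Rightarrow> complex"
  where "inverse_metric I G = (THE H.
    (\<forall>p q. p \<notin> I \<or> q \<notin> I \<longrightarrow> H p q = 0) \<and>
    (\<forall>p\<in>I. \<forall>k\<in>I. (\<Sum>q\<in>I. H p q * G k q) = (if p = k then 1 else 0)))"

definition chern_curvature ::
    "('a, 'd::finite) chart set \<Rightarrow> ('a \<Rightarrow> ('a, 'd) tangent \<Rightarrow> ('a, 'd) tangent \<Rightarrow> complex) \<Rightarrow>
     ('a, 'd) chart \<Rightarrow> complex^'d \<Rightarrow> 'd \<Rightarrow> 'd \<Rightarrow> 'd \<Rightarrow> 'd \<Rightarrow> complex"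
  where "chern_curvature A g c z i j k l =
    - d_dz i (d_dzbar j (metric_comp A g c k l)) z +
    (\<Sum>p\<in>chart_idx c. \<Sum>q\<in>chart_idx c.
       inverse_metric (chart_idx c) (\<lambda>a b. metric_comp A g c a b z) p q *
       d_dz i (metric_comp A g c k q) z * d_dzbar j (metric_comp A g c p l) z)"

text \<open>The contraction below is a real number, since g is Hermitian.\<close>

definition nonpos_bisectional_curvature ::
    "('a, 'd::finite) chart set \<Rightarrow> ('a \<Rightarrow> ('a, 'd) tangent \<Rightarrow> ('a, 'd) tangent \<Rightarrow> complex) \<Rightarrow> bool"
  where "nonpos_bisectional_curvature A g \<longleftrightarrow>
    (\<forall>x\<in>carrier_of A. \<forall>c\<in>A. x \<in> chart_dom c \<longrightarrow>
      (\<forall>u\<in>tangent_space A x. \<forall>v\<in>tangent_space A x.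
        Re (\<Sum>i\<in>chart_idx c. \<Sum>j\<in>chart_idx c. \<Sum>k\<in>chart_idx c. \<Sum>l\<in>chart_idx c.
              chern_curvature A g c (chart_map c x) i j k l *
              (u c $ i) * cnj (u c $ j) * (v c $ k) * cnj (v c $ l)) \<le> 0))"


section \<open>Line bundles and RC-positivity\<close>

text \<open>
  The data of a holomorphic line bundle: the fibres (one-dimensional subspaces of a vector space
  with the given scalar multiplication) and the local holomorphic frames, each on an open set,
  which together define the holomorphic structure.
\<close>

datatype ('x, 'v) line_bundle =
  Line_Bundle (fibre: "'x \<Rightarrow> 'v set") (scale: "complex \<Rightarrow> 'v \<Rightarrow> 'v")
    (frames: "('x set \<times> ('x \<Rightarrow> 'v)) set")

text \<open>The squared norm of a frame, as a function of the coordinates on the base.\<close>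

definition frame_norm2 ::
    "('x \<Rightarrow> 'v \<Rightarrow> 'v \<Rightarrow> complex) \<Rightarrow> ('x \<Rightarrow> 'v) \<Rightarrow> ('x, 'd::finite) chart \<Rightarrow> complex^'d \<Rightarrow> complex"
  where "frame_norm2 h e c z = h (chart_inv c z) (e (chart_inv c z)) (e (chart_inv c z))"

definition line_bundle_metric ::
    "('x, 'd::finite) chart set \<Rightarrow> ('x, 'v::ab_group_add) line_bundle \<Rightarrow>
     ('x \<Rightarrow> 'v \<Rightarrow> 'v \<Rightarrow> complex) \<Rightarrow> bool"
  where "line_bundle_metric A L h \<longleftrightarrow>
    (\<forall>x\<in>carrier_of A. hermitian_inner (scale L) (fibre L x) (h x)) \<and>
    (\<forall>c\<in>A. \<forall>(V, e)\<in>frames L.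
       smooth_fun_on (chart_idx c) (chart_map c ` (chart_dom c \<inter> V)) (frame_norm2 h e c))"

text \<open>
  The coefficients of the Chern curvature \<open>- \<i> \<partial>\<partial>bar log h\<close>, which is \<open>\<i>\<close> times the sum of
  \<open>\<Theta> i j dz\<^sub>i \<and> dzbar\<^sub>j\<close>, with h the squared norm of a local holomorphic frame.
\<close>

definition line_curvature ::
    "('x \<Rightarrow> 'v \<Rightarrow> 'v \<Rightarrow> complex) \<Rightarrow> ('x \<Rightarrow> 'v) \<Rightarrow> ('x, 'd::finite) chart \<Rightarrow> complex^'d \<Rightarrow> 'd \<Rightarrow> 'd \<Rightarrow> complex"
  where "line_curvature h e c z i j =
    - d_dz i (d_dzbar j (\<lambda>w. complex_of_real (ln (Re (frame_norm2 h e c w))))) z"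

definition matrix_eigenvalue :: "'d::finite set \<Rightarrow> ('d \<Rightarrow> 'd \<Rightarrow> complex) \<Rightarrow> complex \<Rightarrow> bool"
  where "matrix_eigenvalue I G \<mu> \<longleftrightarrow>
    (\<exists>v\<in>coord_space I. v \<noteq> 0 \<and> (\<forall>i\<in>I. (\<Sum>j\<in>I. G i j * v $ j) = \<mu> * v $ i))"

text \<open>
  The number of positive eigenvalues of the Hermitian coefficient matrix depends neither on the
  chart (Sylvester) nor on the frame (changing it adds a pluriharmonic function to log h).
\<close>

definition RC_positive ::
    "('x, 'd::finite) chart set \<Rightarrow> ('x, 'v::ab_group_add) line_bundle \<Rightarrow> bool"
  where "RC_positive A L \<longleftrightarrow>
    (\<exists>h. line_bundle_metric A L h \<and>
      (\<forall>x\<in>carrier_of A. \<forall>c\<in>A. \<forall>(V, e)\<in>frames L. x \<in> chart_dom c \<and> x \<in> V \<longrightarrow>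
        (\<exists>\<mu>>0. matrix_eigenvalue (chart_idx c) (line_curvature h e c (chart_map c x))
                   (complex_of_real \<mu>))))"


section \<open>The projectivized tangent bundle and its tautological line bundle\<close>

definition complex_line :: "('a, 'd::finite) tangent \<Rightarrow> ('a, 'd) tangent set"
  where "complex_line W = {tscale a W | a. True}"

type_synonym ('a, 'd) proj_tangent = "'a \<times> ('a, 'd) tangent set"

definition proj_tangent_points :: "('a, 'd::finite) chart set \<Rightarrow> ('a, 'd) proj_tangent set"
  where "proj_tangent_points A =
    {(p, complex_line W) | p W. p \<in> carrier_of A \<and> W \<in> tangent_space A p \<and> W \<noteq> 0}"

text \<open>Where the i-th homogeneous fibre coordinate in the chart c is nonzero.\<close>

definition affine_dom ::
    "('a, 'd::finite) chart set \<Rightarrow> ('a, 'd) chart \<Rightarrow> 'd \<Rightarrow> ('a, 'd) proj_tangent set"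
  where "affine_dom A c i =
    {(p, \<L>) \<in> proj_tangent_points A. p \<in> chart_dom c \<and> (\<exists>W\<in>\<L>. W c $ i \<noteq> 0)}"

text \<open>The point of the line whose i-th component in the chart c is 1.\<close>

definition affine_frame ::
    "('a, 'd::finite) chart \<Rightarrow> 'd \<Rightarrow> ('a, 'd) proj_tangent \<Rightarrow> ('a, 'd) tangent"
  where "affine_frame c i x = (THE W. W \<in> snd x \<and> W c $ i = 1)"

text \<open>
  The usual coordinates: those of the base point (left summand) and the quotients
  \<open>W\<^sub>k / W\<^sub>i\<close> for \<open>k \<noteq> i\<close> (right summand).
\<close>

definition affine_chart ::
    "('a, 'd::finite) chart set \<Rightarrow> ('a, 'd) chart \<Rightarrow> 'd \<Rightarrow> (('a, 'd) proj_tangent, 'd + 'd) chart"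
  where "affine_chart A c i = Chart (affine_dom A c i)
    (Inl ` chart_idx c \<union> Inr ` (chart_idx c - {i}))
    (\<lambda>x. \<chi> s. case s of Inl k \<Rightarrow> chart_map c (fst x) $ k
                    | Inr k \<Rightarrow> if k = i then 0 else affine_frame c i x c $ k)"

definition proj_tangent_atlas ::
    "('a, 'd::finite) chart set \<Rightarrow> (('a, 'd) proj_tangent, 'd + 'd) chart set"
  where "proj_tangent_atlas A = {affine_chart A c i | c i. c \<in> A \<and> i \<in> chart_idx c}"

definition tautological_bundle ::
    "('a, 'd::finite) chart set \<Rightarrow> (('a, 'd) proj_tangent, ('a, 'd) tangent) line_bundle"
  where "tautological_bundle A = Line_Bundle snd tscale
    {(affine_dom A c i, affine_frame c i) | c i. c \<in> A \<and> i \<in> chart_idx c}"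

lemma topspace_atlas_topology: "topspace (atlas_topology A) = carrier_of A"
  unfolding atlas_topology_def topology_generated_by_topspace carrier_of_def
proof (intro equalityI subsetI)
  fix p assume "p \<in> (\<Union>c\<in>A. chart_dom c)"
  then obtain c where "c \<in> A" "p \<in> {p \<in> chart_dom c. chart_map c p \<in> UNIV}"
    by auto
  then show "p \<in> \<Union> {{p \<in> chart_dom c. chart_map c p \<in> W} | c W. c \<in> A \<and> open W}"
    using open_UNIV by blast
qed auto

lemma affine_frame:
  assumes "x \<in> affine_dom A c i"
  shows "affine_frame c i x \<in> snd x" "affine_frame c i x c $ i = 1"
    "snd x = complex_line (affine_frame c i x)"
proof -
  obtain p W W' where x: "x = (p, complex_line W)" and W': "W' \<in> complex_line W" "W' c $ i \<noteq> 0"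
    using assms by (auto simp: affine_dom_def proj_tangent_points_def)
  have nz: "W c $ i \<noteq> 0"
    using W' by (auto simp: complex_line_def tscale_def)
  define E where "E = tscale (1 / (W c $ i)) W"
  have E: "E \<in> snd x \<and> E c $ i = 1"
    using nz by (auto simp: x E_def complex_line_def tscale_def)
  have uniq: "V = E" if "V \<in> snd x \<and> V c $ i = 1" for V
    using that nz by (auto simp: x E_def complex_line_def tscale_def field_simps)
  have eq: "affine_frame c i x = E"
    unfolding affine_frame_def using E uniq by (rule the_equality)
  show "affine_frame c i x \<in> snd x" "affine_frame c i x c $ i = 1"
    using E eq by auto
  have "tscale a W = tscale (a * W c $ i) E" for a
    using nz by (auto simp: E_def tscale_def fun_eq_iff vec_eq_iff)
  moreover have "tscale a E = tscale (a / W c $ i) W" for a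
    by (auto simp: E_def tscale_def fun_eq_iff vec_eq_iff)
  ultimately have "complex_line W = complex_line E"
    unfolding complex_line_def by blast
  then show "snd x = complex_line (affine_frame c i x)"
    by (simp add: eq) (simp add: x)
qed

lemma carrier_proj_tangent_atlas: "carrier_of (proj_tangent_atlas A) = proj_tangent_points A"
proof (intro equalityI subsetI)
  fix x assume "x \<in> carrier_of (proj_tangent_atlas A)"
  then show "x \<in> proj_tangent_points A"
    by (auto simp: carrier_of_def proj_tangent_atlas_def affine_chart_def affine_dom_def)
next
  fix x assume x: "x \<in> proj_tangent_points A"
  then obtain p W where pW: "x = (p, complex_line W)" "W \<in> tangent_space A p" "W \<noteq> 0"
    by (auto simp: proj_tangent_points_def)
  obtain c where c: "W c \<noteq> 0"
    using pW(3) by (auto simp: fun_eq_iff)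
  then have cA: "c \<in> A" "p \<in> chart_dom c" "W c \<in> coord_space (chart_idx c)"
    using pW(2) unfolding tangent_space_def by blast+
  obtain i where i: "W c $ i \<noteq> 0"
    using c by (auto simp: vec_eq_iff)
  with cA have "i \<in> chart_idx c"
    by (auto simp: coord_space_def)
  moreover have "W \<in> complex_line W"
    unfolding complex_line_def by (auto simp: tscale_def intro!: exI[of _ 1])
  then have "x \<in> affine_dom A c i"
    using x i cA pW(1) by (auto simp: affine_dom_def)
  then have "x \<in> chart_dom (affine_chart A c i)"
    by (simp add: affine_chart_def)
  ultimately show "x \<in> carrier_of (proj_tangent_atlas A)"
    using cA(1) unfolding carrier_of_def proj_tangent_atlas_def by blast
qed

end

theory Submission
  imports Defs "HOL-Complex_Analysis.Cauchy_Integral_Formula"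
begin

text \<open>
  Let h be an RC-positive metric of the tautological bundle, g a metric of N with non-positive
  holomorphic bisectional curvature, and consider the function
  \<open>\<Phi> (p, [W]) = g (df W, df W) / h (W, W)\<close> on the projectivized tangent bundle of M. It does
  not depend on the length of W (\<open>norm_quotient_eq\<close>), it is continuous, and since M is compact it
  attains a maximum (\<open>norm_quotient_attains_max\<close>).

  This maximum is not positive (\<open>norm_quotient_max_nonpos\<close>). Suppose it is, and let \<open>z\<^sub>0\<close> be the
  coordinates of a maximum point in an affine chart, e the holomorphic frame belonging to this
  chart, and u a direction in which the curvature of h is positive. Along the disc
  \<open>\<zeta> \<mapsto> z\<^sub>0 + \<zeta> u\<close> put \<open>G = g (df e, df e)\<close> and \<open>H = h (e, e)\<close>. The choice of u says that the
  Laplacian of \<open>log H\<close> is negative at 0, that is \<open>H \<Delta>H < \<bar>\<nabla>H\<bar>\<^sup>2\<close> (\<open>Levi_contraction_ln\<close>). On the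
  other hand \<open>df e\<close> is a holomorphic section, along the disc, of the pull-back of the tangent
  bundle of N, which is non-positively curved, so \<open>log G\<close> is subharmonic at 0:
  \<open>G \<Delta>G \<ge> \<bar>\<nabla>G\<bar>\<^sup>2\<close> (\<open>bisectional_log_convexity\<close>). But \<open>G \<le> c H\<close> near 0 with equality at 0, where c
  is the maximum, so that \<open>\<nabla>G = c \<nabla>H\<close> and \<open>\<Delta>G \<le> c \<Delta>H\<close> there, and the two inequalities contradict each other.

  Hence \<open>\<Phi> \<le> 0\<close>, and df vanishes because g is positive definite. So f is locally constant
  (\<open>locally_constant\<close>), and constant because M is connected.

  Laplacians are computed as the sum of the second derivatives along the two real curves obtained
  by restricting to the rays \<open>\<zeta> = t\<close> and \<open>\<zeta> = \<i> t\<close>. For a holomorphic curve the accelerations along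
  the two rays are opposite, so first-order terms cancel and only the Levi form survives.
  Two facts from analysis make these computations possible. Functions whose iterated directional
  derivatives are continuous are differentiable (\<open>C1_differentiable_on\<close>), so directional
  derivatives are linear in the direction. For holomorphic maps, only differentiability at each
  point is postulated; Cauchy's inequality shows that difference quotients converge locally uniformly
  in the point and the direction (\<open>difference_quotient_uniform_limit\<close>), whence the derivative is
  continuous and again holomorphic.
\<close>


section \<open>Calculus in coordinate subspaces\<close>

lemma coord_space_0 [simp]: "0 \<in> coord_space I"
  by (simp add: coord_space_def)

lemma coord_space_add: "x \<in> coord_space I \<Longrightarrow> y \<in> coord_space I \<Longrightarrow> x + y \<in> coord_space I"
  by (simp add: coord_space_def)

lemma coord_space_diff: "x \<in> coord_space I \<Longrightarrow> y \<in> coord_space I \<Longrightarrow> x - y \<in> coord_space I"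
  by (simp add: coord_space_def)

lemma coord_space_scale: "x \<in> coord_space I \<Longrightarrow> a *s x \<in> coord_space I"
  by (simp add: coord_space_def)

lemma coord_space_scaleR: "x \<in> coord_space I \<Longrightarrow> r *\<^sub>R x \<in> coord_space I"
  by (simp add: coord_space_def)

lemma coord_space_axis: "k \<in> I \<Longrightarrow> axis k a \<in> coord_space I"
  by (auto simp: coord_space_def axis_def)

lemma coord_space_sum: "(\<And>i. i \<in> A \<Longrightarrow> f i \<in> coord_space I) \<Longrightarrow> sum f A \<in> coord_space I"
  by (simp add: coord_space_def)

lemmas coord_space_intros =
  coord_space_add coord_space_diff coord_space_scale coord_space_scaleR coord_space_axis
  coord_space_sum

lemma closed_coord_space: "closed (coord_space I :: (complex^'d::finite) set)"
proof -
  have "closed {z :: complex^'d. z $ k = 0}" for k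
    by (intro closed_Collect_eq continuous_intros)
  moreover have "coord_space I = (\<Inter>k\<in>- I. {z :: complex^'d. z $ k = 0})"
    by (auto simp: coord_space_def)
  ultimately show ?thesis by (auto intro!: closed_INT)
qed

lemma scaleR_vec_eq_scale: "r *\<^sub>R (v :: complex^'d) = complex_of_real r *s v"
  by (auto simp: vec_eq_iff) (simp add: scaleR_conv_of_real)

lemma coord_space_expand:
  assumes "v \<in> coord_space I"
  shows "v = (\<Sum>k\<in>I. Re (v $ k) *\<^sub>R axis k 1 + Im (v $ k) *\<^sub>R axis k \<i>)"
proof -
  have "(\<Sum>k\<in>I. Re (v $ k) *\<^sub>R axis k 1 + Im (v $ k) *\<^sub>R axis k \<i>) $ j = v $ j" for j
  proof -
    have "(\<Sum>k\<in>I. Re (v $ k) *\<^sub>R axis k 1 + Im (v $ k) *\<^sub>R axis k \<i>) $ j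
        = (\<Sum>k\<in>I. if k = j then v $ k else 0)"
      unfolding sum_component
      by (intro sum.cong) (auto simp: axis_def complex_eq_iff)
    also have "\<dots> = v $ j" using assms by (auto simp: coord_space_def)
    finally show ?thesis .
  qed
  then show ?thesis by (simp add: vec_eq_iff)
qed

lemma coord_space_expand_complex:
  assumes "v \<in> coord_space I"
  shows "v = (\<Sum>k\<in>I. v $ k *s axis k 1)"
proof -
  have "(\<Sum>k\<in>I. v $ k *s axis k 1) $ j = v $ j" for j
  proof -
    have "(\<Sum>k\<in>I. v $ k *s axis k 1) $ j = (\<Sum>k\<in>I. if k = j then v $ k else 0)"
      unfolding sum_component by (intro sum.cong) (auto simp: axis_def)
    also have "\<dots> = v $ j" using assms by (auto simp: coord_space_def)
    finally show ?thesis .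
  qed
  then show ?thesis by (simp add: vec_eq_iff)
qed

abbreviation openin_coord :: "'d::finite set \<Rightarrow> (complex^'d) set \<Rightarrow> bool"
  where "openin_coord I S \<equiv> openin (top_of_set (coord_space I)) S"

lemma openin_coord_subset: "openin_coord I S \<Longrightarrow> S \<subseteq> coord_space I"
  using openin_imp_subset by fastforce

lemma openin_coord_ball:
  assumes "openin_coord I S" "x \<in> S"
  obtains e where "e > 0" "\<And>y. y \<in> coord_space I \<Longrightarrow> dist y x < e \<Longrightarrow> y \<in> S"
  using assms unfolding openin_euclidean_subtopology_iff by blast

text \<open>
  A set that is only relatively open in a coordinate subspace becomes open in the parameter space when
  pulled back along a curve running inside the subspace; this is what lets one differentiate along
  curves without restricting the parameter.
\<close>

lemma open_preimage_coord:
  fixes \<gamma> :: "'t::real_normed_vector \<Rightarrow> complex^'d::finite"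
  assumes "openin_coord I S" "open T" "continuous_on T \<gamma>" "\<And>t. t \<in> T \<Longrightarrow> \<gamma> t \<in> coord_space I"
  shows "open {t \<in> T. \<gamma> t \<in> S}"
proof -
  obtain U where U: "open U" "S = coord_space I \<inter> U"
    using assms(1) by (auto simp: openin_open)
  have "open (T \<inter> \<gamma> -` U)"
    using assms(2,3) U(1) by (metis continuous_on_open_vimage Int_commute)
  moreover have "{t \<in> T. \<gamma> t \<in> S} = T \<inter> \<gamma> -` U" using assms(4) U by auto
  ultimately show ?thesis by simp
qed

lemma has_derivative_compose_within:
  assumes "(F has_derivative D) (at (\<gamma> t) within S)" "(\<gamma> has_derivative E) (at t)"
    "open T" "t \<in> T" "\<And>\<tau>. \<tau> \<in> T \<Longrightarrow> \<gamma> \<tau> \<in> S"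
  shows "((\<lambda>\<tau>. F (\<gamma> \<tau>)) has_derivative (\<lambda>h. D (E h))) (at t)"
proof -
  have "(\<gamma> has_derivative E) (at t within T)" using assms(2) has_derivative_at_withinI by blast
  moreover have "(F has_derivative D) (at (\<gamma> t) within \<gamma> ` T)"
    using assms(1) by (rule has_derivative_subset) (use assms in auto)
  ultimately have "((\<lambda>\<tau>. F (\<gamma> \<tau>)) has_derivative (\<lambda>h. D (E h))) (at t within T)"
    by (rule has_derivative_in_compose)
  then show ?thesis using at_within_open[OF assms(4,3)] by simp
qed

lemma line_in_coord:
  assumes "openin_coord I S" "x \<in> S" "v \<in> coord_space I"
  obtains T where "open T" "(0::real) \<in> T" "\<And>t. t \<in> T \<Longrightarrow> x + t *\<^sub>R v \<in> S"
proof -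
  have x: "x \<in> coord_space I" using assms openin_coord_subset by auto
  have "open {t \<in> (UNIV::real set). x + t *\<^sub>R v \<in> S}"
  proof (rule open_preimage_coord[OF assms(1) open_UNIV])
    show "continuous_on UNIV (\<lambda>t::real. x + t *\<^sub>R v)" by (intro continuous_intros)
    show "x + t *\<^sub>R v \<in> coord_space I" for t :: real by (intro coord_space_intros x assms)
  qed
  then show ?thesis using assms(2) by (intro that[of "{t \<in> UNIV. x + t *\<^sub>R v \<in> S}"]) auto
qed

lemma has_derivative_line:
  assumes "openin_coord I S" "x \<in> S" "v \<in> coord_space I" "(F has_derivative D) (at x within S)"
  shows "((\<lambda>t::real. F (x + t *\<^sub>R v)) has_vector_derivative D v) (at 0)"
proof -
  obtain T where T: "open T" "(0::real) \<in> T" "\<And>t. t \<in> T \<Longrightarrow> x + t *\<^sub>R v \<in> S"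
    using line_in_coord assms by blast
  interpret bounded_linear D using assms(4) by (rule has_derivative_bounded_linear)
  have "((\<lambda>t::real. F (x + t *\<^sub>R v)) has_derivative (\<lambda>h. D (h *\<^sub>R v))) (at 0)"
    by (rule has_derivative_compose_within[OF _ _ T(1,2), where S = S])
       (use assms T in \<open>auto intro!: derivative_eq_intros\<close>)
  then show ?thesis by (simp add: has_vector_derivative_def scale)
qed

lemma dirderiv_eq:
  assumes "openin_coord I S" "x \<in> S" "v \<in> coord_space I" "(F has_derivative D) (at x within S)"
  shows "dirderiv F v x = D v"
  unfolding dirderiv_def using has_derivative_line[OF assms] by (rule vector_derivative_at)

lemma dirderiv_cong:
  assumes "openin_coord I S" "x \<in> S" "v \<in> coord_space I" "\<And>y. y \<in> S \<Longrightarrow> F y = G y"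
  shows "dirderiv F v x = dirderiv G v x"
proof -
  obtain T where T: "open T" "(0::real) \<in> T" "\<And>t. t \<in> T \<Longrightarrow> x + t *\<^sub>R v \<in> S"
    using line_in_coord assms by blast
  have "\<forall>\<^sub>F t in nhds 0. F (x + t *\<^sub>R v) = G (x + t *\<^sub>R v)"
    using T assms(4) by (auto simp: eventually_nhds)
  then show ?thesis unfolding dirderiv_def by (intro vector_derivative_cong_eq) auto
qed

lemma differentiable_on_dirderiv:
  assumes "openin_coord I S" "F differentiable_on S" "x \<in> S"
  obtains D where "(F has_derivative D) (at x within S)" "linear D"
    "\<And>v. v \<in> coord_space I \<Longrightarrow> dirderiv F v x = D v"
proof -
  obtain D where D: "(F has_derivative D) (at x within S)"
    using assms by (auto simp: differentiable_on_def differentiable_def)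
  then show ?thesis
    using that[of D] dirderiv_eq[OF assms(1,3) _ D] has_derivative_linear by blast
qed

text \<open>
  The derivative within \<open>S\<close> is determined on the coordinate subspace only, and there it is the
  directional derivative; real-linearity does the rest. The expansion separates the direction from the
  point, so that both can vary along a curve.
\<close>

lemma dirderiv_expand:
  assumes "openin_coord I S" "F differentiable_on S" "x \<in> S" "v \<in> coord_space I"
  shows "dirderiv F v x =
    (\<Sum>k\<in>I. Re (v $ k) *\<^sub>R dirderiv F (axis k 1) x + Im (v $ k) *\<^sub>R dirderiv F (axis k \<i>) x)"
proof -
  obtain D where D: "linear D" "\<And>v. v \<in> coord_space I \<Longrightarrow> dirderiv F v x = D v"
    using differentiable_on_dirderiv[OF assms(1-3)] by metis
  have "D v = D (\<Sum>k\<in>I. Re (v $ k) *\<^sub>R axis k 1 + Im (v $ k) *\<^sub>R axis k \<i>)"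
    using coord_space_expand[OF assms(4)] by simp
  also have "\<dots> = (\<Sum>k\<in>I. Re (v $ k) *\<^sub>R D (axis k 1) + Im (v $ k) *\<^sub>R D (axis k \<i>))"
    using D(1) by (simp add: linear_sum linear_add linear_scale)
  also have "\<dots> = (\<Sum>k\<in>I. Re (v $ k) *\<^sub>R dirderiv F (axis k 1) x + Im (v $ k) *\<^sub>R dirderiv F (axis k \<i>) x)"
    by (intro sum.cong) (auto simp: D(2) coord_space_axis)
  finally show ?thesis using D(2) assms(4) by simp
qed

text \<open>
  The mean value inequality for \<open>F\<close> minus its linear part along the segment from \<open>y\<close> to
  \<open>y + t *\<^sub>R b\<close>. The base point \<open>y\<close> has to vary, since moving in several directions one after another changes it.
\<close>

lemma C1_direction_estimate:
  fixes F :: "complex^'d::finite \<Rightarrow> complex"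
  assumes S: "openin_coord I S" and C1: "Ck_on (Suc 0) I S F" and x: "x \<in> S"
    and b: "b \<in> coord_space I" and e: "e > 0"
  obtains d where "d > 0" "\<And>y t. y \<in> coord_space I \<Longrightarrow> dist y x < d \<Longrightarrow> \<bar>t\<bar> < d \<Longrightarrow>
    norm (F (y + t *\<^sub>R b) - F y - t *\<^sub>R dirderiv F b x) \<le> e * \<bar>t\<bar>"
proof -
  obtain r where r: "r > 0" "\<And>y. y \<in> coord_space I \<Longrightarrow> dist y x < r \<Longrightarrow> y \<in> S"
    using openin_coord_ball[OF S x] by blast
  have "continuous_on S (dirderiv F b)" using C1 b by simp
  then obtain r' where r': "r' > 0"
    "\<And>y. y \<in> S \<Longrightarrow> dist y x < r' \<Longrightarrow> dist (dirderiv F b y) (dirderiv F b x) < e"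
    using x e unfolding continuous_on_iff by meson
  define \<rho> where "\<rho> = min r r'"
  define d where "d = \<rho> / (2 * (1 + norm b))"
  have \<rho>: "\<rho> > 0" using r r' by (simp add: \<rho>_def)
  have nb: "0 < 1 + norm b" by (simp add: add_pos_nonneg)
  have d: "d > 0" using \<rho> nb unfolding d_def by simp
  have dr: "d * (1 + norm b) \<le> \<rho> / 2" using nb unfolding d_def by (simp add: field_simps)
  show ?thesis
  proof (rule that[OF d])
    fix y t assume y: "y \<in> coord_space I" "dist y x < d" and t: "\<bar>t\<bar> < d"
    have near: "y + s *\<^sub>R b \<in> S \<and> dist (y + s *\<^sub>R b) x < r'" if "\<bar>s\<bar> \<le> \<bar>t\<bar>" for s
    proof -
      have "dist (y + s *\<^sub>R b) x \<le> dist y x + \<bar>s\<bar> * norm b"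
        using norm_triangle_ineq[of "y - x" "s *\<^sub>R b"] by (simp add: dist_norm algebra_simps)
      also have "\<dots> < d + d * norm b"
        using y(2) that t by (intro add_less_le_mono mult_right_mono) auto
      also have "\<dots> \<le> \<rho> / 2" using dr by (simp add: algebra_simps)
      also have "\<dots> < \<rho>" using \<rho> by simp
      finally have "dist (y + s *\<^sub>R b) x < \<rho>" .
      then show ?thesis using r(2)[of "y + s *\<^sub>R b"] y b by (auto simp: \<rho>_def coord_space_intros)
    qed
    define q where "q = (\<lambda>s. F (y + s *\<^sub>R b) - s *\<^sub>R dirderiv F b x)"
    have der: "(q has_vector_derivative (dirderiv F b (y + s *\<^sub>R b) - dirderiv F b x)) (at s)"
      if s: "\<bar>s\<bar> \<le> \<bar>t\<bar>" for s
    proof -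
      have "(\<lambda>\<tau>. F (y + s *\<^sub>R b + \<tau> *\<^sub>R b)) differentiable (at 0)"
        using C1 b near[OF s] by simp
      then have "((\<lambda>\<tau>. F (y + s *\<^sub>R b + \<tau> *\<^sub>R b)) has_vector_derivative dirderiv F b (y + s *\<^sub>R b)) (at 0)"
        unfolding dirderiv_def vector_derivative_works by simp
      then have "((\<lambda>\<tau>. F (y + s *\<^sub>R b + \<tau> *\<^sub>R b)) \<circ> (\<lambda>\<tau>. \<tau> - s) has_vector_derivative 1 *\<^sub>R dirderiv F b (y + s *\<^sub>R b)) (at s)"
        by (intro vector_diff_chain_at) (auto intro!: derivative_eq_intros)
      then have "((\<lambda>\<tau>. F (y + \<tau> *\<^sub>R b)) has_vector_derivative dirderiv F b (y + s *\<^sub>R b)) (at s)"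
        by (simp add: o_def algebra_simps)
      then show ?thesis unfolding q_def by (auto intro!: derivative_eq_intros)
    qed
    have "norm (q t - q 0) \<le> e * norm (t - 0)"
    proof (rule differentiable_bound[where f' = "\<lambda>s h. h *\<^sub>R (dirderiv F b (y + s *\<^sub>R b) - dirderiv F b x)"
            and S = "{- \<bar>t\<bar>..\<bar>t\<bar>}"])
      fix s assume s: "s \<in> {- \<bar>t\<bar>..\<bar>t\<bar>}"
      then have s': "\<bar>s\<bar> \<le> \<bar>t\<bar>" by auto
      show "(q has_derivative (\<lambda>h. h *\<^sub>R (dirderiv F b (y + s *\<^sub>R b) - dirderiv F b x))) (at s within {- \<bar>t\<bar>..\<bar>t\<bar>})"
        using der[OF s'] unfolding has_vector_derivative_def by (rule has_derivative_at_withinI)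
      have "norm (dirderiv F b (y + s *\<^sub>R b) - dirderiv F b x) \<le> e"
        using r'(2) near[OF s'] by (auto simp: dist_norm intro: less_imp_le)
      then show "onorm (\<lambda>h. h *\<^sub>R (dirderiv F b (y + s *\<^sub>R b) - dirderiv F b x)) \<le> e"
        by (intro onorm_le) (simp add: mult.commute[of e] mult_left_mono)
    qed auto
    then show "norm (F (y + t *\<^sub>R b) - F y - t *\<^sub>R dirderiv F b x) \<le> e * \<bar>t\<bar>"
      by (simp add: q_def algebra_simps)
  qed
qed

text \<open>
  Going from \<open>y\<close> to the sum one direction at a time, each step is controlled by the
  previous lemma; the distance to \<open>x\<close> grows by at most \<open>d * norm b\<close> in a step, which is why \<open>d\<close> has
  to shrink in the induction.
\<close>

lemma C1_multi_direction_estimate: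
  fixes F :: "complex^'d::finite \<Rightarrow> complex"
  assumes S: "openin_coord I S" and C1: "Ck_on (Suc 0) I S F" and x: "x \<in> S"
    and B: "finite B" "B \<subseteq> coord_space I" and e: "e > 0"
  shows "\<exists>d>0. \<forall>y c. y \<in> coord_space I \<and> dist y x < d \<and> (\<forall>b\<in>B. \<bar>c b\<bar> < d) \<longrightarrow>
    norm (F (y + (\<Sum>b\<in>B. c b *\<^sub>R b)) - F y - (\<Sum>b\<in>B. c b *\<^sub>R dirderiv F b x)) \<le> e * (\<Sum>b\<in>B. \<bar>c b\<bar>)"
  using B
proof (induction B rule: finite_induct)
  case empty
  then show ?case by (auto intro: exI[of _ 1])
next
  case (insert b B)
  obtain d1 where d1: "d1 > 0" and est1: "\<And>y c. y \<in> coord_space I \<Longrightarrow> dist y x < d1 \<Longrightarrow> \<forall>b\<in>B. \<bar>c b\<bar> < d1 \<Longrightarrow>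
    norm (F (y + (\<Sum>b\<in>B. c b *\<^sub>R b)) - F y - (\<Sum>b\<in>B. c b *\<^sub>R dirderiv F b x)) \<le> e * (\<Sum>b\<in>B. \<bar>c b\<bar>)"
    using insert by auto
  have b: "b \<in> coord_space I" using insert by auto
  obtain d2 where d2: "d2 > 0" and est2: "\<And>y t. y \<in> coord_space I \<Longrightarrow> dist y x < d2 \<Longrightarrow> \<bar>t\<bar> < d2 \<Longrightarrow>
    norm (F (y + t *\<^sub>R b) - F y - t *\<^sub>R dirderiv F b x) \<le> e * \<bar>t\<bar>"
    using C1_direction_estimate[OF S C1 x b e] by blast
  define d where "d = min (d1 / (2 * (1 + norm b))) (min (d1/2) d2)"
  have nb: "0 < 1 + norm b" by (simp add: add_pos_nonneg)
  have d: "d > 0" using d1 d2 nb by (simp add: d_def)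
  define c where "c = 1 + norm b"
  have "d \<le> d1 / (2 * c)" by (simp add: d_def c_def)
  moreover have "c > 0" using nb by (simp add: c_def)
  ultimately have "d * c \<le> d1/2" by (simp add: field_simps)
  then have dd: "d * (1 + norm b) \<le> d1/2" by (simp add: c_def)
  have dn: "d * norm b \<le> d1/2" using dd d by (simp add: algebra_simps)
  have dle: "d \<le> d1/2" "d \<le> d2"
    unfolding d_def by (rule min.coboundedI2[OF min.cobounded1], rule min.coboundedI2[OF min.cobounded2])
  show ?case
  proof (intro exI[of _ d] conjI d allI impI)
    fix y c assume A: "y \<in> coord_space I \<and> dist y x < d \<and> (\<forall>b\<in>insert b B. \<bar>c b\<bar> < d)"
    let ?y = "y + c b *\<^sub>R b"
    have "dist ?y x \<le> dist y x + \<bar>c b\<bar> * norm b"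
      using norm_triangle_ineq[of "y - x" "c b *\<^sub>R b"] by (simp add: dist_norm algebra_simps)
    also have "\<dots> < d + d * norm b"
      using A by (intro add_less_le_mono mult_right_mono) (auto intro: less_imp_le)
    also have "\<dots> \<le> d1" using dn dle by simp
    finally have "dist ?y x < d1" .
    then have 1: "norm (F (?y + (\<Sum>b\<in>B. c b *\<^sub>R b)) - F ?y - (\<Sum>b\<in>B. c b *\<^sub>R dirderiv F b x)) \<le> e * (\<Sum>b\<in>B. \<bar>c b\<bar>)"
      using A dle d by (intro est1) (auto simp: b coord_space_intros)
    have 2: "norm (F ?y - F y - c b *\<^sub>R dirderiv F b x) \<le> e * \<bar>c b\<bar>"
      using A dle by (intro est2) auto
    have eq: "F (y + (\<Sum>b\<in>insert b B. c b *\<^sub>R b)) - F y - (\<Sum>b\<in>insert b B. c b *\<^sub>R dirderiv F b x)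
      = (F (?y + (\<Sum>b\<in>B. c b *\<^sub>R b)) - F ?y - (\<Sum>b\<in>B. c b *\<^sub>R dirderiv F b x)) + (F ?y - F y - c b *\<^sub>R dirderiv F b x)"
      using insert by (simp add: algebra_simps)
    show "norm (F (y + (\<Sum>b\<in>insert b B. c b *\<^sub>R b)) - F y - (\<Sum>b\<in>insert b B. c b *\<^sub>R dirderiv F b x))
      \<le> e * (\<Sum>b\<in>insert b B. \<bar>c b\<bar>)"
      unfolding eq using norm_triangle_le[OF add_mono[OF 1 2]] insert
      by (simp add: algebra_simps)
  qed
qed

lemma coord_space_expand_real_basis:
  fixes v :: "complex^'d::finite"
  assumes "v \<in> coord_space I"
  shows "v = (\<Sum>b\<in>Basis \<inter> coord_space I. (v \<bullet> b) *\<^sub>R b)"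
proof -
  have "v \<bullet> b = 0" if "b \<in> Basis" "b \<notin> coord_space I" for b
  proof -
    obtain k a where "b = axis k a" using \<open>b \<in> Basis\<close> by (auto simp: Basis_vec_def)
    moreover from this have "k \<notin> I" using that coord_space_axis by blast
    ultimately show ?thesis using assms by (simp add: inner_axis coord_space_def)
  qed
  then have "(\<Sum>b\<in>Basis \<inter> coord_space I. (v \<bullet> b) *\<^sub>R b) = (\<Sum>b\<in>Basis. (v \<bullet> b) *\<^sub>R b)"
    by (intro sum.mono_neutral_left) auto
  then show ?thesis by (simp add: euclidean_representation)
qed

text \<open>
  The several-variable argument that continuous partial derivatives imply differentiability, with the
  standard real basis vectors inside the coordinate subspace as directions.
\<close>

lemma C1_differentiable_on:
  fixes F :: "complex^'d::finite \<Rightarrow> complex"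
  assumes S: "openin_coord I S" and C1: "Ck_on (Suc 0) I S F"
  shows "F differentiable_on S"
  unfolding differentiable_on_def
proof
  fix x assume x: "x \<in> S"
  define B where "B = Basis \<inter> coord_space I"
  define D where "D = (\<lambda>v. \<Sum>b\<in>B. (v \<bullet> b) *\<^sub>R dirderiv F b x)"
  have B: "finite B" "B \<subseteq> coord_space I" by (auto simp: B_def)
  have "(F has_derivative D) (at x within S)"
    unfolding has_derivative_within_alt
  proof (intro conjI allI impI)
    show "bounded_linear D"
      unfolding D_def by (intro bounded_linear_sum bounded_linear_scaleR_left[THEN bounded_linear_compose] bounded_linear_inner_left)
    fix e :: real assume e: "e > 0"
    define e' where "e' = e / (1 + real (card B))"
    have e': "e' > 0" using e by (simp add: e'_def add_pos_nonneg)
    obtain d where d: "d > 0" and est: "\<And>y c. y \<in> coord_space I \<Longrightarrow> dist y x < d \<Longrightarrow> \<forall>b\<in>B. \<bar>c b\<bar> < d \<Longrightarrow>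
      norm (F (y + (\<Sum>b\<in>B. c b *\<^sub>R b)) - F y - (\<Sum>b\<in>B. c b *\<^sub>R dirderiv F b x)) \<le> e' * (\<Sum>b\<in>B. \<bar>c b\<bar>)"
      using C1_multi_direction_estimate[OF S C1 x B e'] by blast
    have "norm (F y - F x - D (y - x)) \<le> e * norm (y - x)" if y: "y \<in> S" "norm (y - x) < d" for y
    proof -
      have xy: "x \<in> coord_space I" "y \<in> coord_space I" using x y openin_coord_subset[OF S] by auto
      have sum: "x + (\<Sum>b\<in>B. ((y - x) \<bullet> b) *\<^sub>R b) = y"
        using coord_space_expand_real_basis[of "y - x" I] xy by (simp add: B_def coord_space_diff)
      have cb: "\<bar>(y - x) \<bullet> b\<bar> \<le> norm (y - x)" if "b \<in> B" for b
        using that Basis_le_norm by (auto simp: B_def)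
      have "norm (F (x + (\<Sum>b\<in>B. ((y - x) \<bullet> b) *\<^sub>R b)) - F x - D (y - x)) \<le> e' * (\<Sum>b\<in>B. \<bar>(y - x) \<bullet> b\<bar>)"
        unfolding D_def using xy d y(2) cb by (intro est) (auto intro: le_less_trans)
      also have "\<dots> \<le> e' * (real (card B) * norm (y - x))"
        using cb e' by (intro mult_left_mono sum_bounded_above) auto
      also have "\<dots> \<le> e' * ((1 + real (card B)) * norm (y - x))"
        using e' by (intro mult_left_mono mult_right_mono) auto
      also have "\<dots> = e * norm (y - x)" by (simp add: e'_def add_pos_nonneg field_simps add_nonneg_eq_0_iff)
      finally show ?thesis by (simp add: sum)
    qed
    then show "\<exists>d>0. \<forall>y\<in>S. norm (y - x) < d \<longrightarrow> norm (F y - F x - D (y - x)) \<le> e * norm (y - x)"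
      using d by blast
  qed
  then show "F differentiable at x within S" by (auto simp: differentiable_def)
qed


text \<open>
  The regularity that second derivatives along curves need: \<open>F\<close> and its directional derivatives are
  Frechet differentiable within \<open>S\<close>.
\<close>

definition C2_on :: "'d::finite set \<Rightarrow> (complex^'d) set \<Rightarrow> (complex^'d \<Rightarrow> complex) \<Rightarrow> bool"
  where "C2_on I S F \<longleftrightarrow> F differentiable_on S \<and> (\<forall>v\<in>coord_space I. dirderiv F v differentiable_on S)"

lemma smooth_fun_on_imp_C2_on:
  assumes "openin_coord I S" "smooth_fun_on I S F"
  shows "C2_on I S F"
proof -
  have "Ck_on (Suc 0) I S F" "Ck_on (Suc (Suc 0)) I S F"
    using assms(2) unfolding smooth_fun_on_def by blast+
  then show ?thesis
    unfolding C2_on_def by (auto intro!: C1_differentiable_on[OF assms(1)])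
qed

lemma dirderiv_bounded_linear:
  assumes "openin_coord I S" "F differentiable_on S" "x \<in> S" "v \<in> coord_space I" "bounded_linear L"
  shows "dirderiv (\<lambda>y. L (F y)) v x = L (dirderiv F v x)"
proof -
  obtain D where D: "(F has_derivative D) (at x within S)" "\<And>v. v \<in> coord_space I \<Longrightarrow> dirderiv F v x = D v"
    using differentiable_on_dirderiv[OF assms(1-3)] by metis
  have "((\<lambda>y. L (F y)) has_derivative (\<lambda>v. L (D v))) (at x within S)"
    by (rule bounded_linear.has_derivative[OF assms(5) D(1)])
  from dirderiv_eq[OF assms(1,3,4) this] show ?thesis using D(2) assms(4) by simp
qed

lemma dirderiv_sum_mult:
  fixes G :: "'i \<Rightarrow> complex^'d::finite \<Rightarrow> complex"
  assumes "openin_coord I S" "\<And>j. j \<in> J \<Longrightarrow> G j differentiable_on S" "x \<in> S" "v \<in> coord_space I"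
  shows "dirderiv (\<lambda>y. \<Sum>j\<in>J. a j * G j y) v x = (\<Sum>j\<in>J. a j * dirderiv (G j) v x)"
proof -
  have "\<exists>D. \<forall>j\<in>J. (G j has_derivative D j) (at x within S)"
    using assms(2,3) by (intro bchoice) (auto simp: differentiable_on_def differentiable_def)
  then obtain D where D: "\<And>j. j \<in> J \<Longrightarrow> (G j has_derivative D j) (at x within S)" by blast
  have "((\<lambda>y. \<Sum>j\<in>J. a j * G j y) has_derivative (\<lambda>v. \<Sum>j\<in>J. a j * D j v)) (at x within S)"
    by (intro has_derivative_sum has_derivative_mult_right D)
  from dirderiv_eq[OF assms(1,3,4) this] show ?thesis
    using dirderiv_eq[OF assms(1,3,4) D] by simp
qed

lemma differentiable_on_sum_mult:
  fixes G :: "'i \<Rightarrow> complex^'d::finite \<Rightarrow> complex"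
  assumes "finite J" "\<And>j. j \<in> J \<Longrightarrow> G j differentiable_on S"
  shows "(\<lambda>y. \<Sum>j\<in>J. a j * G j y) differentiable_on S"
  using assms by (auto simp: differentiable_on_def intro!: differentiable_sum differentiable_mult)

lemma dirderiv2_expand:
  assumes S: "openin_coord I S" and F: "C2_on I S F" and x: "x \<in> S"
    and w: "w \<in> coord_space I" and v: "v \<in> coord_space I"
  shows "dirderiv (dirderiv F w) v x =
    (\<Sum>k\<in>I. Re (w $ k) *\<^sub>R dirderiv (dirderiv F (axis k 1)) v x + Im (w $ k) *\<^sub>R dirderiv (dirderiv F (axis k \<i>)) v x)"
proof -
  have F': "F differentiable_on S" "\<And>k a. k \<in> I \<Longrightarrow> dirderiv F (axis k a) differentiable_on S"
    using F by (auto simp: C2_on_def coord_space_axis)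
  define D where "D = (\<lambda>k a. SOME D. (dirderiv F (axis k a) has_derivative D) (at x within S))"
  have D: "(dirderiv F (axis k a) has_derivative D k a) (at x within S)" if "k \<in> I" for k a
  proof -
    have "\<exists>D. (dirderiv F (axis k a) has_derivative D) (at x within S)"
      using F'(2)[OF that, of a] x unfolding differentiable_on_def differentiable_def by blast
    then show ?thesis unfolding D_def by (rule someI_ex)
  qed
  have D': "dirderiv (dirderiv F (axis k a)) v x = D k a v" if "k \<in> I" for k a
    by (rule dirderiv_eq[OF S x v D[OF that]])
  have "((\<lambda>y. \<Sum>k\<in>I. Re (w $ k) *\<^sub>R dirderiv F (axis k 1) y + Im (w $ k) *\<^sub>R dirderiv F (axis k \<i>) y)
     has_derivative (\<lambda>v. \<Sum>k\<in>I. Re (w $ k) *\<^sub>R D k 1 v + Im (w $ k) *\<^sub>R D k \<i> v)) (at x within S)"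
    by (intro has_derivative_sum has_derivative_add has_derivative_scaleR_right D)
  from dirderiv_eq[OF S x v this]
  have "dirderiv (\<lambda>y. \<Sum>k\<in>I. Re (w $ k) *\<^sub>R dirderiv F (axis k 1) y + Im (w $ k) *\<^sub>R dirderiv F (axis k \<i>) y) v x
      = (\<Sum>k\<in>I. Re (w $ k) *\<^sub>R D k 1 v + Im (w $ k) *\<^sub>R D k \<i> v)" .
  moreover have "dirderiv (dirderiv F w) v x
     = dirderiv (\<lambda>y. \<Sum>k\<in>I. Re (w $ k) *\<^sub>R dirderiv F (axis k 1) y + Im (w $ k) *\<^sub>R dirderiv F (axis k \<i>) y) v x"
    by (rule dirderiv_cong[OF S x v]) (rule dirderiv_expand[OF S F'(1) _ w])
  moreover have "(\<Sum>k\<in>I. Re (w $ k) *\<^sub>R D k 1 v + Im (w $ k) *\<^sub>R D k \<i> v) =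
    (\<Sum>k\<in>I. Re (w $ k) *\<^sub>R dirderiv (dirderiv F (axis k 1)) v x + Im (w $ k) *\<^sub>R dirderiv (dirderiv F (axis k \<i>)) v x)"
    by (intro sum.cong refl) (simp only: D')
  ultimately show ?thesis by (simp only:)
qed

lemma has_vector_derivative_along_curve:
  assumes S: "openin_coord I S" and F: "F differentiable_on S" and T: "open T" "t \<in> T"
    and \<gamma>: "\<And>t. t \<in> T \<Longrightarrow> \<gamma> t \<in> S" "(\<gamma> has_vector_derivative w) (at t)" and w: "w \<in> coord_space I"
  shows "((\<lambda>t. F (\<gamma> t)) has_vector_derivative dirderiv F w (\<gamma> t)) (at t)"
proof -
  obtain D where D: "(F has_derivative D) (at (\<gamma> t) within S)" "linear D" "dirderiv F w (\<gamma> t) = D w"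
    using differentiable_on_dirderiv[OF S F \<gamma>(1)[OF T(2)]] w by metis
  have "((\<lambda>t. F (\<gamma> t)) has_derivative (\<lambda>h. D (h *\<^sub>R w))) (at t)"
    using \<gamma> T by (intro has_derivative_compose_within[where F = F and \<gamma> = \<gamma> and t = t, OF D(1)]) (auto simp: has_vector_derivative_def)
  then show ?thesis using D by (simp add: has_vector_derivative_def linear_scale)
qed

text \<open>
  The chain rule \<open>(F \<circ> \<gamma>)'' = dF (\<gamma>'') + d\<^sup>2F (\<gamma>', \<gamma>')\<close>. In the first derivative \<open>\<gamma>'\<close> appears as a direction,
  so it is expanded in the real basis before the product rule is applied.
\<close>

lemma second_derivative_along_curve:
  assumes S: "openin_coord I S" and F: "C2_on I S F" and T: "open T" "0 \<in> T"
    and \<gamma>: "\<And>t. t \<in> T \<Longrightarrow> \<gamma> t \<in> S" "\<And>t. t \<in> T \<Longrightarrow> (\<gamma> has_vector_derivative \<gamma>' t) (at t)"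
    and \<gamma>': "\<And>t. t \<in> T \<Longrightarrow> \<gamma>' t \<in> coord_space I" "(\<gamma>' has_vector_derivative \<gamma>'') (at 0)"
    and \<gamma>'': "\<gamma>'' \<in> coord_space I"
  shows "((\<lambda>t. dirderiv F (\<gamma>' t) (\<gamma> t)) has_vector_derivative
    dirderiv F \<gamma>'' (\<gamma> 0) + dirderiv (dirderiv F (\<gamma>' 0)) (\<gamma>' 0) (\<gamma> 0)) (at 0)"
proof -
  have F': "F differentiable_on S" "\<And>k a. k \<in> I \<Longrightarrow> dirderiv F (axis k a) differentiable_on S"
    using F by (auto simp: C2_on_def coord_space_axis)
  let ?d = "\<lambda>k a. dirderiv F (axis k a)"
  let ?w = "\<gamma>' 0" and ?x = "\<gamma> 0"
  have d: "((\<lambda>t. ?d k a (\<gamma> t)) has_vector_derivative dirderiv (?d k a) ?w ?x) (at 0)" if "k \<in> I" for k a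
    by (rule has_vector_derivative_along_curve[OF S F'(2)[OF that] T]) (use \<gamma> \<gamma>' T in auto)
  have re: "((\<lambda>t. Re (\<gamma>' t $ k)) has_vector_derivative Re (\<gamma>'' $ k)) (at 0)"
       "((\<lambda>t. Im (\<gamma>' t $ k)) has_vector_derivative Im (\<gamma>'' $ k)) (at 0)" for k
    using bounded_linear.has_vector_derivative[OF bounded_linear_compose[OF bounded_linear_Re bounded_linear_vec_nth] \<gamma>'(2)]
      bounded_linear.has_vector_derivative[OF bounded_linear_compose[OF bounded_linear_Im bounded_linear_vec_nth] \<gamma>'(2)]
    by (auto simp: o_def)
  have prod: "((\<lambda>t. f t *\<^sub>R g t) has_vector_derivative (f 0 *\<^sub>R g' + f' *\<^sub>R g 0)) (at 0)"
    if "(f has_vector_derivative f') (at 0)" "(g has_vector_derivative g') (at 0)"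
    for f :: "real \<Rightarrow> real" and g :: "real \<Rightarrow> complex" and f' g'
    using has_vector_derivative_scaleR[of f f' 0 UNIV g g'] that
    by (simp add: has_real_derivative_iff_has_vector_derivative)
  have "((\<lambda>t. \<Sum>k\<in>I. Re (\<gamma>' t $ k) *\<^sub>R ?d k 1 (\<gamma> t) + Im (\<gamma>' t $ k) *\<^sub>R ?d k \<i> (\<gamma> t)) has_vector_derivative
     (\<Sum>k\<in>I. (Re (?w $ k) *\<^sub>R dirderiv (?d k 1) ?w ?x + Re (\<gamma>'' $ k) *\<^sub>R ?d k 1 ?x)
           + (Im (?w $ k) *\<^sub>R dirderiv (?d k \<i>) ?w ?x + Im (\<gamma>'' $ k) *\<^sub>R ?d k \<i> ?x))) (at 0)"
    by (intro has_vector_derivative_sum has_vector_derivative_add prod re d)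
  also have "(\<Sum>k\<in>I. (Re (?w $ k) *\<^sub>R dirderiv (?d k 1) ?w ?x + Re (\<gamma>'' $ k) *\<^sub>R ?d k 1 ?x)
           + (Im (?w $ k) *\<^sub>R dirderiv (?d k \<i>) ?w ?x + Im (\<gamma>'' $ k) *\<^sub>R ?d k \<i> ?x))
      = dirderiv F \<gamma>'' ?x + dirderiv (dirderiv F ?w) ?w ?x"
    using dirderiv2_expand[OF S F, of ?x ?w ?w] dirderiv_expand[OF S F'(1), of ?x \<gamma>''] \<gamma>(1) \<gamma>'(1) T(2) \<gamma>''
    by (simp add: sum.distrib algebra_simps)
  finally show ?thesis
    by (rule has_vector_derivative_transform_within_open[OF _ T])
       (use dirderiv_expand[OF S F'(1)] \<gamma> \<gamma>' in auto)
qed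

lemma dirderiv_real_valued:
  assumes "openin_coord I S" "F differentiable_on S" "x \<in> S" "v \<in> coord_space I"
    "\<And>y. y \<in> S \<Longrightarrow> Im (F y) = 0"
  shows "Im (dirderiv F v x) = 0"
proof -
  have "Im (dirderiv F v x) = dirderiv (\<lambda>y. Im (F y)) v x"
    using dirderiv_bounded_linear[OF assms(1-4) bounded_linear_Im] by simp
  also have "\<dots> = dirderiv (\<lambda>y. 0) v x"
    by (rule dirderiv_cong[OF assms(1,3,4)]) (rule assms(5))
  also have "\<dots> = 0" by (simp add: dirderiv_def)
  finally show ?thesis .
qed

text \<open>
  This and the next lemma identify the contractions of the Wirtinger derivatives with a direction \<open>u\<close> as
  the Wirtinger derivatives of the restriction to the complex line spanned by \<open>u\<close>.
\<close>

lemma sum_d_dzbar: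
  assumes "openin_coord I S" "F differentiable_on S" "x \<in> S" "u \<in> coord_space I"
  shows "(\<Sum>j\<in>I. cnj (u $ j) * d_dzbar j F x) = (dirderiv F u x + \<i> * dirderiv F (\<i> *s u) x) / 2"
proof -
  have iu: "\<i> *s u \<in> coord_space I" using assms(4) by (rule coord_space_scale)
  have "(\<Sum>j\<in>I. cnj (u $ j) * d_dzbar j F x) = (\<Sum>j\<in>I. (
      (Re (u $ j) *\<^sub>R dirderiv F (axis j 1) x + Im (u $ j) *\<^sub>R dirderiv F (axis j \<i>) x)
      + \<i> * (Re ((\<i> *s u) $ j) *\<^sub>R dirderiv F (axis j 1) x + Im ((\<i> *s u) $ j) *\<^sub>R dirderiv F (axis j \<i>) x)) / 2)"
    by (intro sum.cong) (auto simp: d_dzbar_def complex_eq_iff field_simps)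
  also have "\<dots> = (dirderiv F u x + \<i> * dirderiv F (\<i> *s u) x) / 2"
    unfolding dirderiv_expand[OF assms] dirderiv_expand[OF assms(1-3) iu]
    by (simp add: sum_divide_distrib sum_distrib_left sum.distrib add_divide_distrib)
  finally show ?thesis .
qed

lemma sum_d_dz:
  assumes "openin_coord I S" "F differentiable_on S" "x \<in> S" "u \<in> coord_space I"
  shows "(\<Sum>j\<in>I. u $ j * d_dz j F x) = (dirderiv F u x - \<i> * dirderiv F (\<i> *s u) x) / 2"
proof -
  have iu: "\<i> *s u \<in> coord_space I" using assms(4) by (rule coord_space_scale)
  have "(\<Sum>j\<in>I. u $ j * d_dz j F x) = (\<Sum>j\<in>I. (
      (Re (u $ j) *\<^sub>R dirderiv F (axis j 1) x + Im (u $ j) *\<^sub>R dirderiv F (axis j \<i>) x)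
      - \<i> * (Re ((\<i> *s u) $ j) *\<^sub>R dirderiv F (axis j 1) x + Im ((\<i> *s u) $ j) *\<^sub>R dirderiv F (axis j \<i>) x)) / 2)"
    by (intro sum.cong) (auto simp: d_dz_def complex_eq_iff field_simps)
  also have "\<dots> = (dirderiv F u x - \<i> * dirderiv F (\<i> *s u) x) / 2"
    unfolding dirderiv_expand[OF assms] dirderiv_expand[OF assms(1-3) iu]
    by (simp only: sum_divide_distrib[symmetric] sum_subtractf sum_distrib_left)
  finally show ?thesis .
qed

text \<open>
  Both contractions are carried out one after another, the inner one at all points near \<open>x\<close>. The mixed
  second derivatives are kept: for a real-valued function their difference only contributes to the
  imaginary part.
\<close>

lemma Levi_contraction:
  assumes S: "openin_coord I S" and F: "C2_on I S F" and x: "x \<in> S" and u: "u \<in> coord_space I"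
  shows "(\<Sum>i\<in>I. \<Sum>j\<in>I. d_dz i (d_dzbar j F) x * (u $ i) * cnj (u $ j)) =
    (dirderiv (dirderiv F u) u x + dirderiv (dirderiv F (\<i> *s u)) (\<i> *s u) x
      + \<i> * (dirderiv (dirderiv F (\<i> *s u)) u x - dirderiv (dirderiv F u) (\<i> *s u) x)) / 4"
proof -
  have iu: "\<i> *s u \<in> coord_space I" using u by (rule coord_space_scale)
  have F': "F differentiable_on S" "\<And>w. w \<in> coord_space I \<Longrightarrow> dirderiv F w differentiable_on S"
    using F by (auto simp: C2_on_def)
  define P where "P = (\<lambda>y. (dirderiv F u y + \<i> * dirderiv F (\<i> *s u) y) / 2)"
  have P_sum: "P = (\<lambda>y. \<Sum>k\<in>{0,1::nat}. (if k = 0 then 1/2 else \<i>/2) * (if k = 0 then dirderiv F u else dirderiv F (\<i> *s u)) y)"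
    by (auto simp: P_def add_divide_distrib)
  have P: "P differentiable_on S"
    unfolding P_sum by (rule differentiable_on_sum_mult) (auto simp: F' u iu)
  have dP: "dirderiv P v x = (dirderiv (dirderiv F u) v x + \<i> * dirderiv (dirderiv F (\<i> *s u)) v x) / 2"
    if "v \<in> coord_space I" for v
    unfolding P_sum by (subst dirderiv_sum_mult[OF S _ x that]) (auto simp: F' u iu add_divide_distrib)
  have bar: "d_dzbar j F = (\<lambda>y. \<Sum>k\<in>{0,1::nat}. (if k = 0 then 1/2 else \<i>/2) * (if k = 0 then dirderiv F (axis j 1) else dirderiv F (axis j \<i>)) y)" for j
    by (auto simp: d_dzbar_def add_divide_distrib)
  have dbar: "d_dzbar j F differentiable_on S" if "j \<in> I" for j
    unfolding bar by (rule differentiable_on_sum_mult) (auto simp: F' coord_space_axis that)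
  have eqP: "(\<Sum>j\<in>I. cnj (u $ j) * d_dzbar j F y) = P y" if "y \<in> S" for y
    unfolding P_def by (rule sum_d_dzbar[OF S F'(1) that u])
  have dir: "(\<Sum>j\<in>I. cnj (u $ j) * dirderiv (d_dzbar j F) v x) = dirderiv P v x" if "v \<in> coord_space I" for v
  proof -
    have "dirderiv (\<lambda>y. \<Sum>j\<in>I. cnj (u $ j) * d_dzbar j F y) v x = (\<Sum>j\<in>I. cnj (u $ j) * dirderiv (d_dzbar j F) v x)"
      by (rule dirderiv_sum_mult[OF S dbar x that])
    moreover have "dirderiv (\<lambda>y. \<Sum>j\<in>I. cnj (u $ j) * d_dzbar j F y) v x = dirderiv P v x"
      by (rule dirderiv_cong[OF S x that eqP])
    ultimately show ?thesis by simp
  qed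
  have "(\<Sum>j\<in>I. d_dz i (d_dzbar j F) x * (u $ i) * cnj (u $ j)) = u $ i * d_dz i P x" if "i \<in> I" for i
  proof -
    have "(\<Sum>j\<in>I. d_dz i (d_dzbar j F) x * (u $ i) * cnj (u $ j))
      = u $ i * (((\<Sum>j\<in>I. cnj (u $ j) * dirderiv (d_dzbar j F) (axis i 1) x)
          - \<i> * (\<Sum>j\<in>I. cnj (u $ j) * dirderiv (d_dzbar j F) (axis i \<i>) x)) / 2)"
      unfolding d_dz_def sum_distrib_left sum_subtractf[symmetric] sum_divide_distrib
      by (intro sum.cong) (auto simp: field_simps)
    then show ?thesis using that by (simp add: dir coord_space_axis d_dz_def)
  qed
  then have "(\<Sum>i\<in>I. \<Sum>j\<in>I. d_dz i (d_dzbar j F) x * (u $ i) * cnj (u $ j)) = (\<Sum>i\<in>I. u $ i * d_dz i P x)"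
    by simp
  also have "\<dots> = (dirderiv P u x - \<i> * dirderiv P (\<i> *s u) x) / 2"
    by (rule sum_d_dz[OF S P x u])
  also have "\<dots> = (dirderiv (dirderiv F u) u x + dirderiv (dirderiv F (\<i> *s u)) (\<i> *s u) x
      + \<i> * (dirderiv (dirderiv F (\<i> *s u)) u x - dirderiv (dirderiv F u) (\<i> *s u) x)) / 4"
    unfolding dP[OF u] dP[OF iu] by (simp add: complex_eq_iff field_simps)
  finally show ?thesis .
qed

lemma Levi_contraction_real:
  assumes S: "openin_coord I S" and F: "C2_on I S F" and x: "x \<in> S" and u: "u \<in> coord_space I"
    and real: "\<And>y. y \<in> S \<Longrightarrow> Im (F y) = 0"
  shows "Re (\<Sum>i\<in>I. \<Sum>j\<in>I. d_dz i (d_dzbar j F) x * (u $ i) * cnj (u $ j)) =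
    (Re (dirderiv (dirderiv F u) u x) + Re (dirderiv (dirderiv F (\<i> *s u)) (\<i> *s u) x)) / 4"
proof -
  have iu: "\<i> *s u \<in> coord_space I" using u by (rule coord_space_scale)
  have F': "F differentiable_on S" "\<And>w. w \<in> coord_space I \<Longrightarrow> dirderiv F w differentiable_on S"
    using F by (auto simp: C2_on_def)
  have "Im (dirderiv (dirderiv F w) v x) = 0" if "w \<in> coord_space I" "v \<in> coord_space I" for v w
    by (rule dirderiv_real_valued[OF S F'(2)[OF that(1)] x that(2)])
       (rule dirderiv_real_valued[OF S F'(1) _ that(1) real])
  then show ?thesis unfolding Levi_contraction[OF S F x u] by (simp add: u iu)
qed

text \<open>
  On each of the two real lines spanned by \<open>u\<close> and \<open>\<i> *s u\<close>, \<open>(log H)'' = H''/H - (H'/H)\<^sup>2\<close>.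
\<close>

lemma Levi_contraction_ln:
  fixes H :: "complex^'d::finite \<Rightarrow> complex"
  assumes S: "openin_coord I S" and H: "C2_on I S H" and x: "x \<in> S" and u: "u \<in> coord_space I"
    and pos: "\<And>y. y \<in> S \<Longrightarrow> 0 < Re (H y)"
  defines "L \<equiv> \<lambda>y. complex_of_real (ln (Re (H y)))"
    and "q \<equiv> \<lambda>w. Re (dirderiv (dirderiv H w) w x) / Re (H x) - (Re (dirderiv H w x) / Re (H x))\<^sup>2"
  shows "Re (\<Sum>i\<in>I. \<Sum>j\<in>I. d_dz i (d_dzbar j L) x * (u $ i) * cnj (u $ j)) = (q u + q (\<i> *s u)) / 4"
proof -
  have iu: "\<i> *s u \<in> coord_space I" using u by (rule coord_space_scale)
  have H': "H differentiable_on S" "\<And>w. w \<in> coord_space I \<Longrightarrow> dirderiv H w differentiable_on S"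
    using H by (auto simp: C2_on_def)
  have dL: "(L has_derivative (\<lambda>v. complex_of_real (Re (D v) / Re (H y)))) (at y within S)"
    if "y \<in> S" "(H has_derivative D) (at y within S)" for y D
    unfolding L_def
    by (rule derivative_eq_intros that pos[OF that(1)] refl)+ (simp add: field_simps)
  have L: "L differentiable_on S"
    using H'(1) dL unfolding differentiable_on_def differentiable_def by meson
  have Lw: "dirderiv L w y = complex_of_real (Re (dirderiv H w y) / Re (H y))"
    if y: "y \<in> S" and w: "w \<in> coord_space I" for y w
  proof -
    obtain D where D: "(H has_derivative D) (at y within S)"
      using H'(1) y unfolding differentiable_on_def differentiable_def by blast
    show ?thesis using dirderiv_eq[OF S y w D] dirderiv_eq[OF S y w dL[OF y D]] by simp
  qed
  have dLw: "(dirderiv L w has_derivative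
      (\<lambda>v. complex_of_real (Re (D2 v) / Re (H y) - Re (dirderiv H w y) * Re (D v) / (Re (H y))\<^sup>2))) (at y within S)"
    if y: "y \<in> S" and w: "w \<in> coord_space I" and D: "(H has_derivative D) (at y within S)"
      and D2: "(dirderiv H w has_derivative D2) (at y within S)" for y w D D2
  proof -
    have "((\<lambda>y. complex_of_real (Re (dirderiv H w y) / Re (H y))) has_derivative
      (\<lambda>v. complex_of_real (Re (D2 v) / Re (H y) - Re (dirderiv H w y) * Re (D v) / (Re (H y))\<^sup>2))) (at y within S)"
    proof (rule has_derivative_of_real[OF has_derivative_eq_rhs[OF has_derivative_divide]])
      show "((\<lambda>y. Re (dirderiv H w y)) has_derivative (\<lambda>v. Re (D2 v))) (at y within S)"
        by (rule bounded_linear.has_derivative[OF bounded_linear_Re D2])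
      show "((\<lambda>y. Re (H y)) has_derivative (\<lambda>v. Re (D v))) (at y within S)"
        by (rule bounded_linear.has_derivative[OF bounded_linear_Re D])
      show "Re (H y) \<noteq> 0" using pos[OF y] by simp
      then show "(\<lambda>v. - Re (dirderiv H w y) * (inverse (Re (H y)) * Re (D v) * inverse (Re (H y))) + Re (D2 v) / Re (H y)) =
        (\<lambda>v. Re (D2 v) / Re (H y) - Re (dirderiv H w y) * Re (D v) / (Re (H y))\<^sup>2)"
        by (simp add: field_simps power2_eq_square fun_eq_iff)
    qed
    then show ?thesis
      by (rule has_derivative_transform[OF y, rotated]) (simp add: Lw w)
  qed
  have L2: "dirderiv L w differentiable_on S" if w: "w \<in> coord_space I" for w
    using H'(1) H'(2)[OF w] dLw[OF _ w] unfolding differentiable_on_def differentiable_def by meson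
  have q: "Re (dirderiv (dirderiv L w) w x) = q w" if w: "w \<in> coord_space I" for w
  proof -
    obtain D where D: "(H has_derivative D) (at x within S)"
      using H'(1) x by (auto simp: differentiable_on_def differentiable_def)
    obtain D2 where D2: "(dirderiv H w has_derivative D2) (at x within S)"
      using H'(2)[OF w] x by (auto simp: differentiable_on_def differentiable_def)
    show ?thesis
      using dirderiv_eq[OF S x w D] dirderiv_eq[OF S x w D2] dirderiv_eq[OF S x w dLw[OF x w D D2]]
      by (simp add: q_def power2_eq_square)
  qed
  have C2: "C2_on I S L" using L L2 by (simp add: C2_on_def)
  have real: "Im (L y) = 0" for y by (simp add: L_def)
  show ?thesis unfolding Levi_contraction_real[OF S C2 x u real] q[OF u] q[OF iu] ..
qed


section \<open>Holomorphic maps between coordinate subspaces\<close>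

lemma norm_vec_scale: "norm (a *s (v :: complex^'d::finite)) = cmod a * norm v"
  unfolding norm_vec_def by (simp add: norm_mult L2_set_right_distrib)

lemma has_derivative_vecI:
  fixes \<gamma> :: "'t::real_normed_vector \<Rightarrow> complex^'d::finite"
  assumes "\<And>k. ((\<lambda>t. \<gamma> t $ k) has_derivative (\<lambda>h. D h $ k)) (at t within T)"
  shows "(\<gamma> has_derivative D) (at t within T)"
  unfolding has_derivative_componentwise_within[of \<gamma>]
proof
  fix b :: "complex^'d" assume "b \<in> Basis"
  then obtain k a where b: "b = axis k a" by (auto simp: Basis_vec_def)
  show "((\<lambda>x. \<gamma> x \<bullet> b) has_derivative (\<lambda>x. D x \<bullet> b)) (at t within T)"
    unfolding b inner_axis by (intro has_derivative_inner_left assms)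
qed

lemma has_vector_derivative_vecI:
  fixes \<gamma> :: "real \<Rightarrow> complex^'d::finite"
  assumes "\<And>k. ((\<lambda>t. \<gamma> t $ k) has_vector_derivative (D $ k)) (at t within T)"
  shows "(\<gamma> has_vector_derivative D) (at t within T)"
  unfolding has_vector_derivative_def
  by (rule has_derivative_vecI) (use assms in \<open>simp add: has_vector_derivative_def\<close>)

lemma has_derivative_scale_left:
  fixes w :: "complex^'d::finite"
  shows "((\<lambda>\<eta>. x + \<eta> *s w) has_derivative (\<lambda>\<eta>. \<eta> *s w)) (at \<zeta> within T)"
  by (rule has_derivative_vecI) (auto intro!: derivative_eq_intros)

lemma continuous_on_scale_left:
  fixes w :: "complex^'d::finite"
  shows "continuous_on T (\<lambda>\<eta>. x + \<eta> *s w)"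
  unfolding continuous_on_eq_continuous_within
  using has_derivative_continuous[OF has_derivative_scale_left] by blast

lemma continuous_on_vec_scale:
  fixes f :: "'t::topological_space \<Rightarrow> complex^'d::finite"
  assumes "continuous_on T c" "continuous_on T f"
  shows "continuous_on T (\<lambda>x. c x *s f x)"
  unfolding vector_scalar_mult_def by (intro continuous_on_vec_lambda continuous_on_mult assms continuous_on_component)

lemma cholomorphic_derivative:
  assumes "openin_coord I S" "cholomorphic S F" "x \<in> S"
  obtains D where "(F has_derivative D) (at x within S)" "\<And>a v. D (a *s v) = a *s D v" "linear D"
    "\<And>v. v \<in> coord_space I \<Longrightarrow> dirderiv F v x = D v"
proof -
  obtain D where D: "(F has_derivative D) (at x within S)" "\<And>a v. D (a *s v) = a *s D v"
    using assms unfolding cholomorphic_def by blast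
  show ?thesis
    by (rule that[OF D]) (use D dirderiv_eq[OF assms(1,3) _ D(1)] has_derivative_linear in auto)
qed

lemma cholomorphic_differentiable_on: "cholomorphic S F \<Longrightarrow> F differentiable_on S"
  unfolding cholomorphic_def differentiable_on_def differentiable_def by blast

lemma cholomorphic_continuous_on: "cholomorphic S F \<Longrightarrow> continuous_on S F"
  using cholomorphic_differentiable_on differentiable_imp_continuous_on by blast

lemma dirderiv_scale:
  assumes "openin_coord I S" "cholomorphic S F" "x \<in> S" "v \<in> coord_space I"
  shows "dirderiv F (a *s v) x = a *s dirderiv F v x"
  using cholomorphic_derivative[OF assms(1-3)] assms(4) by (metis coord_space_scale)

lemma dirderiv_add:
  assumes "openin_coord I S" "cholomorphic S F" "x \<in> S" "v \<in> coord_space I" "w \<in> coord_space I"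
  shows "dirderiv F (v + w) x = dirderiv F v x + dirderiv F w x"
  using cholomorphic_derivative[OF assms(1-3)] assms(4,5) by (metis coord_space_add linear_add)

lemma dirderiv_zero [simp]: "dirderiv F 0 x = 0"
  by (simp add: dirderiv_def)

lemma dirderiv_in_coord_space:
  assumes "openin_coord I S" "cholomorphic S F" "x \<in> S" "v \<in> coord_space I"
    "\<And>y. y \<in> S \<Longrightarrow> F y \<in> coord_space J"
  shows "dirderiv F v x \<in> coord_space J"
  unfolding coord_space_def
proof (clarify)
  fix k assume k: "k \<notin> J"
  have "dirderiv (\<lambda>y. F y $ k) v x = dirderiv F v x $ k"
    by (rule dirderiv_bounded_linear[OF assms(1) cholomorphic_differentiable_on[OF assms(2)] assms(3,4) bounded_linear_vec_nth])
  moreover have "dirderiv (\<lambda>y. F y $ k) v x = dirderiv (\<lambda>y. 0) v x"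
    by (rule dirderiv_cong[OF assms(1,3,4)]) (use assms(5) k in \<open>simp add: coord_space_def\<close>)
  ultimately show "dirderiv F v x $ k = 0" by (simp add: dirderiv_def)
qed

lemma has_derivative_cholomorphic_compose:
  assumes "(F has_derivative D) (at x within S)" "(G has_derivative E) (at (F x) within S')"
    "\<And>y. y \<in> S \<Longrightarrow> F y \<in> S'"
  shows "((\<lambda>y. G (F y)) has_derivative (\<lambda>v. E (D v))) (at x within S)"
proof -
  have "(G has_derivative E) (at (F x) within F ` S)"
    using assms(2) by (rule has_derivative_subset) (use assms(3) in auto)
  from has_derivative_in_compose[OF assms(1) this] show ?thesis .
qed

lemma cholomorphic_subset: "cholomorphic S F \<Longrightarrow> T \<subseteq> S \<Longrightarrow> cholomorphic T F"
  unfolding cholomorphic_def by (meson has_derivative_subset subsetD)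

text \<open>
  The chain rule for directional derivatives requires the inner derivative to stay in the coordinate
  subspace of the target, where the derivative of \<open>G\<close> within \<open>S'\<close> is determined.
\<close>

lemma dirderiv_compose:
  assumes S: "openin_coord I S" and F: "cholomorphic S F" and x: "x \<in> S" and v: "v \<in> coord_space I"
    and S': "openin_coord J S'" and G: "cholomorphic S' G" and FS: "\<And>y. y \<in> S \<Longrightarrow> F y \<in> S'"
  shows "dirderiv (\<lambda>y. G (F y)) v x = dirderiv G (dirderiv F v x) (F x)"
proof -
  have J: "dirderiv F v x \<in> coord_space J"
    by (rule dirderiv_in_coord_space[OF S F x v]) (use FS openin_coord_subset[OF S'] in auto)
  obtain D where D: "(F has_derivative D) (at x within S)" "dirderiv F v x = D v"
    using cholomorphic_derivative[OF S F x] v by metis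
  obtain E where E: "(G has_derivative E) (at (F x) within S')" "dirderiv G (dirderiv F v x) (F x) = E (dirderiv F v x)"
    using cholomorphic_derivative[OF S' G FS[OF x]] J by metis
  show ?thesis
    using dirderiv_eq[OF S x v has_derivative_cholomorphic_compose[OF D(1) E(1) FS]] D E by simp
qed

lemma holomorphic_line:
  assumes S: "openin_coord I S" and F: "cholomorphic S F" and x: "x \<in> coord_space I" and w: "w \<in> coord_space I"
    and \<zeta>: "x + \<zeta> *s w \<in> S"
  shows "((\<lambda>\<eta>. F (x + \<eta> *s w) $ k) has_field_derivative dirderiv F w (x + \<zeta> *s w) $ k) (at \<zeta>)"
proof -
  obtain D where D: "(F has_derivative D) (at (x + \<zeta> *s w) within S)" "\<And>a v. D (a *s v) = a *s D v"
    "dirderiv F w (x + \<zeta> *s w) = D w"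
    using cholomorphic_derivative[OF S F \<zeta>] w by metis
  have op: "open {\<eta> \<in> UNIV. x + \<eta> *s w \<in> S}"
    by (rule open_preimage_coord[OF S open_UNIV continuous_on_scale_left]) (intro coord_space_intros x w)
  have "((\<lambda>\<eta>. F (x + \<eta> *s w)) has_derivative (\<lambda>\<eta>. D (\<eta> *s w))) (at \<zeta>)"
    by (rule has_derivative_compose_within[where F = F and \<gamma> = "\<lambda>\<eta>. x + \<eta> *s w" and t = \<zeta>, OF D(1) has_derivative_scale_left op])
       (use \<zeta> in auto)
  from bounded_linear.has_derivative[OF bounded_linear_vec_nth this, of k]
  show ?thesis by (simp add: has_field_derivative_def D(2,3) mult_commute_abs)
qed

text \<open>
  Taylor's formula on the disc of radius \<open>R / 2\<close>, where Cauchy's inequality on discs of radius \<open>R / 4\<close>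
  bounds the second derivative by \<open>2 * K / (R / 4)\<^sup>2\<close>.
\<close>

lemma holomorphic_first_order_remainder:
  assumes hol: "p holomorphic_on ball 0 R" and R: "R > 0" and bd: "\<And>\<eta>. \<eta> \<in> ball 0 R \<Longrightarrow> cmod (p \<eta>) \<le> K"
    and h: "cmod h < R / 2"
  shows "cmod (p h - p 0 - h * deriv p 0) \<le> (32 * K / R\<^sup>2) * (cmod h)\<^sup>2"
proof -
  have bound2: "cmod ((deriv ^^ 2) p \<xi>) \<le> 32 * K / R\<^sup>2" if \<xi>: "\<xi> \<in> ball 0 (R/2)" for \<xi>
  proof -
    have sub: "cball \<xi> (R/4) \<subseteq> ball 0 R"
    proof
      fix y assume "y \<in> cball \<xi> (R/4)"
      then have "cmod y \<le> cmod \<xi> + R/4"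
        using norm_triangle_ineq[of \<xi> "y - \<xi>"] by (simp add: dist_norm norm_minus_commute)
      then show "y \<in> ball 0 R" using \<xi> R by simp
    qed
    have "cmod ((deriv ^^ 2) p \<xi>) \<le> fact 2 * K / (R/4)^2"
    proof (rule Cauchy_inequality)
      show "p holomorphic_on ball \<xi> (R/4)"
        by (rule holomorphic_on_subset[OF hol]) (use sub ball_subset_cball in blast)
      show "continuous_on (cball \<xi> (R/4)) p"
        by (rule continuous_on_subset[OF holomorphic_on_imp_continuous_on[OF hol] sub])
      show "cmod (p x) \<le> K" if "cmod (\<xi> - x) = R/4" for x
        using bd[of x] sub that by (auto simp: dist_norm)
    qed (use R in auto)
    also have "\<dots> = 32 * K / R\<^sup>2" by (simp add: power2_eq_square)
    finally show ?thesis .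
  qed
  have "cmod ((deriv ^^ 0) p h - (\<Sum>i\<le>1. (deriv ^^ i) p 0 * (h - 0) ^ i / fact i))
      \<le> (32 * K / R\<^sup>2) * cmod (h - 0) ^ Suc 1 / fact 1"
  proof (rule complex_Taylor[where S = "ball 0 (R/2)" and f = "\<lambda>i. (deriv ^^ i) p"])
    fix i and x :: complex assume x: "x \<in> ball 0 (R/2)"
    then have "x \<in> ball 0 R" using R by auto
    then have "((deriv ^^ i) p has_field_derivative deriv ((deriv ^^ i) p) x) (at x)"
      by (intro holomorphic_derivI[OF holomorphic_higher_deriv[OF hol open_ball] open_ball])
    then show "((deriv ^^ i) p has_field_derivative (deriv ^^ Suc i) p x) (at x within ball 0 (R/2))"
      by (simp add: has_field_derivative_at_within)
  qed (use bound2 h R in \<open>auto simp: numeral_2_eq_2\<close>)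
  then show ?thesis by (simp add: power2_eq_square algebra_simps)
qed

text \<open>
  Continuity bounds \<open>F\<close> near \<open>x0\<close>; applying the remainder estimate on every complex line through a
  point near \<open>x0\<close> with direction near \<open>w0\<close> then gives a constant \<open>C\<close> that serves all of them.
\<close>

lemma difference_quotient_locally_uniform:
  fixes F :: "complex^'d::finite \<Rightarrow> complex^'e::finite"
  assumes S: "openin_coord I S" and F: "cholomorphic S F" and x0: "x0 \<in> S" and w0: "w0 \<in> coord_space I"
  obtains e C where "e > 0"
    "\<And>x w h. \<lbrakk>x \<in> coord_space I; w \<in> coord_space I; dist x x0 < e; dist w w0 < e; cmod h < e\<rbrakk> \<Longrightarrow>
       x \<in> S \<and> x + h *s w \<in> S \<and>
       cmod (F (x + h *s w) $ k - F x $ k - h * (dirderiv F w x $ k)) \<le> C * (cmod h)\<^sup>2"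
proof -
  have x0': "x0 \<in> coord_space I" using x0 openin_coord_subset[OF S] by auto
  obtain d1 where d1: "d1 > 0" "\<And>y. y \<in> coord_space I \<Longrightarrow> dist y x0 < d1 \<Longrightarrow> y \<in> S"
    using openin_coord_ball[OF S x0] by blast
  have "continuous_on S F" by (rule cholomorphic_continuous_on[OF F])
  then obtain d2 where d2: "d2 > 0" "\<And>y. y \<in> S \<Longrightarrow> dist y x0 < d2 \<Longrightarrow> dist (F y) (F x0) < 1"
    using x0 unfolding continuous_on_iff by (meson zero_less_one)
  define d where "d = min d1 d2"
  define K where "K = norm (F x0) + 1"
  define R where "R = d / (2 * (norm w0 + 1))"
  define e where "e = min (d / 2) (min 1 (R / 2))"
  have d: "d > 0" using d1 d2 by (simp add: d_def)
  have nw: "norm w0 + 1 > 0" by (simp add: add_nonneg_pos)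
  have R: "R > 0" using d nw by (simp add: R_def)
  have e: "e > 0" using d R by (simp add: e_def)
  have eb: "e \<le> d / 2" "e \<le> 1" "e \<le> R / 2" unfolding e_def by linarith+
  have bound: "y \<in> S \<and> norm (F y) \<le> K" if "y \<in> coord_space I" "dist y x0 < d" for y
  proof -
    have "y \<in> S" using d1(2) that by (simp add: d_def)
    moreover from this have "dist (F y) (F x0) < 1" using d2(2) that by (simp add: d_def)
    moreover have "norm (F y) \<le> norm (F x0) + dist (F y) (F x0)"
      using norm_triangle_ineq[of "F x0" "F y - F x0"] by (simp add: dist_norm)
    ultimately show ?thesis by (simp add: K_def)
  qed
  show ?thesis
  proof (rule that[of e "32 * K / R\<^sup>2"])
    show "e > 0" by (rule e)
    fix x w h assume x: "x \<in> coord_space I" "dist x x0 < e" and w: "w \<in> coord_space I" "dist w w0 < e" and h: "cmod h < e"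
    define p where "p = (\<lambda>\<eta>. F (x + \<eta> *s w) $ k)"
    have near: "x + \<eta> *s w \<in> S \<and> norm (F (x + \<eta> *s w)) \<le> K" if \<eta>: "cmod \<eta> < R" for \<eta>
    proof (rule bound)
      show "x + \<eta> *s w \<in> coord_space I" by (intro coord_space_intros x w)
      have "norm w \<le> norm w0 + dist w w0"
        using norm_triangle_ineq[of w0 "w - w0"] by (simp add: dist_norm)
      then have nw': "norm w \<le> norm w0 + 1" using w eb by simp
      have "dist (x + \<eta> *s w) x0 \<le> dist x x0 + cmod \<eta> * norm w"
        using norm_triangle_ineq[of "x - x0" "\<eta> *s w"] by (simp add: dist_norm algebra_simps norm_vec_scale)
      also have "\<dots> < d / 2 + R * (norm w0 + 1)"
        using x eb \<eta> nw' R by (intro add_less_le_mono mult_mono) auto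
      also have "R * (norm w0 + 1) = d / 2" using nw by (simp add: R_def field_simps)
      finally show "dist (x + \<eta> *s w) x0 < d" by simp
    qed
    have der: "(p has_field_derivative dirderiv F w (x + \<eta> *s w) $ k) (at \<eta>)" if "cmod \<eta> < R" for \<eta>
      unfolding p_def by (rule holomorphic_line[OF S F x(1) w(1)]) (use near[OF that] in simp)
    have hol: "p holomorphic_on ball 0 R"
      unfolding holomorphic_on_open[OF open_ball] using der by (metis mem_ball_0)
    have der0: "deriv p 0 = dirderiv F w x $ k" using der[of 0] R by (simp add: DERIV_imp_deriv)
    have bd: "cmod (p \<eta>) \<le> K" if "\<eta> \<in> ball 0 R" for \<eta>
    proof -
      have "cmod (p \<eta>) \<le> norm (F (x + \<eta> *s w))" unfolding p_def by (rule Finite_Cartesian_Product.norm_nth_le)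
      also have "\<dots> \<le> K" using near that by simp
      finally show ?thesis .
    qed
    have hR: "cmod h < R / 2" using h eb by linarith
    have "cmod (p h - p 0 - h * deriv p 0) \<le> (32 * K / R\<^sup>2) * (cmod h)\<^sup>2"
      by (rule holomorphic_first_order_remainder[OF hol R bd hR])
    moreover have "x \<in> S" "x + h *s w \<in> S" using near[of 0] near[of h] R hR by auto
    ultimately show "x \<in> S \<and> x + h *s w \<in> S \<and>
       cmod (F (x + h *s w) $ k - F x $ k - h * (dirderiv F w x $ k)) \<le> (32 * K / R\<^sup>2) * (cmod h)\<^sup>2"
      by (simp add: p_def der0[unfolded p_def])
  qed
qed

lemma difference_quotient_uniform_limit:
  fixes F :: "complex^'d::finite \<Rightarrow> complex^'e::finite"
  assumes S: "openin_coord I S" and F: "cholomorphic S F" and x0: "x0 \<in> S" and w0: "w0 \<in> coord_space I"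
  obtains e h where "e > 0" "\<And>n::nat. h n \<noteq> (0::complex)"
    "\<And>x w n. \<lbrakk>x \<in> coord_space I; w \<in> coord_space I; dist x x0 < e; dist w w0 < e\<rbrakk> \<Longrightarrow> x \<in> S \<and> x + h n *s w \<in> S"
    "uniform_limit ((coord_space I \<inter> ball x0 e) \<times> (coord_space I \<inter> ball w0 e))
       (\<lambda>n (x, w). (F (x + h n *s w) $ k - F x $ k) / h n) (\<lambda>(x, w). dirderiv F w x $ k) sequentially"
proof -
  obtain e C where e: "e > 0" and est:
    "\<And>x w h. \<lbrakk>x \<in> coord_space I; w \<in> coord_space I; dist x x0 < e; dist w w0 < e; cmod h < e\<rbrakk> \<Longrightarrow>
       x \<in> S \<and> x + h *s w \<in> S \<and>
       cmod (F (x + h *s w) $ k - F x $ k - h * (dirderiv F w x $ k)) \<le> C * (cmod h)\<^sup>2"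
    using difference_quotient_locally_uniform[OF S F x0 w0] by metis
  define h where "h = (\<lambda>n::nat. complex_of_real (e / (real n + 2)))"
  have hn: "cmod (h n) = e / (real n + 2)" for n unfolding h_def norm_of_real using e by simp
  have hne: "h n \<noteq> 0" for n unfolding h_def of_real_eq_0_iff using e by simp
  have he: "cmod (h n) < e" for n using e by (simp add: hn field_simps add_pos_nonneg)
  show ?thesis
  proof (rule that[OF e hne])
    show "x \<in> S \<and> x + h n *s w \<in> S"
      if "x \<in> coord_space I" "w \<in> coord_space I" "dist x x0 < e" "dist w w0 < e" for x w n
      using est[OF that he] by blast
    show "uniform_limit ((coord_space I \<inter> ball x0 e) \<times> (coord_space I \<inter> ball w0 e))
       (\<lambda>n (x, w). (F (x + h n *s w) $ k - F x $ k) / h n) (\<lambda>(x, w). dirderiv F w x $ k) sequentially"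
      unfolding uniform_limit_iff
    proof (intro allI impI)
      fix \<epsilon> :: real assume \<epsilon>: "\<epsilon> > 0"
      have "(\<lambda>n. e / real (n + 2)) \<longlonglongrightarrow> 0"
        by (rule LIMSEQ_ignore_initial_segment[OF lim_const_over_n])
      then have "(\<lambda>n. C * cmod (h n)) \<longlonglongrightarrow> C * 0"
        unfolding hn by (intro tendsto_mult_left) (simp add: add.commute)
      then have "\<forall>\<^sub>F n in sequentially. C * cmod (h n) < \<epsilon>"
        using \<epsilon> by (intro order_tendstoD(2)) auto
      then show "\<forall>\<^sub>F n in sequentially. \<forall>xw\<in>(coord_space I \<inter> ball x0 e) \<times> (coord_space I \<inter> ball w0 e).
          dist (case xw of (x, w) \<Rightarrow> (F (x + h n *s w) $ k - F x $ k) / h n) (case xw of (x, w) \<Rightarrow> dirderiv F w x $ k) < \<epsilon>"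
      proof eventually_elim
        case (elim n)
        show ?case
        proof
          fix z assume z: "z \<in> (coord_space I \<inter> ball x0 e) \<times> (coord_space I \<inter> ball w0 e)"
          define x w where "x = fst z" and "w = snd z"
          have zeq: "z = (x, w)" by (simp add: x_def w_def)
          have xw: "x \<in> coord_space I" "dist x x0 < e" "w \<in> coord_space I" "dist w w0 < e"
            using z by (auto simp: zeq dist_commute)
          have "dist ((F (x + h n *s w) $ k - F x $ k) / h n) (dirderiv F w x $ k)
            = cmod ((F (x + h n *s w) $ k - F x $ k - h n * (dirderiv F w x $ k)) / h n)"
            using hne[of n] by (simp add: dist_norm diff_divide_distrib)
          also have "\<dots> \<le> C * (cmod (h n))\<^sup>2 / cmod (h n)"
            unfolding norm_divide using est[OF xw(1,3,2,4) he] by (intro divide_right_mono) auto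
          also have "\<dots> = C * cmod (h n)" using hne[of n] by (simp add: power2_eq_square)
          finally show "dist (case z of (x, w) \<Rightarrow> (F (x + h n *s w) $ k - F x $ k) / h n) (case z of (x, w) \<Rightarrow> dirderiv F w x $ k) < \<epsilon>"
            using elim by (simp add: zeq)
        qed
      qed
    qed
  qed
qed

text \<open>
  A locally uniform limit of the difference quotients, which are continuous in the point and the
  direction.
\<close>

lemma continuous_on_holomorphic_dirderiv:
  fixes F :: "complex^'d::finite \<Rightarrow> complex^'e::finite"
  assumes S: "openin_coord I S" and F: "cholomorphic S F"
  shows "continuous_on (S \<times> coord_space I) (\<lambda>(x, w). dirderiv F w x $ k)"
  unfolding continuous_on_eq_continuous_within
proof (clarify)
  fix x0 w0 assume x0: "x0 \<in> S" and w0: "w0 \<in> coord_space I"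
  obtain e h where e: "e > 0" and hne: "\<And>n::nat. h n \<noteq> (0::complex)"
    and inS: "\<And>x w n. \<lbrakk>x \<in> coord_space I; w \<in> coord_space I; dist x x0 < e; dist w w0 < e\<rbrakk> \<Longrightarrow> x \<in> S \<and> x + h n *s w \<in> S"
    and ul: "uniform_limit ((coord_space I \<inter> ball x0 e) \<times> (coord_space I \<inter> ball w0 e))
       (\<lambda>n (x, w). (F (x + h n *s w) $ k - F x $ k) / h n) (\<lambda>(x, w). dirderiv F w x $ k) sequentially"
    by (rule difference_quotient_uniform_limit[OF S F x0 w0, of k]) (rule that)
  let ?U = "(coord_space I \<inter> ball x0 e) \<times> (coord_space I \<inter> ball w0 e)"
  have FS: "continuous_on S F" by (rule cholomorphic_continuous_on[OF F])
  have "continuous_on ?U (\<lambda>(x, w). dirderiv F w x $ k)"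
  proof (rule uniform_limit_theorem[OF always_eventually ul], intro allI)
    fix n
    have "continuous_on ?U (\<lambda>p. F (fst p + h n *s snd p))"
    proof (rule continuous_on_compose2[OF FS])
      show "continuous_on ?U (\<lambda>p. fst p + h n *s snd p)"
        by (intro continuous_on_add continuous_on_vec_scale continuous_on_const continuous_on_fst continuous_on_snd continuous_on_id)
      show "(\<lambda>p. fst p + h n *s snd p) ` ?U \<subseteq> S"
        using inS by (auto simp: dist_commute)
    qed
    moreover have "continuous_on ?U (\<lambda>p. F (fst p))"
    proof (rule continuous_on_compose2[OF FS])
      show "continuous_on ?U fst" by (intro continuous_on_fst continuous_on_id)
      show "fst ` ?U \<subseteq> S" using inS by (auto simp: dist_commute)
    qed
    ultimately show "continuous_on ?U (\<lambda>(x, w). (F (x + h n *s w) $ k - F x $ k) / h n)"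
      unfolding case_prod_unfold by (intro continuous_intros continuous_on_component) (use hne in auto)
  qed simp
  then have "continuous (at (x0, w0) within ?U) (\<lambda>(x, w). dirderiv F w x $ k)"
    using x0 w0 e openin_coord_subset[OF S] by (auto simp: continuous_on_eq_continuous_within)
  moreover have "at (x0, w0) within ?U = at (x0, w0) within (S \<times> coord_space I)"
  proof (rule at_within_nhd)
    show "(x0, w0) \<in> ball x0 e \<times> ball w0 e" using e by simp
    show "open (ball x0 e \<times> ball w0 e)" by (intro open_Times open_ball)
    show "?U \<inter> (ball x0 e \<times> ball w0 e) - {(x0, w0)} = (S \<times> coord_space I) \<inter> (ball x0 e \<times> ball w0 e) - {(x0, w0)}"
      using inS openin_coord_subset[OF S] by (auto simp: dist_commute)
  qed
  ultimately show "continuous (at (x0, w0) within S \<times> coord_space I) (\<lambda>(x, w). dirderiv F w x $ k)"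
    by simp
qed

text \<open>
  By Weierstrass' theorem, as a locally uniform limit of difference quotients that are holomorphic in
  \<open>\<zeta>\<close>. This is the holomorphy of \<open>df e\<close> along a disc: the point and the direction both move with \<open>\<zeta>\<close>.
\<close>

lemma holomorphic_dirderiv_along_line:
  fixes F :: "complex^'d::finite \<Rightarrow> complex^'e::finite"
  assumes S: "openin_coord I S" and F: "cholomorphic S F"
    and x: "x \<in> coord_space I" and u: "u \<in> coord_space I" and w: "w \<in> coord_space I" and u': "u' \<in> coord_space I"
    and T: "open T" and TS: "\<And>\<zeta>. \<zeta> \<in> T \<Longrightarrow> x + \<zeta> *s u \<in> S"
  shows "(\<lambda>\<zeta>. dirderiv F (w + \<zeta> *s u') (x + \<zeta> *s u) $ k) holomorphic_on T"
  unfolding holomorphic_on_open[OF T]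
proof
  fix \<zeta>0 assume \<zeta>0: "\<zeta>0 \<in> T"
  let ?g = "\<lambda>\<zeta>. dirderiv F (w + \<zeta> *s u') (x + \<zeta> *s u) $ k"
  let ?x = "\<lambda>\<zeta>. x + \<zeta> *s u" and ?w = "\<lambda>\<zeta>. w + \<zeta> *s u'"
  have xw: "?x \<zeta> \<in> coord_space I" "?w \<zeta> \<in> coord_space I" for \<zeta> by (intro coord_space_intros x w u u')+
  obtain e h where e: "e > 0" and hne: "\<And>n::nat. h n \<noteq> (0::complex)"
    and inS: "\<And>y v n. \<lbrakk>y \<in> coord_space I; v \<in> coord_space I; dist y (?x \<zeta>0) < e; dist v (?w \<zeta>0) < e\<rbrakk> \<Longrightarrow> y \<in> S \<and> y + h n *s v \<in> S"
    and ul: "uniform_limit ((coord_space I \<inter> ball (?x \<zeta>0) e) \<times> (coord_space I \<inter> ball (?w \<zeta>0) e))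
       (\<lambda>n (x, w). (F (x + h n *s w) $ k - F x $ k) / h n) (\<lambda>(x, w). dirderiv F w x $ k) sequentially"
    by (rule difference_quotient_uniform_limit[OF S F TS[OF \<zeta>0] xw(2)[of \<zeta>0], of k]) (rule that)
  have cont: "continuous_on UNIV ?x" "continuous_on UNIV ?w" by (rule continuous_on_scale_left)+
  have "open (?x -` ball (?x \<zeta>0) e)" "open (?w -` ball (?w \<zeta>0) e)"
    by (intro open_vimage open_ball cont)+
  then have "open (?x -` ball (?x \<zeta>0) e \<inter> ?w -` ball (?w \<zeta>0) e)" by auto
  then obtain r where r: "r > 0" "ball \<zeta>0 r \<subseteq> ?x -` ball (?x \<zeta>0) e \<inter> ?w -` ball (?w \<zeta>0) e"
    using e unfolding open_contains_ball by (metis IntI centre_in_ball vimageI2)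
  have near: "dist (?x \<zeta>) (?x \<zeta>0) < e \<and> dist (?w \<zeta>) (?w \<zeta>0) < e" if "\<zeta> \<in> ball \<zeta>0 r" for \<zeta>
    using r(2) that by (auto simp: dist_commute)
  have "?g holomorphic_on ball \<zeta>0 r"
  proof (rule holomorphic_uniform_sequence[OF open_ball])
    fix n
    have eq: "(F (?x \<zeta> + h n *s ?w \<zeta>) $ k - F (?x \<zeta>) $ k) / h n =
       (F ((x + h n *s w) + \<zeta> *s (u + h n *s u')) $ k - F (?x \<zeta>) $ k) / h n" for \<zeta>
      by (simp add: algebra_simps vec.scale_right_distrib)
    show "(\<lambda>\<zeta>. (F (?x \<zeta> + h n *s ?w \<zeta>) $ k - F (?x \<zeta>) $ k) / h n) holomorphic_on ball \<zeta>0 r"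
      unfolding eq
    proof (intro holomorphic_intros hne)
      show "(\<lambda>\<zeta>. F ((x + h n *s w) + \<zeta> *s (u + h n *s u')) $ k) holomorphic_on ball \<zeta>0 r"
        unfolding holomorphic_on_open[OF open_ball]
      proof
        fix \<zeta> assume \<zeta>: "\<zeta> \<in> ball \<zeta>0 r"
        have "?x \<zeta> + h n *s ?w \<zeta> \<in> S" using inS[OF xw, of \<zeta> \<zeta> n] near[OF \<zeta>] by blast
        then have "(x + h n *s w) + \<zeta> *s (u + h n *s u') \<in> S"
          by (simp add: algebra_simps vec.scale_right_distrib)
        moreover have "x + h n *s w \<in> coord_space I" "u + h n *s u' \<in> coord_space I" by (intro coord_space_intros x w u u')+
        ultimately show "\<exists>f'. ((\<lambda>\<zeta>. F ((x + h n *s w) + \<zeta> *s (u + h n *s u')) $ k) has_field_derivative f') (at \<zeta>)"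
          using holomorphic_line[OF S F] by blast
      qed
      show "(\<lambda>\<zeta>. F (?x \<zeta>) $ k) holomorphic_on ball \<zeta>0 r"
        unfolding holomorphic_on_open[OF open_ball]
      proof
        fix \<zeta> assume \<zeta>: "\<zeta> \<in> ball \<zeta>0 r"
        have "?x \<zeta> \<in> S" using inS[OF xw, of \<zeta> \<zeta>] near[OF \<zeta>] by blast
        then show "\<exists>f'. ((\<lambda>\<zeta>. F (?x \<zeta>) $ k) has_field_derivative f') (at \<zeta>)"
          using holomorphic_line[OF S F x u] by blast
      qed
    qed
  next
    fix \<zeta> assume "\<zeta> \<in> ball \<zeta>0 r"
    then obtain d where d: "d > 0" "cball \<zeta> d \<subseteq> ball \<zeta>0 r" using open_contains_cball[of "ball \<zeta>0 r"] open_ball by blast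
    have "uniform_limit (cball \<zeta> d) (\<lambda>n \<zeta>. (\<lambda>(x, w). (F (x + h n *s w) $ k - F x $ k) / h n) (?x \<zeta>, ?w \<zeta>))
       (\<lambda>\<zeta>. (\<lambda>(x, w). dirderiv F w x $ k) (?x \<zeta>, ?w \<zeta>)) sequentially"
      by (rule uniform_limit_compose'[OF ul]) (use d near xw in \<open>auto simp: dist_commute\<close>)
    then have "uniform_limit (cball \<zeta> d) (\<lambda>n \<zeta>. (F (?x \<zeta> + h n *s ?w \<zeta>) $ k - F (?x \<zeta>) $ k) / h n) ?g sequentially"
      by simp
    with d show "\<exists>d>0. cball \<zeta> d \<subseteq> ball \<zeta>0 r \<and>
       uniform_limit (cball \<zeta> d) (\<lambda>n \<zeta>. (F (?x \<zeta> + h n *s ?w \<zeta>) $ k - F (?x \<zeta>) $ k) / h n) ?g sequentially" by blast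
  qed
  then show "\<exists>f'. (?g has_field_derivative f') (at \<zeta>0)"
    using r(1) by (auto simp: holomorphic_on_open)
qed


section \<open>Hermitian forms\<close>

text \<open>
  Sesquilinear in the pattern of the metric components: the second index is the conjugated one.
\<close>

definition sesq :: "'n::finite set \<Rightarrow> ('n \<Rightarrow> 'n \<Rightarrow> complex) \<Rightarrow> complex^'n \<Rightarrow> complex^'n \<Rightarrow> complex"
  where "sesq J E v w = (\<Sum>k\<in>J. \<Sum>l\<in>J. E k l * v $ k * cnj (w $ l))"

lemma sesq_add_left: "sesq J E (u + v) w = sesq J E u w + sesq J E v w"
  by (simp add: sesq_def sum.distrib[symmetric] algebra_simps)

lemma sesq_add_right: "sesq J E w (u + v) = sesq J E w u + sesq J E w v"
  by (simp add: sesq_def sum.distrib[symmetric] algebra_simps)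

lemma sesq_scale_left: "sesq J E (a *s v) w = a * sesq J E v w"
  by (simp add: sesq_def sum_distrib_left algebra_simps)

lemma sesq_scale_right: "sesq J E v (a *s w) = cnj a * sesq J E v w"
  by (simp add: sesq_def sum_distrib_left algebra_simps)

lemma sesq_add_form: "sesq J (\<lambda>k l. E k l + E' k l) v w = sesq J E v w + sesq J E' v w"
  by (simp add: sesq_def sum.distrib[symmetric] algebra_simps)

lemma sesq_scale_form: "sesq J (\<lambda>k l. a * E k l) v w = a * sesq J E v w"
  by (simp add: sesq_def sum_distrib_left algebra_simps)

lemma sesq_cnj:
  assumes "\<And>k l. k \<in> J \<Longrightarrow> l \<in> J \<Longrightarrow> E' l k = cnj (E k l)"
  shows "cnj (sesq J E v w) = sesq J E' w v"
proof -
  have "cnj (sesq J E v w) = (\<Sum>k\<in>J. \<Sum>l\<in>J. E' l k * w $ l * cnj (v $ k))"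
    unfolding sesq_def cnj_sum by (intro sum.cong refl) (simp add: assms)
  then show ?thesis unfolding sesq_def by (subst sum.swap) simp
qed

lemma sesq_real:
  assumes "\<And>k l. k \<in> J \<Longrightarrow> l \<in> J \<Longrightarrow> E l k = cnj (E k l)"
  shows "Im (sesq J E v v) = 0"
proof -
  have "cnj (sesq J E v v) = sesq J E v v" by (rule sesq_cnj) (rule assms)
  then have "Im (cnj (sesq J E v v)) = Im (sesq J E v v)" by (rule arg_cong)
  then show ?thesis by simp
qed

definition pos_hermitian :: "'n::finite set \<Rightarrow> ('n \<Rightarrow> 'n \<Rightarrow> complex) \<Rightarrow> bool"
  where "pos_hermitian J G \<longleftrightarrow> (\<forall>k\<in>J. \<forall>l\<in>J. G l k = cnj (G k l)) \<and>
    (\<forall>v\<in>coord_space J. v \<noteq> 0 \<longrightarrow> 0 < Re (sesq J G v v))"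

lemma pos_hermitian_swap: "pos_hermitian J G \<Longrightarrow> k \<in> J \<Longrightarrow> l \<in> J \<Longrightarrow> G l k = cnj (G k l)"
  unfolding pos_hermitian_def by blast

lemma pos_hermitian_pos: "pos_hermitian J G \<Longrightarrow> v \<in> coord_space J \<Longrightarrow> v \<noteq> 0 \<Longrightarrow> 0 < Re (sesq J G v v)"
  unfolding pos_hermitian_def by blast

lemma pos_hermitian_cnj: "pos_hermitian J G \<Longrightarrow> cnj (sesq J G v w) = sesq J G w v"
  by (rule sesq_cnj) (rule pos_hermitian_swap)

lemma pos_hermitian_real:
  assumes "pos_hermitian J G"
  shows "sesq J G v v = of_real (Re (sesq J G v v))"
proof -
  have "Im (sesq J G v v) = 0" by (rule sesq_real) (rule pos_hermitian_swap[OF assms])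
  then show ?thesis by (simp add: complex_eq_iff)
qed

lemma pos_hermitian_nonneg:
  assumes "pos_hermitian J G" "v \<in> coord_space J"
  shows "0 \<le> Re (sesq J G v v)"
proof (cases "v = 0")
  case True
  then show ?thesis by (simp add: sesq_def)
qed (use pos_hermitian_pos[OF assms] in simp)

text \<open>
  As usual, from non-negativity on \<open>v - c *s w\<close> with \<open>c\<close> the quotient of \<open>\<langle>v, w\<rangle>\<close> by \<open>\<langle>w, w\<rangle>\<close>.
\<close>

lemma pos_hermitian_Cauchy_Schwarz:
  assumes G: "pos_hermitian J G" and v: "v \<in> coord_space J" and w: "w \<in> coord_space J"
  shows "(cmod (sesq J G v w))\<^sup>2 \<le> Re (sesq J G v v) * Re (sesq J G w w)"
proof (cases "w = 0")
  case True
  then show ?thesis by (simp add: sesq_def)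
next
  case False
  define W where "W = Re (sesq J G w w)"
  have W: "W > 0" unfolding W_def by (rule pos_hermitian_pos[OF G w False])
  have WW: "sesq J G w w = of_real W" using pos_hermitian_real[OF G] by (simp add: W_def)
  define c where "c = sesq J G v w / of_real W"
  have wv: "sesq J G w v = cnj (sesq J G v w)" using pos_hermitian_cnj[OF G] by simp
  have "0 \<le> Re (sesq J G (v + (- c) *s w) (v + (- c) *s w))"
    by (rule pos_hermitian_nonneg[OF G]) (intro coord_space_intros v w)
  also have "sesq J G (v + (- c) *s w) (v + (- c) *s w) =
    sesq J G v v - cnj c * sesq J G v w - c * cnj (sesq J G v w) + c * cnj c * of_real W"
    unfolding sesq_add_left sesq_add_right sesq_scale_left sesq_scale_right wv WW by (simp add: algebra_simps)
  also have "\<dots> = sesq J G v v - of_real ((cmod (sesq J G v w))\<^sup>2 / W)"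
  proof -
    have "cnj c * sesq J G v w = of_real ((cmod (sesq J G v w))\<^sup>2 / W)"
      "c * cnj (sesq J G v w) = of_real ((cmod (sesq J G v w))\<^sup>2 / W)"
      using W by (simp_all add: c_def complex_norm_square mult.commute del: of_real_power)
    moreover have "c * cnj c * of_real W = c * cnj (sesq J G v w)" using W by (simp add: c_def)
    ultimately show ?thesis by simp
  qed
  finally have "(cmod (sesq J G v w))\<^sup>2 / W \<le> Re (sesq J G v v)" by simp
  then show ?thesis using W by (simp add: W_def[symmetric] field_simps)
qed

text \<open>
  The block on \<open>J\<close> is completed by the identity to a matrix over the whole index type. A kernel vector
  \<open>x\<close> vanishes off \<open>J\<close>, and its conjugate has norm zero.
\<close>

lemma pos_hermitian_matrix_inj:
  assumes G: "pos_hermitian J G"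
  defines "A \<equiv> \<chi> k q. if k \<in> J \<and> q \<in> J then G k q else if k = q then 1 else 0"
  shows "inj ((*v) A)"
proof (rule inj_onI)
  have zero: "x = 0" if "A *v x = 0" for x
  proof -
    have comp: "(\<Sum>q\<in>UNIV. A $ k $ q * x $ q) = 0" for k
      using that by (simp add: matrix_vector_mult_def vec_eq_iff)
    have off: "x $ k = 0" if "k \<notin> J" for k
    proof -
      have "(\<Sum>q\<in>UNIV. A $ k $ q * x $ q) = (\<Sum>q\<in>UNIV. if q = k then x $ k else 0)"
        using that by (intro sum.cong) (auto simp: A_def)
      then show ?thesis using comp[of k] by simp
    qed
    have on: "(\<Sum>q\<in>J. G k q * x $ q) = 0" if "k \<in> J" for k
    proof -
      have "(\<Sum>q\<in>UNIV. A $ k $ q * x $ q) = (\<Sum>q\<in>J. A $ k $ q * x $ q)"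
        by (intro sum.mono_neutral_right) (auto simp: off)
      then show ?thesis using comp[of k] that by (simp add: A_def)
    qed
    define y where "y = (\<chi> k. cnj (x $ k))"
    have "sesq J G y y = (\<Sum>k\<in>J. cnj (x $ k) * (\<Sum>q\<in>J. G k q * x $ q))"
      unfolding sesq_def y_def sum_distrib_left by (intro sum.cong refl) (simp add: algebra_simps)
    also have "\<dots> = 0" by (simp add: on)
    finally have "sesq J G y y = 0" .
    moreover have "y \<in> coord_space J" using off by (simp add: y_def coord_space_def)
    ultimately have "y = 0" using pos_hermitian_pos[OF G, of y] by fastforce
    then show ?thesis by (simp add: y_def vec_eq_iff)
  qed
  fix x y assume "A *v x = A *v y"
  then have "A *v (x - y) = 0" by (simp add: matrix_vector_mult_diff_distrib)
  then show "x = y" using zero[of "x - y"] by simp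
qed

text \<open>
  The inverse of the completed matrix shows that the definite description has a (unique) witness. A left
  inverse of a square matrix is also a right inverse, which yields the contraction over the first index
  rather than over the second one.
\<close>

lemma inverse_metric_props:
  assumes G: "pos_hermitian J G"
  shows "p \<notin> J \<or> q \<notin> J \<Longrightarrow> inverse_metric J G p q = 0"
    and "l \<in> J \<Longrightarrow> q \<in> J \<Longrightarrow> (\<Sum>p\<in>J. G p l * inverse_metric J G p q) = (if l = q then 1 else 0)"
proof -
  define A where "A = (\<chi> k q. if k \<in> J \<and> q \<in> J then G k q else if k = q then 1 else (0::complex))"
  have inj: "inj ((*v) A)" unfolding A_def by (rule pos_hermitian_matrix_inj[OF G])
  then obtain B where BA: "B ** A = mat 1" using matrix_left_invertible_injective by blast
  then have AB: "A ** B = mat 1" using matrix_left_right_inverse by blast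
  define H where "H = (\<lambda>p q. if p \<in> J \<and> q \<in> J then B $ q $ p else 0)"
  let ?P = "\<lambda>H. (\<forall>p q. p \<notin> J \<or> q \<notin> J \<longrightarrow> H p q = 0) \<and>
    (\<forall>p\<in>J. \<forall>k\<in>J. (\<Sum>q\<in>J. H p q * G k q) = (if p = k then 1 else 0))"
  have 1: "(\<Sum>q\<in>J. H p q * G k q) = (if p = k then 1 else 0)" if "p \<in> J" "k \<in> J" for p k
  proof -
    have "(\<Sum>q\<in>J. H p q * G k q) = (\<Sum>q\<in>UNIV. A $ k $ q * B $ q $ p)"
      using that by (intro sum.mono_neutral_cong_left) (auto simp: H_def A_def)
    also have "\<dots> = (A ** B) $ k $ p" by (simp add: matrix_matrix_mult_def)
    finally show ?thesis unfolding AB by (auto simp: mat_def)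
  qed
  have 2: "(\<Sum>p\<in>J. G p l * H p q) = (if l = q then 1 else 0)" if "l \<in> J" "q \<in> J" for l q
  proof -
    have "(\<Sum>p\<in>J. G p l * H p q) = (\<Sum>p\<in>UNIV. B $ q $ p * A $ p $ l)"
      using that by (intro sum.mono_neutral_cong_left) (auto simp: H_def A_def)
    also have "\<dots> = (B ** A) $ q $ l" by (simp add: matrix_matrix_mult_def)
    finally show ?thesis unfolding BA by (auto simp: mat_def)
  qed
  have PH: "?P H" using 1 by (auto simp: H_def)
  have uniq: "H' = H" if P': "?P H'" for H'
  proof (rule ext, rule ext)
    fix p q
    show "H' p q = H p q"
    proof (cases "p \<in> J")
      case True
      define y where "y = (\<chi> q. H' p q - H p q)"
      have "(A *v y) $ k = 0" for k
      proof (cases "k \<in> J")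
        case k: True
        have "(A *v y) $ k = (\<Sum>q\<in>UNIV. A $ k $ q * y $ q)" by (simp add: matrix_vector_mult_def)
        also have "\<dots> = (\<Sum>q\<in>J. H' p q * G k q - H p q * G k q)"
          using k by (intro sum.mono_neutral_cong_right) (auto simp: A_def y_def algebra_simps)
        also have "\<dots> = 0" using P' PH True k by (simp add: sum_subtractf)
        finally show ?thesis .
      next
        case k: False
        have "(A *v y) $ k = (\<Sum>q\<in>UNIV. A $ k $ q * y $ q)" by (simp add: matrix_vector_mult_def)
        also have "\<dots> = 0" using k P' PH by (intro sum.neutral) (auto simp: A_def y_def)
        finally show ?thesis .
      qed
      then have "A *v y = A *v 0" by (simp add: vec_eq_iff)
      then have "y = 0" using inj by (rule injD[rotated])
      then show ?thesis by (simp add: y_def vec_eq_iff)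
    qed (use P' PH in auto)
  qed
  have eq: "inverse_metric J G = H"
    unfolding inverse_metric_def
  proof (rule the_equality)
    show "?P H" by (rule PH)
    show "H' = H" if "?P H'" for H' using that by (rule uniq)
  qed
  show "p \<notin> J \<or> q \<notin> J \<Longrightarrow> inverse_metric J G p q = 0" by (auto simp: eq H_def)
  show "l \<in> J \<Longrightarrow> q \<in> J \<Longrightarrow> (\<Sum>p\<in>J. G p l * inverse_metric J G p q) = (if l = q then 1 else 0)"
    unfolding eq by (rule 2)
qed

text \<open>
  Represents the linear form \<open>w \<mapsto> \<Sum>l. \<alpha> l * cnj (w $ l)\<close> as an inner product with a vector \<open>X\<close>, so that
  the quadratic term of the Chern curvature becomes the squared norm of \<open>X\<close>.
\<close>

lemma raise_index:
  assumes G: "pos_hermitian J G"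
  obtains X where "X \<in> coord_space J" "\<And>l. l \<in> J \<Longrightarrow> (\<Sum>p\<in>J. G p l * X $ p) = \<alpha> l"
    "(\<Sum>p\<in>J. \<Sum>q\<in>J. inverse_metric J G p q * \<alpha> q * cnj (\<alpha> p)) = sesq J G X X"
proof -
  let ?H = "inverse_metric J G"
  define X where "X = (\<chi> p. \<Sum>q\<in>J. ?H p q * \<alpha> q)"
  have X: "X \<in> coord_space J"
    by (simp add: X_def coord_space_def inverse_metric_props(1)[OF G])
  have lower: "(\<Sum>p\<in>J. G p l * X $ p) = \<alpha> l" if "l \<in> J" for l
  proof -
    have "(\<Sum>p\<in>J. G p l * X $ p) = (\<Sum>q\<in>J. (\<Sum>p\<in>J. G p l * ?H p q) * \<alpha> q)"
      unfolding X_def vec_lambda_beta sum_distrib_left sum_distrib_right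
      by (subst sum.swap) (simp add: algebra_simps)
    also have "\<dots> = (\<Sum>q\<in>J. if l = q then \<alpha> q else 0)"
      by (intro sum.cong refl) (simp add: inverse_metric_props(2)[OF G that])
    finally show ?thesis using that by simp
  qed
  have herm: "cnj (G r p) = G p r" if "r \<in> J" "p \<in> J" for r p
    by (rule pos_hermitian_swap[OF G that, symmetric])
  have "(\<Sum>p\<in>J. \<Sum>q\<in>J. ?H p q * \<alpha> q * cnj (\<alpha> p)) = (\<Sum>p\<in>J. X $ p * cnj (\<alpha> p))"
    by (simp add: X_def sum_distrib_right)
  also have "\<dots> = (\<Sum>p\<in>J. X $ p * cnj (\<Sum>r\<in>J. G r p * X $ r))"
    by (intro sum.cong refl) (simp add: lower)
  also have "\<dots> = sesq J G X X"
    unfolding sesq_def cnj_sum sum_distrib_left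
    by (intro sum.cong refl) (simp add: herm algebra_simps)
  finally show ?thesis using that[OF X lower] by blast
qed

section \<open>Log-plurisubharmonicity from non-positive bisectional curvature\<close>

lemma sum_swap_pairs:
  "(\<Sum>i\<in>A. \<Sum>j\<in>B. \<Sum>k\<in>C. \<Sum>l\<in>D. f i j k l) = (\<Sum>k\<in>C. \<Sum>l\<in>D. \<Sum>i\<in>A. \<Sum>j\<in>B. f i j k l)"
proof -
  have "(\<Sum>j\<in>B. \<Sum>k\<in>C. \<Sum>l\<in>D. f i j k l) = (\<Sum>k\<in>C. \<Sum>l\<in>D. \<Sum>j\<in>B. f i j k l)" for i
    by (subst sum.swap, intro sum.cong refl, rule sum.swap)
  then have "(\<Sum>i\<in>A. \<Sum>j\<in>B. \<Sum>k\<in>C. \<Sum>l\<in>D. f i j k l) = (\<Sum>i\<in>A. \<Sum>k\<in>C. \<Sum>l\<in>D. \<Sum>j\<in>B. f i j k l)"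
    by simp
  also have "\<dots> = (\<Sum>k\<in>C. \<Sum>l\<in>D. \<Sum>i\<in>A. \<Sum>j\<in>B. f i j k l)"
    by (subst sum.swap, intro sum.cong refl, rule sum.swap)
  finally show ?thesis .
qed

lemma sum_product_pairs:
  fixes h :: complex
  shows "h * (\<Sum>i\<in>A. \<Sum>k\<in>B. f i k) * (\<Sum>j\<in>C. \<Sum>l\<in>D. g j l) =
    (\<Sum>i\<in>A. \<Sum>k\<in>B. \<Sum>j\<in>C. \<Sum>l\<in>D. h * f i k * g j l)"
proof -
  have "h * (\<Sum>i\<in>A. \<Sum>k\<in>B. f i k) * R = (\<Sum>i\<in>A. \<Sum>k\<in>B. h * f i k * R)" for R
    by (simp add: sum_distrib_left sum_distrib_right)
  then show ?thesis unfolding sum_distrib_left[symmetric] .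
qed

lemma second_derivative_product:
  fixes X Y Z :: "real \<Rightarrow> complex"
  assumes X: "\<And>t. t \<in> T \<Longrightarrow> (X has_vector_derivative X1 t) (at t)" "(X1 has_vector_derivative X2) (at 0)"
    and Y: "\<And>t. t \<in> T \<Longrightarrow> (Y has_vector_derivative Y1 t) (at t)" "(Y1 has_vector_derivative Y2) (at 0)"
    and Z: "\<And>t. t \<in> T \<Longrightarrow> (Z has_vector_derivative Z1 t) (at t)" "(Z1 has_vector_derivative Z2) (at 0)"
    and T: "0 \<in> T"
  shows "t \<in> T \<Longrightarrow> ((\<lambda>t. X t * Y t * Z t) has_vector_derivative X1 t * Y t * Z t + X t * Y1 t * Z t + X t * Y t * Z1 t) (at t)"
    and "((\<lambda>t. X1 t * Y t * Z t + X t * Y1 t * Z t + X t * Y t * Z1 t) has_vector_derivative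
      X2 * Y 0 * Z 0 + X 0 * Y2 * Z 0 + X 0 * Y 0 * Z2
      + 2 * (X1 0 * Y1 0 * Z 0 + X1 0 * Y 0 * Z1 0 + X 0 * Y1 0 * Z1 0)) (at 0)"
proof -
  have triple: "((\<lambda>t. A t * B t * C t) has_vector_derivative A' * B t * C t + A t * B' * C t + A t * B t * C') (at t)"
    if "(A has_vector_derivative A') (at t)" "(B has_vector_derivative B') (at t)" "(C has_vector_derivative C') (at t)"
    for A B C :: "real \<Rightarrow> complex" and A' B' C' t
    using has_vector_derivative_mult[OF has_vector_derivative_mult[OF that(1,2)] that(3)]
    by (simp add: algebra_simps)
  show "t \<in> T \<Longrightarrow> ((\<lambda>t. X t * Y t * Z t) has_vector_derivative X1 t * Y t * Z t + X t * Y1 t * Z t + X t * Y t * Z1 t) (at t)"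
    by (intro triple X Y Z)
  have "((\<lambda>t. X1 t * Y t * Z t + X t * Y1 t * Z t + X t * Y t * Z1 t) has_vector_derivative
      (X2 * Y 0 * Z 0 + X1 0 * Y1 0 * Z 0 + X1 0 * Y 0 * Z1 0)
      + (X1 0 * Y1 0 * Z 0 + X 0 * Y2 * Z 0 + X 0 * Y1 0 * Z1 0)
      + (X1 0 * Y 0 * Z1 0 + X 0 * Y1 0 * Z1 0 + X 0 * Y 0 * Z2)) (at 0)"
    by (intro has_vector_derivative_add triple X Y Z T)
  then show "((\<lambda>t. X1 t * Y t * Z t + X t * Y1 t * Z t + X t * Y t * Z1 t) has_vector_derivative
      X2 * Y 0 * Z 0 + X 0 * Y2 * Z 0 + X 0 * Y 0 * Z2
      + 2 * (X1 0 * Y1 0 * Z 0 + X1 0 * Y 0 * Z1 0 + X 0 * Y1 0 * Z1 0)) (at 0)"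
    by (simp add: algebra_simps)
qed

text \<open>
  The derivative of a vector-valued holomorphic curve. Being a total function it can be iterated.
\<close>

definition cderiv :: "(complex \<Rightarrow> complex^'n) \<Rightarrow> complex \<Rightarrow> complex^'n"
  where "cderiv \<phi> \<zeta> = (\<chi> k. deriv (\<lambda>\<zeta>. \<phi> \<zeta> $ k) \<zeta>)"

lemma has_vector_derivative_holomorphic_ray:
  assumes "p holomorphic_on ball 0 r" "cmod \<theta> = 1" "\<bar>t\<bar> < r"
  shows "((\<lambda>t. p (of_real t * \<theta>)) has_vector_derivative \<theta> * deriv p (of_real t * \<theta>)) (at t)"
proof -
  have "of_real t * \<theta> \<in> ball 0 r" using assms by (simp add: norm_mult)
  then have "(p has_field_derivative deriv p (of_real t * \<theta>)) (at (of_real t * \<theta>))"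
    by (rule holomorphic_derivI[OF assms(1) open_ball])
  moreover have "((\<lambda>t. of_real t * \<theta>) has_vector_derivative \<theta>) (at t)"
    using bounded_linear_imp_has_derivative[OF bounded_linear_scaleR_left[of \<theta>]]
    by (simp add: has_vector_derivative_def scaleR_conv_of_real)
  ultimately have "((p \<circ> (\<lambda>t. of_real t * \<theta>)) has_vector_derivative \<theta> * deriv p (of_real t * \<theta>)) (at t)"
    by (intro field_vector_diff_chain_at)
  then show ?thesis by (simp add: o_def)
qed

lemma cderiv_in_coord_space:
  assumes "\<And>\<zeta>. \<zeta> \<in> ball 0 r \<Longrightarrow> \<phi> \<zeta> \<in> coord_space J" "\<zeta> \<in> ball 0 r"
  shows "cderiv \<phi> \<zeta> \<in> coord_space J"
  unfolding coord_space_def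
proof (clarify)
  fix k assume k: "k \<notin> J"
  have "((\<lambda>\<zeta>. \<phi> \<zeta> $ k) has_field_derivative 0) (at \<zeta>)"
    by (rule has_field_derivative_transform_within_open[of "\<lambda>_. 0" _ _ "ball 0 r"])
       (use assms k in \<open>auto simp: coord_space_def\<close>)
  then show "cderiv \<phi> \<zeta> $ k = 0" by (simp add: cderiv_def DERIV_imp_deriv)
qed

text \<open>
  Differentiation along the ray in direction \<open>\<theta>\<close> multiplies the complex derivative by \<open>\<theta>\<close>. Hence the
  second derivatives along the rays in directions \<open>1\<close> and \<open>\<i>\<close> are opposite.
\<close>

lemma second_derivative_holomorphic_ray:
  assumes hol: "\<And>k. (\<lambda>\<zeta>. \<phi> \<zeta> $ k) holomorphic_on ball 0 r" and r: "r > 0" and \<theta>: "cmod \<theta> = 1"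
  shows "\<bar>t\<bar> < r \<Longrightarrow> ((\<lambda>t. \<phi> (of_real t * \<theta>)) has_vector_derivative \<theta> *s cderiv \<phi> (of_real t * \<theta>)) (at t)"
    and "((\<lambda>t. \<theta> *s cderiv \<phi> (of_real t * \<theta>)) has_vector_derivative \<theta> *s (\<theta> *s cderiv (cderiv \<phi>) 0)) (at 0)"
proof -
  show "\<bar>t\<bar> < r \<Longrightarrow> ((\<lambda>t. \<phi> (of_real t * \<theta>)) has_vector_derivative \<theta> *s cderiv \<phi> (of_real t * \<theta>)) (at t)"
    by (rule has_vector_derivative_vecI)
       (simp add: cderiv_def has_vector_derivative_holomorphic_ray[OF hol \<theta>])
  have "(\<lambda>\<zeta>. deriv (\<lambda>\<zeta>. \<phi> \<zeta> $ k) \<zeta>) holomorphic_on ball 0 r" for k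
    by (rule holomorphic_deriv[OF hol open_ball])
  from has_vector_derivative_holomorphic_ray[OF this \<theta>, of 0] r
  have "((\<lambda>t. deriv (\<lambda>\<zeta>. \<phi> \<zeta> $ k) (of_real t * \<theta>)) has_vector_derivative \<theta> * deriv (deriv (\<lambda>\<zeta>. \<phi> \<zeta> $ k)) 0) (at 0)" for k
    by simp
  then have "((\<lambda>t. \<theta> * deriv (\<lambda>\<zeta>. \<phi> \<zeta> $ k) (of_real t * \<theta>)) has_vector_derivative \<theta> * (\<theta> * deriv (deriv (\<lambda>\<zeta>. \<phi> \<zeta> $ k)) 0)) (at 0)" for k
    by (rule has_vector_derivative_mult_right)
  then show "((\<lambda>t. \<theta> *s cderiv \<phi> (of_real t * \<theta>)) has_vector_derivative \<theta> *s (\<theta> *s cderiv (cderiv \<phi>) 0)) (at 0)"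
    by (intro has_vector_derivative_vecI) (simp add: cderiv_def mult.assoc)
qed

text \<open>
  The heart of the matter: a holomorphic vector field \<open>s\<close> along a holomorphic disc \<open>\<phi>\<close> satisfies
  \<open>G \<Delta>G \<ge> \<bar>\<nabla>G\<bar>\<^sup>2\<close> at 0, with \<open>G\<close> its squared norm. Write \<open>a\<close> and \<open>b\<close> for the derivatives of \<open>\<phi>\<close> and \<open>s\<close>
  at 0, \<open>v = s 0\<close>, and \<open>X\<close> for the vector with \<open>\<langle>X, w\<rangle> = \<partial>\<^sub>a g (v, w)\<close> for all \<open>w\<close>; in classical terms \<open>X\<close> is the Christoffel
  term, and \<open>X + b\<close> the covariant derivative of \<open>s\<close>. Then \<open>\<nabla>G\<close> is given by \<open>2 \<langle>X + b, v\<rangle>\<close>, and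
  \<open>\<Delta>G = 4 \<bar>X + b\<bar>\<^sup>2 - 4 R (a, a, v, v)\<close>. As the curvature term has the right sign, the
  Cauchy-Schwarz inequality concludes.
\<close>

lemma bisectional_log_convexity:
  fixes g :: "'n::finite \<Rightarrow> 'n \<Rightarrow> complex^'n \<Rightarrow> complex"
  assumes S: "openin_coord J S"
    and g: "\<And>k l. k \<in> J \<Longrightarrow> l \<in> J \<Longrightarrow> C2_on J S (g k l)"
    and pos: "\<And>y. y \<in> S \<Longrightarrow> pos_hermitian J (\<lambda>k l. g k l y)"
    and r: "r > 0"
    and \<phi>: "\<And>\<zeta>. \<zeta> \<in> ball 0 r \<Longrightarrow> \<phi> \<zeta> \<in> S" "\<And>k. (\<lambda>\<zeta>. \<phi> \<zeta> $ k) holomorphic_on ball 0 r"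
    and s: "\<And>\<zeta>. \<zeta> \<in> ball 0 r \<Longrightarrow> s \<zeta> \<in> coord_space J" "\<And>k. (\<lambda>\<zeta>. s \<zeta> $ k) holomorphic_on ball 0 r"
    and curv: "\<And>u v. u \<in> coord_space J \<Longrightarrow> v \<in> coord_space J \<Longrightarrow>
      Re (\<Sum>i\<in>J. \<Sum>j\<in>J. \<Sum>k\<in>J. \<Sum>l\<in>J.
         (- d_dz i (d_dzbar j (g k l)) (\<phi> 0) + (\<Sum>p\<in>J. \<Sum>q\<in>J.
            inverse_metric J (\<lambda>a b. g a b (\<phi> 0)) p q * d_dz i (g k q) (\<phi> 0) * d_dzbar j (g p l) (\<phi> 0))) *
         u $ i * cnj (u $ j) * v $ k * cnj (v $ l)) \<le> 0"
  defines "G \<equiv> \<lambda>\<zeta>. sesq J (\<lambda>k l. g k l (\<phi> \<zeta>)) (s \<zeta>) (s \<zeta>)"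
  obtains G1 G2 where
    "\<And>\<theta> t. \<theta> \<in> {1, \<i>} \<Longrightarrow> \<bar>t\<bar> < r \<Longrightarrow> ((\<lambda>t. Re (G (of_real t * \<theta>))) has_real_derivative G1 \<theta> t) (at t)"
    "\<And>\<theta>. \<theta> \<in> {1, \<i>} \<Longrightarrow> (G1 \<theta> has_real_derivative G2 \<theta>) (at 0)"
    "(G1 1 0)\<^sup>2 + (G1 \<i> 0)\<^sup>2 \<le> Re (G 0) * (G2 1 + G2 \<i>)"
proof -
  define y where "y = \<phi> 0"
  define a where "a = cderiv \<phi> 0"
  define a2 where "a2 = cderiv (cderiv \<phi>) 0"
  define v where "v = s 0"
  define b where "b = cderiv s 0"
  define b2 where "b2 = cderiv (cderiv s) 0"
  have \<phi>J: "\<phi> \<zeta> \<in> coord_space J" if "\<zeta> \<in> ball 0 r" for \<zeta> using \<phi>(1)[OF that] openin_coord_subset[OF S] by auto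
  have d\<phi>J: "cderiv \<phi> \<zeta> \<in> coord_space J" if "\<zeta> \<in> ball 0 r" for \<zeta> using cderiv_in_coord_space[OF \<phi>J that] .
  have dsJ: "cderiv s \<zeta> \<in> coord_space J" if "\<zeta> \<in> ball 0 r" for \<zeta> using cderiv_in_coord_space[OF s(1) that] .
  have yS: "y \<in> S" using \<phi>(1) r by (simp add: y_def)
  have aJ: "a \<in> coord_space J" and vJ: "v \<in> coord_space J" and bJ: "b \<in> coord_space J"
    using d\<phi>J[of 0] s(1)[of 0] dsJ[of 0] r by (simp_all add: a_def v_def b_def)
  have a2J: "a2 \<in> coord_space J"
    unfolding a2_def by (rule cderiv_in_coord_space[OF d\<phi>J]) (use r in auto)
  have iaJ: "\<i> *s a \<in> coord_space J" using aJ by (rule coord_space_scale)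
  \<comment> \<open>Derivatives of the metric coefficients along the ray in direction \<open>\<theta>\<close>, and those of the products
    \<open>g\<^sub>k\<^sub>l(\<phi>) s\<^sub>k cnj(s\<^sub>l)\<close> whose sum is G.\<close>
  define X1 where "X1 = (\<lambda>\<theta> k l t. dirderiv (g k l) (\<theta> *s cderiv \<phi> (of_real t * \<theta>)) (\<phi> (of_real t * \<theta>)))"
  define X2 where "X2 = (\<lambda>\<theta> k l. dirderiv (g k l) (\<theta> *s (\<theta> *s a2)) y + dirderiv (dirderiv (g k l) (\<theta> *s a)) (\<theta> *s a) y)"
  define P1 where "P1 = (\<lambda>\<theta> k l t.
      X1 \<theta> k l t * s (of_real t * \<theta>) $ k * cnj (s (of_real t * \<theta>) $ l)
      + g k l (\<phi> (of_real t * \<theta>)) * (\<theta> * cderiv s (of_real t * \<theta>) $ k) * cnj (s (of_real t * \<theta>) $ l)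
      + g k l (\<phi> (of_real t * \<theta>)) * s (of_real t * \<theta>) $ k * cnj (\<theta> * cderiv s (of_real t * \<theta>) $ l))"
  define P2 where "P2 = (\<lambda>\<theta> k l.
      X2 \<theta> k l * v $ k * cnj (v $ l) + g k l y * (\<theta> * (\<theta> * b2 $ k)) * cnj (v $ l) + g k l y * v $ k * cnj (\<theta> * (\<theta> * b2 $ l))
      + 2 * (X1 \<theta> k l 0 * (\<theta> * b $ k) * cnj (v $ l) + X1 \<theta> k l 0 * v $ k * cnj (\<theta> * b $ l)
         + g k l y * (\<theta> * b $ k) * cnj (\<theta> * b $ l)))"
  define G1 where "G1 = (\<lambda>\<theta> t. Re (\<Sum>k\<in>J. \<Sum>l\<in>J. P1 \<theta> k l t))"
  define G2 where "G2 = (\<lambda>\<theta>. Re (\<Sum>k\<in>J. \<Sum>l\<in>J. P2 \<theta> k l))"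
  define T where "T = {-r<..<r}"
  have T: "open T" "0 \<in> T" using r by (auto simp: T_def)
  have prod: "t \<in> T \<Longrightarrow> ((\<lambda>t. g k l (\<phi> (of_real t * \<theta>)) * s (of_real t * \<theta>) $ k * cnj (s (of_real t * \<theta>) $ l)) has_vector_derivative P1 \<theta> k l t) (at t)"
      "(P1 \<theta> k l has_vector_derivative P2 \<theta> k l) (at 0)"
    if kl: "k \<in> J" "l \<in> J" and th: "\<theta> \<in> {1, \<i>}" for k l \<theta> t
  proof -
    have \<theta>: "cmod \<theta> = 1" using th by auto
    have ball: "of_real t * \<theta> \<in> ball 0 r" if "t \<in> T" for t
      using that \<theta> by (auto simp: T_def norm_mult)
    have gd: "g k l differentiable_on S" using g[OF kl] by (simp add: C2_on_def)
    have ray: "((\<lambda>t. \<phi> (of_real t * \<theta>)) has_vector_derivative \<theta> *s cderiv \<phi> (of_real t * \<theta>)) (at t)" if "t \<in> T" for t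
      by (rule second_derivative_holomorphic_ray(1)[OF \<phi>(2) r \<theta>]) (use that in \<open>auto simp: T_def\<close>)
    have ray2: "((\<lambda>t. \<theta> *s cderiv \<phi> (of_real t * \<theta>)) has_vector_derivative \<theta> *s (\<theta> *s a2)) (at 0)"
      unfolding a2_def by (rule second_derivative_holomorphic_ray(2)[OF \<phi>(2) r \<theta>])
    have dJ: "\<theta> *s cderiv \<phi> (of_real t * \<theta>) \<in> coord_space J" if "t \<in> T" for t
      by (intro coord_space_scale d\<phi>J ball that)
    have Xd: "((\<lambda>t. g k l (\<phi> (of_real t * \<theta>))) has_vector_derivative X1 \<theta> k l t) (at t)" if "t \<in> T" for t
      unfolding X1_def
      by (rule has_vector_derivative_along_curve[OF S gd T(1) that, where \<gamma> = "\<lambda>t. \<phi> (of_real t * \<theta>)"])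
         (use \<phi>(1) ball ray dJ that in auto)
    have Xdd: "(X1 \<theta> k l has_vector_derivative X2 \<theta> k l) (at 0)"
      using second_derivative_along_curve[OF S g[OF kl] T, where \<gamma> = "\<lambda>t. \<phi> (of_real t * \<theta>)"
          and \<gamma>' = "\<lambda>t. \<theta> *s cderiv \<phi> (of_real t * \<theta>)" and \<gamma>'' = "\<theta> *s (\<theta> *s a2)"] \<phi>(1) ball ray ray2 dJ a2J
      by (simp add: X1_def X2_def y_def a_def coord_space_scale)
    have Yd: "((\<lambda>t. s (of_real t * \<theta>) $ j) has_vector_derivative \<theta> * cderiv s (of_real t * \<theta>) $ j) (at t)" if "t \<in> T" for t j
      using bounded_linear.has_vector_derivative[OF bounded_linear_vec_nth second_derivative_holomorphic_ray(1)[OF s(2) r \<theta>, of t], of j] that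
      by (auto simp: T_def)
    have Ydd: "((\<lambda>t. \<theta> * cderiv s (of_real t * \<theta>) $ j) has_vector_derivative \<theta> * (\<theta> * b2 $ j)) (at 0)" for j
      using bounded_linear.has_vector_derivative[OF bounded_linear_vec_nth second_derivative_holomorphic_ray(2)[OF s(2) r \<theta>], of j]
      by (simp add: b2_def mult.assoc)
    have Zd: "((\<lambda>t. cnj (s (of_real t * \<theta>) $ j)) has_vector_derivative cnj (\<theta> * cderiv s (of_real t * \<theta>) $ j)) (at t)" if "t \<in> T" for t j
      by (rule bounded_linear.has_vector_derivative[OF bounded_linear_cnj Yd[OF that]])
    have Zdd: "((\<lambda>t. cnj (\<theta> * cderiv s (of_real t * \<theta>) $ j)) has_vector_derivative cnj (\<theta> * (\<theta> * b2 $ j))) (at 0)" for j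
      by (rule bounded_linear.has_vector_derivative[OF bounded_linear_cnj Ydd])
    note D = second_derivative_product[OF Xd Xdd Yd[where j = k] Ydd[where j = k] Zd[where j = l] Zdd[where j = l] T(2)]
    show "t \<in> T \<Longrightarrow> ((\<lambda>t. g k l (\<phi> (of_real t * \<theta>)) * s (of_real t * \<theta>) $ k * cnj (s (of_real t * \<theta>) $ l)) has_vector_derivative P1 \<theta> k l t) (at t)"
      unfolding P1_def by (rule D(1))
    show "(P1 \<theta> k l has_vector_derivative P2 \<theta> k l) (at 0)"
      using D(2) unfolding P1_def P2_def by (simp add: y_def v_def b_def)
  qed
  have deriv1: "((\<lambda>t. Re (G (of_real t * \<theta>))) has_real_derivative G1 \<theta> t) (at t)"
    if "\<theta> \<in> {1, \<i>}" "\<bar>t\<bar> < r" for \<theta> t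
  proof -
    have "t \<in> T" using that by (auto simp: T_def)
    then have "((\<lambda>t. G (of_real t * \<theta>)) has_vector_derivative (\<Sum>k\<in>J. \<Sum>l\<in>J. P1 \<theta> k l t)) (at t)"
      unfolding G_def sesq_def by (intro has_vector_derivative_sum prod that)
    from bounded_linear.has_vector_derivative[OF bounded_linear_Re this]
    show ?thesis by (simp add: G1_def has_real_derivative_iff_has_vector_derivative)
  qed
  have deriv2: "(G1 \<theta> has_real_derivative G2 \<theta>) (at 0)" if "\<theta> \<in> {1, \<i>}" for \<theta>
  proof -
    have "((\<lambda>t. \<Sum>k\<in>J. \<Sum>l\<in>J. P1 \<theta> k l t) has_vector_derivative (\<Sum>k\<in>J. \<Sum>l\<in>J. P2 \<theta> k l)) (at 0)"
      by (intro has_vector_derivative_sum prod(2) that)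
    from bounded_linear.has_vector_derivative[OF bounded_linear_Re this]
    show ?thesis by (simp add: G1_def G2_def has_real_derivative_iff_has_vector_derivative)
  qed
  let ?gy = "\<lambda>k l. g k l y"
  have pos0: "pos_hermitian J ?gy" by (rule pos[OF yS])
  have herm: "g l k x = cnj (g k l x)" if "k \<in> J" "l \<in> J" "x \<in> S" for k l x
    by (rule pos_hermitian_swap[OF pos[OF that(3)] that(1,2)])
  have gdiff: "g k l differentiable_on S" if "k \<in> J" "l \<in> J" for k l
    using g[OF that] by (simp add: C2_on_def)
  have gdiff2: "dirderiv (g k l) w differentiable_on S" if "k \<in> J" "l \<in> J" "w \<in> coord_space J" for k l w
    using g[OF that(1,2)] that(3) by (simp add: C2_on_def)
  have herm1: "dirderiv (g l k) w x = cnj (dirderiv (g k l) w x)"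
    if kl: "k \<in> J" "l \<in> J" and w: "w \<in> coord_space J" and x: "x \<in> S" for k l w x
  proof -
    have "dirderiv (g l k) w x = dirderiv (\<lambda>x. cnj (g k l x)) w x"
      by (rule dirderiv_cong[OF S x w]) (rule herm[OF kl])
    also have "\<dots> = cnj (dirderiv (g k l) w x)"
      by (rule dirderiv_bounded_linear[OF S gdiff[OF kl] x w bounded_linear_cnj])
    finally show ?thesis .
  qed
  have herm2: "dirderiv (dirderiv (g l k) w) w' y = cnj (dirderiv (dirderiv (g k l) w) w' y)"
    if kl: "k \<in> J" "l \<in> J" and w: "w \<in> coord_space J" and w': "w' \<in> coord_space J" for k l w w'
  proof -
    have "dirderiv (dirderiv (g l k) w) w' y = dirderiv (\<lambda>x. cnj (dirderiv (g k l) w x)) w' y"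
      by (rule dirderiv_cong[OF S yS w']) (rule herm1[OF kl w])
    also have "\<dots> = cnj (dirderiv (dirderiv (g k l) w) w' y)"
      by (rule dirderiv_bounded_linear[OF S gdiff2[OF kl w] yS w' bounded_linear_cnj])
    finally show ?thesis .
  qed
  define d where "d = (\<lambda>w k l. dirderiv (g k l) w y)"
  define dd where "dd = (\<lambda>w w' k l. dirderiv (dirderiv (g k l) w) w' y)"
  \<comment> \<open>The (1,0)- and (0,1)-derivatives of the metric coefficients in the direction \<open>a\<close>; they are conjugate
    transposes of each other.\<close>
  define P where "P = (\<lambda>k l. (d a k l - \<i> * d (\<i> *s a) k l) / 2)"
  define Q where "Q = (\<lambda>k l. (d a k l + \<i> * d (\<i> *s a) k l) / 2)"
  have Phol: "(\<Sum>i\<in>J. a $ i * d_dz i (g k l) y) = P k l" if "k \<in> J" "l \<in> J" for k l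
    unfolding P_def d_def by (rule sum_d_dz[OF S gdiff[OF that] yS aJ])
  have Qhol: "(\<Sum>j\<in>J. cnj (a $ j) * d_dzbar j (g k l) y) = Q k l" if "k \<in> J" "l \<in> J" for k l
    unfolding Q_def d_def by (rule sum_d_dzbar[OF S gdiff[OF that] yS aJ])
  have dherm: "d w l k = cnj (d w k l)" if "k \<in> J" "l \<in> J" "w \<in> coord_space J" for k l w
    unfolding d_def by (rule herm1[OF that yS])
  have QP: "Q l k = cnj (P k l)" if "k \<in> J" "l \<in> J" for k l
    using dherm[OF that aJ] dherm[OF that iaJ] by (simp add: Q_def P_def)
  define \<alpha> where "\<alpha> = (\<lambda>l. \<Sum>k\<in>J. P k l * v $ k)"
  obtain X where X: "X \<in> coord_space J" "\<And>l. l \<in> J \<Longrightarrow> (\<Sum>p\<in>J. ?gy p l * X $ p) = \<alpha> l"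
    and XX: "(\<Sum>p\<in>J. \<Sum>q\<in>J. inverse_metric J ?gy p q * \<alpha> q * cnj (\<alpha> p)) = sesq J ?gy X X"
    by (rule raise_index[OF pos0, of \<alpha>]) (rule that)
  have PX: "sesq J P v w = sesq J ?gy X w" for w
  proof -
    have "sesq J P v w = (\<Sum>l\<in>J. \<alpha> l * cnj (w $ l))"
      unfolding sesq_def \<alpha>_def sum_distrib_right by (rule sum.swap)
    also have "\<dots> = (\<Sum>l\<in>J. (\<Sum>p\<in>J. ?gy p l * X $ p) * cnj (w $ l))"
      by (intro sum.cong refl) (simp add: X)
    also have "\<dots> = sesq J ?gy X w" unfolding sesq_def sum_distrib_right by (rule sum.swap)
    finally show ?thesis .
  qed
  have Qbv: "sesq J Q b v = cnj (sesq J P v b)"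
    by (rule sesq_cnj[symmetric]) (rule QP)
  show ?thesis
  proof (rule that[OF deriv1 deriv2])
    define LL where "LL = Re (sesq J (\<lambda>k l. dd a a k l + dd (\<i> *s a) (\<i> *s a) k l) v v)"
    \<comment> \<open>The assumption on the curvature, contracted with \<open>a\<close> and \<open>v\<close>.\<close>
    have curvature: "4 * Re (sesq J ?gy X X) \<le> LL"
    proof -
      \<comment> \<open>In the Levi form \<open>m\<close> carries a factor \<open>\<i> / 4\<close>; being Hermitian, it contributes an imaginary number.\<close>
      define m where "m = (\<lambda>k l. dd (\<i> *s a) a k l - dd a (\<i> *s a) k l)"
      have "Im (sesq J m v v) = 0"
      proof (rule sesq_real)
        fix k l assume kl: "k \<in> J" "l \<in> J"
        show "m l k = cnj (m k l)"
          unfolding m_def dd_def herm2[OF kl iaJ aJ] herm2[OF kl aJ iaJ] by simp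
      qed
      moreover have "sesq J (\<lambda>k l. \<Sum>i\<in>J. \<Sum>j\<in>J. d_dz i (d_dzbar j (g k l)) y * (a $ i) * cnj (a $ j)) v v
        = sesq J (\<lambda>k l. (1/4) * (dd a a k l + dd (\<i> *s a) (\<i> *s a) k l) + (\<i> / 4) * m k l) v v"
        unfolding sesq_def
        by (intro sum.cong refl) (simp add: Levi_contraction[OF S g yS aJ] dd_def m_def add_divide_distrib)
      ultimately have Levi: "Re (sesq J (\<lambda>k l. \<Sum>i\<in>J. \<Sum>j\<in>J. d_dz i (d_dzbar j (g k l)) y * (a $ i) * cnj (a $ j)) v v) = LL / 4"
        unfolding LL_def sesq_add_form[of J "\<lambda>k l. (1/4) * (dd a a k l + dd (\<i> *s a) (\<i> *s a) k l)"] sesq_scale_form by simp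
      have split: "(\<Sum>i\<in>J. \<Sum>j\<in>J. \<Sum>k\<in>J. \<Sum>l\<in>J.
         (- d_dz i (d_dzbar j (g k l)) y + (\<Sum>p\<in>J. \<Sum>q\<in>J.
            inverse_metric J ?gy p q * d_dz i (g k q) y * d_dzbar j (g p l) y)) *
         a $ i * cnj (a $ j) * v $ k * cnj (v $ l))
        = - sesq J (\<lambda>k l. \<Sum>i\<in>J. \<Sum>j\<in>J. d_dz i (d_dzbar j (g k l)) y * (a $ i) * cnj (a $ j)) v v + sesq J ?gy X X"
      proof -
        have A: "(\<Sum>i\<in>J. \<Sum>j\<in>J. \<Sum>k\<in>J. \<Sum>l\<in>J. d_dz i (d_dzbar j (g k l)) y * a $ i * cnj (a $ j) * v $ k * cnj (v $ l))
          = sesq J (\<lambda>k l. \<Sum>i\<in>J. \<Sum>j\<in>J. d_dz i (d_dzbar j (g k l)) y * (a $ i) * cnj (a $ j)) v v"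
        proof -
          have "(\<Sum>i\<in>J. \<Sum>j\<in>J. \<Sum>k\<in>J. \<Sum>l\<in>J. d_dz i (d_dzbar j (g k l)) y * a $ i * cnj (a $ j) * v $ k * cnj (v $ l))
            = (\<Sum>k\<in>J. \<Sum>l\<in>J. \<Sum>i\<in>J. \<Sum>j\<in>J. d_dz i (d_dzbar j (g k l)) y * a $ i * cnj (a $ j) * v $ k * cnj (v $ l))"
            by (rule sum_swap_pairs)
          then show ?thesis by (simp add: sesq_def sum_distrib_right)
        qed
        have B: "(\<Sum>i\<in>J. \<Sum>j\<in>J. \<Sum>k\<in>J. \<Sum>l\<in>J. (\<Sum>p\<in>J. \<Sum>q\<in>J.
            inverse_metric J ?gy p q * d_dz i (g k q) y * d_dzbar j (g p l) y) * a $ i * cnj (a $ j) * v $ k * cnj (v $ l))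
          = sesq J ?gy X X"
        proof -
          have al: "\<alpha> q = (\<Sum>i\<in>J. \<Sum>k\<in>J. a $ i * d_dz i (g k q) y * v $ k)" if "q \<in> J" for q
          proof -
            have "\<alpha> q = (\<Sum>k\<in>J. (\<Sum>i\<in>J. a $ i * d_dz i (g k q) y) * v $ k)"
              unfolding \<alpha>_def by (intro sum.cong refl) (simp add: Phol that)
            also have "\<dots> = (\<Sum>i\<in>J. \<Sum>k\<in>J. a $ i * d_dz i (g k q) y * v $ k)"
              unfolding sum_distrib_right by (rule sum.swap)
            finally show ?thesis .
          qed
          have al': "cnj (\<alpha> p) = (\<Sum>j\<in>J. \<Sum>l\<in>J. cnj (a $ j) * d_dzbar j (g p l) y * cnj (v $ l))" if "p \<in> J" for p
          proof -
            have "cnj (\<alpha> p) = (\<Sum>l\<in>J. Q p l * cnj (v $ l))"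
              unfolding \<alpha>_def cnj_sum by (intro sum.cong refl) (simp add: QP that)
            also have "\<dots> = (\<Sum>l\<in>J. (\<Sum>j\<in>J. cnj (a $ j) * d_dzbar j (g p l) y) * cnj (v $ l))"
              by (intro sum.cong refl) (simp add: Qhol that)
            also have "\<dots> = (\<Sum>j\<in>J. \<Sum>l\<in>J. cnj (a $ j) * d_dzbar j (g p l) y * cnj (v $ l))"
              unfolding sum_distrib_right by (rule sum.swap)
            finally show ?thesis .
          qed
          let ?t = "\<lambda>i j k l p q. inverse_metric J ?gy p q * d_dz i (g k q) y * d_dzbar j (g p l) y * a $ i * cnj (a $ j) * v $ k * cnj (v $ l)"
          have "sesq J ?gy X X = (\<Sum>p\<in>J. \<Sum>q\<in>J. inverse_metric J ?gy p q * \<alpha> q * cnj (\<alpha> p))" by (rule XX[symmetric])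
          also have "\<dots> = (\<Sum>p\<in>J. \<Sum>q\<in>J. inverse_metric J ?gy p q * (\<Sum>i\<in>J. \<Sum>k\<in>J. a $ i * d_dz i (g k q) y * v $ k)
              * (\<Sum>j\<in>J. \<Sum>l\<in>J. cnj (a $ j) * d_dzbar j (g p l) y * cnj (v $ l)))"
          proof (intro sum.cong refl)
            fix p q assume p: "p \<in> J" and q: "q \<in> J"
            show "inverse_metric J ?gy p q * \<alpha> q * cnj (\<alpha> p) =
              inverse_metric J ?gy p q * (\<Sum>i\<in>J. \<Sum>k\<in>J. a $ i * d_dz i (g k q) y * v $ k)
              * (\<Sum>j\<in>J. \<Sum>l\<in>J. cnj (a $ j) * d_dzbar j (g p l) y * cnj (v $ l))"
              unfolding al[OF q] al'[OF p] ..
          qed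
          also have "\<dots> = (\<Sum>p\<in>J. \<Sum>q\<in>J. \<Sum>i\<in>J. \<Sum>k\<in>J. \<Sum>j\<in>J. \<Sum>l\<in>J. ?t i j k l p q)"
            unfolding sum_product_pairs by (intro sum.cong refl) (simp add: mult_ac)
          also have "\<dots> = (\<Sum>i\<in>J. \<Sum>k\<in>J. \<Sum>p\<in>J. \<Sum>q\<in>J. \<Sum>j\<in>J. \<Sum>l\<in>J. ?t i j k l p q)"
            by (rule sum_swap_pairs)
          also have "\<dots> = (\<Sum>i\<in>J. \<Sum>k\<in>J. \<Sum>j\<in>J. \<Sum>l\<in>J. \<Sum>p\<in>J. \<Sum>q\<in>J. ?t i j k l p q)"
            by (intro sum.cong refl sum_swap_pairs)
          also have "\<dots> = (\<Sum>i\<in>J. \<Sum>j\<in>J. \<Sum>k\<in>J. \<Sum>l\<in>J. \<Sum>p\<in>J. \<Sum>q\<in>J. ?t i j k l p q)"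
            by (rule sum.cong[OF refl]) (rule sum.swap)
          also have "\<dots> = (\<Sum>i\<in>J. \<Sum>j\<in>J. \<Sum>k\<in>J. \<Sum>l\<in>J. (\<Sum>p\<in>J. \<Sum>q\<in>J.
              inverse_metric J ?gy p q * d_dz i (g k q) y * d_dzbar j (g p l) y) * a $ i * cnj (a $ j) * v $ k * cnj (v $ l))"
            by (simp add: sum_distrib_right)
          finally show ?thesis by simp
        qed
        show ?thesis unfolding A[symmetric] B[symmetric]
          by (simp add: sum.distrib[symmetric] sum_negf[symmetric] algebra_simps)
      qed
      show ?thesis using curv[OF aJ vJ] unfolding y_def[symmetric] split using Levi by simp
    qed
    have X10: "X1 \<theta> k l 0 = d (\<theta> *s a) k l" for \<theta> k l
      by (simp add: X1_def d_def y_def a_def)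
    have lin: "dirderiv (g k l) (- a2) y = - dirderiv (g k l) a2 y" if kl: "k \<in> J" "l \<in> J" for k l
    proof -
      obtain D where "linear D" "\<And>w. w \<in> coord_space J \<Longrightarrow> dirderiv (g k l) w y = D w"
        using differentiable_on_dirderiv[OF S gdiff[OF kl] yS] by metis
      moreover have "- a2 \<in> coord_space J" using a2J by (simp add: coord_space_def)
      ultimately show ?thesis using a2J by (simp add: linear_neg)
    qed
    \<comment> \<open>The accelerations along the two rays cancel, by this and the linearity in the direction.\<close>
    have neg: "\<i> *s (\<i> *s w) = - w" for w :: "complex^'n" by (simp add: vec_eq_iff)
    have "(\<Sum>k\<in>J. \<Sum>l\<in>J. P2 1 k l) + (\<Sum>k\<in>J. \<Sum>l\<in>J. P2 \<i> k l) =
      (\<Sum>k\<in>J. \<Sum>l\<in>J. (dd a a k l + dd (\<i> *s a) (\<i> *s a) k l) * v $ k * cnj (v $ l)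
         + (4 * Q k l) * b $ k * cnj (v $ l) + (4 * P k l) * v $ k * cnj (b $ l) + (4 * g k l y) * b $ k * cnj (b $ l))"
      unfolding sum.distrib[symmetric]
      by (intro sum.cong refl)
         (simp add: P2_def X2_def X10 dd_def lin P_def Q_def neg algebra_simps add_divide_distrib diff_divide_distrib)
    also have "\<dots> = sesq J (\<lambda>k l. dd a a k l + dd (\<i> *s a) (\<i> *s a) k l) v v + 4 * sesq J Q b v + 4 * sesq J P v b + 4 * sesq J ?gy b b"
      by (simp add: sesq_def sum.distrib sum_distrib_left mult.assoc)
    finally have total: "(\<Sum>k\<in>J. \<Sum>l\<in>J. P2 1 k l) + (\<Sum>k\<in>J. \<Sum>l\<in>J. P2 \<i> k l) =
      sesq J (\<lambda>k l. dd a a k l + dd (\<i> *s a) (\<i> *s a) k l) v v + 4 * sesq J Q b v + 4 * sesq J P v b + 4 * sesq J ?gy b b" .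
    have "G2 1 + G2 \<i> = LL + 4 * Re (sesq J Q b v + sesq J P v b + sesq J ?gy b b)"
      unfolding G2_def LL_def plus_complex.sel(1)[symmetric] total by simp
    also have "\<dots> \<ge> 4 * Re (sesq J ?gy X X + sesq J Q b v + sesq J P v b + sesq J ?gy b b)"
      using curvature by simp
    also have "sesq J ?gy X X + sesq J Q b v + sesq J P v b + sesq J ?gy b b = sesq J ?gy (X + b) (X + b)"
      unfolding Qbv PX pos_hermitian_cnj[OF pos0] sesq_add_left sesq_add_right by simp
    finally have lap: "4 * Re (sesq J ?gy (X + b) (X + b)) \<le> G2 1 + G2 \<i>" .
    have im: "Im (sesq J (d w) v v) = 0" if "w \<in> coord_space J" for w
      by (rule sesq_real) (rule dherm[OF _ _ that])
    have G1: "G1 \<theta> 0 = Re (sesq J (d (\<theta> *s a)) v v) + 2 * Re (\<theta> * sesq J ?gy b v)" for \<theta>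
    proof -
      have "(\<Sum>k\<in>J. \<Sum>l\<in>J. P1 \<theta> k l 0) = sesq J (d (\<theta> *s a)) v v + sesq J ?gy (\<theta> *s b) v + sesq J ?gy v (\<theta> *s b)"
        by (simp add: P1_def X10 sesq_def sum.distrib y_def v_def b_def mult.assoc)
      moreover have "sesq J ?gy v (\<theta> *s b) = cnj (sesq J ?gy (\<theta> *s b) v)" using pos_hermitian_cnj[OF pos0] by simp
      ultimately show ?thesis unfolding G1_def by (simp add: sesq_scale_left)
    qed
    have "sesq J P v v = (1/2) * (sesq J (d a) v v) + (- \<i>/2) * sesq J (d (\<i> *s a)) v v"
      unfolding sesq_scale_form[symmetric] sesq_add_form[symmetric] P_def by (simp add: diff_divide_distrib)
    then have "Re (sesq J (d a) v v) = 2 * Re (sesq J ?gy X v)" "Re (sesq J (d (\<i> *s a)) v v) = - 2 * Im (sesq J ?gy X v)"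
      using im[OF aJ] im[OF iaJ] unfolding PX by simp_all
    then have "G1 1 0 = 2 * Re (sesq J ?gy (X + b) v)" "G1 \<i> 0 = - 2 * Im (sesq J ?gy (X + b) v)"
      unfolding G1 sesq_add_left by simp_all
    then have "(G1 1 0)\<^sup>2 + (G1 \<i> 0)\<^sup>2 = 4 * (cmod (sesq J ?gy (X + b) v))\<^sup>2"
      by (simp add: cmod_power2 power_mult_distrib)
    also have "\<dots> \<le> 4 * (Re (sesq J ?gy (X + b) (X + b)) * Re (sesq J ?gy v v))"
      using pos_hermitian_Cauchy_Schwarz[OF pos0 coord_space_add[OF X(1) bJ] vJ] by simp
    also have "\<dots> = Re (sesq J ?gy v v) * (4 * Re (sesq J ?gy (X + b) (X + b)))" by simp
    also have "\<dots> \<le> Re (sesq J ?gy v v) * (G2 1 + G2 \<i>)"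
      by (rule mult_left_mono[OF lap pos_hermitian_nonneg[OF pos0 vJ]])
    finally show "(G1 1 0)\<^sup>2 + (G1 \<i> 0)\<^sup>2 \<le> Re (G 0) * (G2 1 + G2 \<i>)"
      by (simp add: G_def y_def v_def)
  qed
qed


section \<open>Charts, tangent vectors and differentials\<close>

lemma complex_manifoldD:
  assumes "complex_manifold n A" "c \<in> A"
  shows "inj_on (chart_map c) (chart_dom c)"
    and "openin_coord (chart_idx c) (chart_map c ` chart_dom c)"
    and "d \<in> A \<Longrightarrow> openin_coord (chart_idx c) (chart_map c ` (chart_dom c \<inter> chart_dom d))"
    and "d \<in> A \<Longrightarrow> cholomorphic (chart_map c ` (chart_dom c \<inter> chart_dom d)) (transition c d)"
  using assms unfolding complex_manifold_def by blast+

lemma chart_inv_chart_map: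
  assumes "complex_manifold n A" "c \<in> A" "p \<in> chart_dom c"
  shows "chart_inv c (chart_map c p) = p"
  unfolding chart_inv_def by (rule inv_into_f_f[OF complex_manifoldD(1)[OF assms(1,2)] assms(3)])

lemma chart_map_chart_inv:
  assumes "z \<in> chart_map c ` chart_dom c"
  shows "chart_map c (chart_inv c z) = z" "chart_inv c z \<in> chart_dom c"
  unfolding chart_inv_def using assms by (auto intro: f_inv_into_f inv_into_into)

lemma chart_map_in_coord_space:
  assumes "complex_manifold n A" "c \<in> A" "p \<in> chart_dom c"
  shows "chart_map c p \<in> coord_space (chart_idx c)"
  using openin_coord_subset[OF complex_manifoldD(2)[OF assms(1,2)]] assms(3) by auto

lemma transition_chart_map:
  assumes "complex_manifold n A" "c \<in> A" "p \<in> chart_dom c"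
  shows "transition c d (chart_map c p) = chart_map d p"
  unfolding transition_def by (simp add: chart_inv_chart_map[OF assms])

lemma openin_coord_preimage:
  assumes "openin_coord I S" "continuous_on S F" "openin_coord J S'" "\<And>y. y \<in> S \<Longrightarrow> F y \<in> coord_space J"
  shows "openin_coord I {y \<in> S. F y \<in> S'}"
proof -
  obtain U where U: "open U" "S' = coord_space J \<inter> U" using assms(3) by (auto simp: openin_open)
  have "openin (top_of_set S) (S \<inter> F -` U)"
    by (rule continuous_openin_preimage_gen[OF assms(2) U(1)])
  then have "openin_coord I (S \<inter> F -` U)" using assms(1) openin_trans by blast
  moreover have "S \<inter> F -` U = {y \<in> S. F y \<in> S'}" using assms(4) U by auto
  ultimately show ?thesis by simp
qed

text \<open>
  Directional derivatives are local, so the factorization of \<open>K\<close> is needed only where both factors are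
  defined. This covers all changes of charts, whose domains match only on overlaps.
\<close>

lemma dirderiv_compose_local:
  assumes S: "openin_coord I S" and F: "cholomorphic S F" and FJ: "\<And>y. y \<in> S \<Longrightarrow> F y \<in> coord_space J"
    and S': "openin_coord J S'" and G: "cholomorphic S' G"
    and x: "x \<in> S" "F x \<in> S'" and v: "v \<in> coord_space I"
    and K: "\<And>y. y \<in> S \<Longrightarrow> F y \<in> S' \<Longrightarrow> K y = G (F y)"
  shows "dirderiv K v x = dirderiv G (dirderiv F v x) (F x)"
proof -
  define S'' where "S'' = {y \<in> S. F y \<in> S'}"
  have S'': "openin_coord I S''"
    unfolding S''_def by (rule openin_coord_preimage[OF S cholomorphic_continuous_on[OF F] S' FJ])
  have x'': "x \<in> S''" using x by (simp add: S''_def)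
  have F'': "cholomorphic S'' F" by (rule cholomorphic_subset[OF F]) (auto simp: S''_def)
  have "dirderiv K v x = dirderiv (\<lambda>y. G (F y)) v x"
    by (rule dirderiv_cong[OF S'' x'' v]) (auto simp: S''_def K)
  also have "\<dots> = dirderiv G (dirderiv F v x) (F x)"
    by (rule dirderiv_compose[OF S'' F'' x'' v S' G]) (simp add: S''_def)
  finally show ?thesis .
qed

lemma dirderiv_id: "dirderiv (\<lambda>z. z) a x = a"
  unfolding dirderiv_def
  by (rule vector_derivative_at) (auto intro!: derivative_eq_intros)

lemma dirderiv_transition_self:
  assumes A: "complex_manifold n A" and c: "c \<in> A" "p \<in> chart_dom c" and a: "a \<in> coord_space (chart_idx c)"
  shows "dirderiv (transition c c) a (chart_map c p) = a"
proof -
  have "dirderiv (transition c c) a (chart_map c p) = dirderiv (\<lambda>z. z) a (chart_map c p)"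
    by (rule dirderiv_cong[OF complex_manifoldD(2)[OF A c(1)] _ a])
       (use c in \<open>auto simp: transition_chart_map[OF A]\<close>)
  then show ?thesis by (simp add: dirderiv_id)
qed

lemma dirderiv_transition_in_coord_space:
  assumes A: "complex_manifold n A" and c: "c \<in> A" "p \<in> chart_dom c" and d: "d \<in> A" "p \<in> chart_dom d"
    and a: "a \<in> coord_space (chart_idx c)"
  shows "dirderiv (transition c d) a (chart_map c p) \<in> coord_space (chart_idx d)"
  by (rule dirderiv_in_coord_space[OF complex_manifoldD(3,4)[OF A c(1) d(1)] _ a])
     (use c d in \<open>auto simp: transition_chart_map[OF A] chart_map_in_coord_space[OF A]\<close>)

lemma dirderiv_transition_compose:
  assumes A: "complex_manifold n A" and c: "c \<in> A" "p \<in> chart_dom c" and d: "d \<in> A" "p \<in> chart_dom d"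
    and e: "e \<in> A" "p \<in> chart_dom e" and a: "a \<in> coord_space (chart_idx c)"
  shows "dirderiv (transition c e) a (chart_map c p) =
    dirderiv (transition d e) (dirderiv (transition c d) a (chart_map c p)) (chart_map d p)"
proof -
  have "dirderiv (transition c e) a (chart_map c p) =
    dirderiv (transition d e) (dirderiv (transition c d) a (chart_map c p)) (transition c d (chart_map c p))"
  proof (rule dirderiv_compose_local[OF complex_manifoldD(3,4)[OF A c(1) d(1)] _ complex_manifoldD(3,4)[OF A d(1) e(1)]])
    show "transition c d y \<in> coord_space (chart_idx d)" if "y \<in> chart_map c ` (chart_dom c \<inter> chart_dom d)" for y
      using that c d by (auto simp: transition_chart_map[OF A] chart_map_in_coord_space[OF A])
    show "chart_map c p \<in> chart_map c ` (chart_dom c \<inter> chart_dom d)"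
      "transition c d (chart_map c p) \<in> chart_map d ` (chart_dom d \<inter> chart_dom e)"
      using c d e by (auto simp: transition_chart_map[OF A])
    show "a \<in> coord_space (chart_idx c)" by (rule a)
    fix y assume "y \<in> chart_map c ` (chart_dom c \<inter> chart_dom d)"
    then obtain q where "y = chart_map c q" "q \<in> chart_dom c" "q \<in> chart_dom d" by auto
    then show "transition c e y = transition d e (transition c d y)"
      using c d by (simp add: transition_chart_map[OF A])
  qed
  then show ?thesis by (simp add: transition_chart_map[OF A c])
qed

lemma tangent_vec_at:
  assumes "complex_manifold n A" "c \<in> A" "p \<in> chart_dom c" "a \<in> coord_space (chart_idx c)"
  shows "tangent_vec A c p a c = a"
  using assms(2,3) by (simp add: tangent_vec_def dirderiv_transition_self[OF assms])

lemma tangent_vec_in_tangent_space: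
  assumes A: "complex_manifold n A" and c: "c \<in> A" "p \<in> chart_dom c" and a: "a \<in> coord_space (chart_idx c)"
  shows "tangent_vec A c p a \<in> tangent_space A p"
  unfolding tangent_space_def mem_Collect_eq
proof (intro conjI allI ballI impI)
  show "tangent_vec A c p a d = 0" if "d \<notin> A \<or> p \<notin> chart_dom d" for d
    using that by (auto simp: tangent_vec_def)
  show "tangent_vec A c p a d \<in> coord_space (chart_idx d)" if "d \<in> A" "p \<in> chart_dom d" for d
    using dirderiv_transition_in_coord_space[OF A c that a] that by (simp add: tangent_vec_def)
  show "tangent_vec A c p a e = dirderiv (transition d e) (tangent_vec A c p a d) (chart_map d p)"
    if "d \<in> A" "e \<in> A" "p \<in> chart_dom d \<inter> chart_dom e" for d e
  proof -
    have *: "tangent_vec A c p a d = dirderiv (transition c d) a (chart_map c p)"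
      "tangent_vec A c p a e = dirderiv (transition c e) a (chart_map c p)"
      using that by (auto simp: tangent_vec_def)
    show ?thesis unfolding * by (rule dirderiv_transition_compose[OF A c _ _ _ _ a]) (use that in auto)
  qed
qed

lemma tangent_space_component:
  assumes "W \<in> tangent_space A p" "c \<in> A" "p \<in> chart_dom c"
  shows "W c \<in> coord_space (chart_idx c)"
  using assms unfolding tangent_space_def by blast

lemma tangent_space_transform:
  assumes "W \<in> tangent_space A p" "c \<in> A" "p \<in> chart_dom c" "d \<in> A" "p \<in> chart_dom d"
  shows "W d = dirderiv (transition c d) (W c) (chart_map c p)"
  using assms unfolding tangent_space_def by blast

text \<open>
  A tangent vector is determined by its components in any one chart.
\<close>

lemma tangent_vec_component:
  assumes W: "W \<in> tangent_space A p" and c: "c \<in> A" "p \<in> chart_dom c"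
  shows "tangent_vec A c p (W c) = W"
proof
  fix d
  show "tangent_vec A c p (W c) d = W d"
  proof (cases "d \<in> A \<and> p \<in> chart_dom d")
    case True
    then show ?thesis using tangent_space_transform[OF W c, of d] by (simp add: tangent_vec_def)
  next
    case False
    then have "W d = 0" using W unfolding tangent_space_def by blast
    then show ?thesis using False by (auto simp: tangent_vec_def)
  qed
qed

lemma tangent_vec_change_chart:
  assumes A: "complex_manifold n A" and c: "c \<in> A" "p \<in> chart_dom c" and d: "d \<in> A" "p \<in> chart_dom d"
    and a: "a \<in> coord_space (chart_idx c)"
  shows "tangent_vec A d p (dirderiv (transition c d) a (chart_map c p)) = tangent_vec A c p a"
proof
  fix e
  show "tangent_vec A d p (dirderiv (transition c d) a (chart_map c p)) e = tangent_vec A c p a e"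
  proof (cases "e \<in> A \<and> p \<in> chart_dom e")
    case True
    then show ?thesis using dirderiv_transition_compose[OF A c d _ _ a, of e] by (simp add: tangent_vec_def)
  qed (auto simp: tangent_vec_def)
qed

lemma tangent_vec_scale:
  assumes A: "complex_manifold n A" and c: "c \<in> A" "p \<in> chart_dom c" and v: "v \<in> coord_space (chart_idx c)"
  shows "tangent_vec A c p (a *s v) = tscale a (tangent_vec A c p v)"
proof
  fix d
  show "tangent_vec A c p (a *s v) d = tscale a (tangent_vec A c p v) d"
  proof (cases "d \<in> A \<and> p \<in> chart_dom d")
    case True
    then have d: "d \<in> A" and x: "chart_map c p \<in> chart_map c ` (chart_dom c \<inter> chart_dom d)" using c by auto
    show ?thesis
      using True dirderiv_scale[OF complex_manifoldD(3,4)[OF A c(1) d] x v] by (simp add: tangent_vec_def tscale_def)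
  qed (auto simp: tangent_vec_def tscale_def)
qed

lemma tangent_vec_add:
  assumes A: "complex_manifold n A" and c: "c \<in> A" "p \<in> chart_dom c"
    and v: "v \<in> coord_space (chart_idx c)" and w: "w \<in> coord_space (chart_idx c)"
  shows "tangent_vec A c p (v + w) = tangent_vec A c p v + tangent_vec A c p w"
proof
  fix d
  show "tangent_vec A c p (v + w) d = (tangent_vec A c p v + tangent_vec A c p w) d"
  proof (cases "d \<in> A \<and> p \<in> chart_dom d")
    case True
    then have d: "d \<in> A" and x: "chart_map c p \<in> chart_map c ` (chart_dom c \<inter> chart_dom d)" using c by auto
    show ?thesis
      using True dirderiv_add[OF complex_manifoldD(3,4)[OF A c(1) d] x v w] by (simp add: tangent_vec_def)
  qed (auto simp: tangent_vec_def)
qed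

lemma tangent_vec_zero [simp]: "tangent_vec A c p 0 = 0"
  by (auto simp: tangent_vec_def fun_eq_iff)

lemma hermitian_innerD:
  assumes "hermitian_inner sc V h" "u \<in> V"
  shows "v \<in> V \<Longrightarrow> w \<in> V \<Longrightarrow> h (u + v) w = h u w + h v w"
    and "v \<in> V \<Longrightarrow> h (sc a u) v = a * h u v"
    and "v \<in> V \<Longrightarrow> h v u = cnj (h u v)"
    and "u \<noteq> 0 \<Longrightarrow> 0 < Re (h u u)"
proof -
  note H = assms(1)[unfolded hermitian_inner_def]
  note H' = conjunct2[OF H] and H'' = conjunct2[OF conjunct2[OF H]]
  show "v \<in> V \<Longrightarrow> w \<in> V \<Longrightarrow> h (u + v) w = h u w + h v w"
    by (rule bspec[OF bspec[OF bspec[OF conjunct1[OF H] assms(2)]]])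
  show "v \<in> V \<Longrightarrow> h (sc a u) v = a * h u v"
    by (rule bspec[OF bspec[OF spec[OF conjunct1[OF H']] assms(2)]])
  show "v \<in> V \<Longrightarrow> h v u = cnj (h u v)"
    by (rule bspec[OF bspec[OF conjunct1[OF H''] assms(2)]])
  show "u \<noteq> 0 \<Longrightarrow> 0 < Re (h u u)"
    by (rule mp[OF bspec[OF conjunct2[OF H''] assms(2)]])
qed

lemma hermitian_metricD:
  assumes "hermitian_metric A g" "c \<in> A"
  shows "p \<in> chart_dom c \<Longrightarrow> hermitian_inner tscale (tangent_space A p) (g p)"
    and "k \<in> chart_idx c \<Longrightarrow> l \<in> chart_idx c \<Longrightarrow>
      smooth_fun_on (chart_idx c) (chart_map c ` chart_dom c) (metric_comp A g c k l)"
  using assms unfolding hermitian_metric_def carrier_of_def by blast+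

lemma hermitian_metric_sum_left:
  assumes A: "complex_manifold n A" and g: "hermitian_metric A g" and c: "c \<in> A" "p \<in> chart_dom c"
    and W: "W \<in> tangent_space A p" and K: "finite K" "K \<subseteq> chart_idx c"
  shows "g p (tangent_vec A c p (\<Sum>k\<in>K. a k *s axis k 1)) W = (\<Sum>k\<in>K. a k * g p (tangent_vec A c p (axis k 1)) W)"
  using K
proof (induction K rule: finite_induct)
  note H = hermitian_metricD(1)[OF g c]
  case empty
  have "tangent_vec A c p 0 \<in> tangent_space A p" by (rule tangent_vec_in_tangent_space[OF A c]) simp
  then have "(0 :: ('a, 'b) tangent) \<in> tangent_space A p" by simp
  then have "g p (0 + 0) W = g p 0 W + g p 0 W" using W by (intro hermitian_innerD(1)[OF H])
  then have "g p 0 W = 0" by simp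
  then show ?case by (simp only: sum.empty tangent_vec_zero)
next
  case (insert k K)
  note H = hermitian_metricD(1)[OF g c]
  have k: "axis k 1 \<in> coord_space (chart_idx c)" using insert by (simp add: coord_space_axis)
  have rest: "(\<Sum>k\<in>K. a k *s axis k 1) \<in> coord_space (chart_idx c)"
    using insert by (intro coord_space_sum coord_space_scale coord_space_axis) auto
  note T = tangent_vec_in_tangent_space[OF A c]
  have "g p (tangent_vec A c p (a k *s axis k 1 + (\<Sum>k\<in>K. a k *s axis k 1))) W
      = g p (tscale (a k) (tangent_vec A c p (axis k 1)) + tangent_vec A c p (\<Sum>k\<in>K. a k *s axis k 1)) W"
    by (simp add: tangent_vec_add[OF A c coord_space_scale[OF k] rest] tangent_vec_scale[OF A c k])
  also have "\<dots> = g p (tscale (a k) (tangent_vec A c p (axis k 1))) W + g p (tangent_vec A c p (\<Sum>k\<in>K. a k *s axis k 1)) W"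
    using T[OF rest] T[OF coord_space_scale[OF k, of "a k"]] W
    unfolding tangent_vec_scale[OF A c k] by (intro hermitian_innerD(1)[OF H])
  also have "g p (tscale (a k) (tangent_vec A c p (axis k 1))) W = a k * g p (tangent_vec A c p (axis k 1)) W"
    by (rule hermitian_innerD(2)[OF H T[OF k] W])
  finally show ?case using insert by simp
qed

text \<open>
  On each tangent space the metric is determined by its values on the coordinate vectors, which are
  its components. This reduces everything to matrices of functions on coordinate spaces.
\<close>

lemma hermitian_metric_sesq:
  assumes A: "complex_manifold n A" and g: "hermitian_metric A g" and c: "c \<in> A" "p \<in> chart_dom c"
    and v: "v \<in> coord_space (chart_idx c)" and w: "w \<in> coord_space (chart_idx c)"
  shows "g p (tangent_vec A c p v) (tangent_vec A c p w) =
    sesq (chart_idx c) (\<lambda>k l. metric_comp A g c k l (chart_map c p)) v w"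
proof -
  let ?J = "chart_idx c" and ?e = "\<lambda>k. tangent_vec A c p (axis k 1)"
  note H = hermitian_metricD(1)[OF g c]
  note T = tangent_vec_in_tangent_space[OF A c]
  have sym: "g p U V = cnj (g p V U)" if "U \<in> tangent_space A p" "V \<in> tangent_space A p" for U V
    by (rule hermitian_innerD(3)[OF H that(2,1)])
  have e: "?e k \<in> tangent_space A p" if "k \<in> ?J" for k using T[OF coord_space_axis[OF that]] .
  have left: "g p (tangent_vec A c p u) W = (\<Sum>k\<in>?J. u $ k * g p (?e k) W)"
    if "u \<in> coord_space ?J" "W \<in> tangent_space A p" for u W
    using hermitian_metric_sum_left[OF A g c that(2), of ?J "\<lambda>k. u $ k"] coord_space_expand_complex[OF that(1)] by simp
  have right: "g p W (tangent_vec A c p u) = (\<Sum>l\<in>?J. cnj (u $ l) * g p W (?e l))"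
    if "u \<in> coord_space ?J" "W \<in> tangent_space A p" for u W
  proof -
    have "g p W (tangent_vec A c p u) = (\<Sum>l\<in>?J. cnj (u $ l) * cnj (g p (?e l) W))"
      using sym[OF that(2) T[OF that(1)]] left[OF that] by simp
    also have "\<dots> = (\<Sum>l\<in>?J. cnj (u $ l) * g p W (?e l))"
    proof (intro sum.cong refl)
      fix l assume l: "l \<in> ?J"
      show "cnj (u $ l) * cnj (g p (?e l) W) = cnj (u $ l) * g p W (?e l)"
        using sym[OF that(2) e[OF l]] by simp
    qed
    finally show ?thesis .
  qed
  have "g p (tangent_vec A c p v) (tangent_vec A c p w) = (\<Sum>k\<in>?J. v $ k * (\<Sum>l\<in>?J. cnj (w $ l) * g p (?e k) (?e l)))"
    unfolding left[OF v T[OF w]] by (intro sum.cong refl) (simp add: right[OF w e])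
  also have "\<dots> = sesq ?J (\<lambda>k l. metric_comp A g c k l (chart_map c p)) v w"
    unfolding sesq_def sum_distrib_left
    by (intro sum.cong refl) (simp add: metric_comp_def chart_inv_chart_map[OF A c] mult_ac)
  finally show ?thesis .
qed

lemma hermitian_metric_pos_hermitian:
  assumes A: "complex_manifold n A" and g: "hermitian_metric A g" and c: "c \<in> A" "z \<in> chart_map c ` chart_dom c"
  shows "pos_hermitian (chart_idx c) (\<lambda>k l. metric_comp A g c k l z)"
proof -
  obtain p where p: "p \<in> chart_dom c" "z = chart_map c p" using c(2) by auto
  note H = hermitian_metricD(1)[OF g c(1) p(1)]
  note T = tangent_vec_in_tangent_space[OF A c(1) p(1)]
  show ?thesis
    unfolding pos_hermitian_def
  proof (intro conjI ballI impI)
    fix k l assume "k \<in> chart_idx c" "l \<in> chart_idx c"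
    then have "tangent_vec A c p (axis k 1) \<in> tangent_space A p" "tangent_vec A c p (axis l 1) \<in> tangent_space A p"
      by (intro T coord_space_axis; simp)+
    then have "g p (tangent_vec A c p (axis l 1)) (tangent_vec A c p (axis k 1)) =
        cnj (g p (tangent_vec A c p (axis k 1)) (tangent_vec A c p (axis l 1)))"
      by (rule hermitian_innerD(3)[OF H])
    then show "metric_comp A g c l k z = cnj (metric_comp A g c k l z)"
      by (simp add: metric_comp_def p chart_inv_chart_map[OF A c(1) p(1)])
  next
    fix v :: "complex^'b" assume v: "v \<in> coord_space (chart_idx c)" "v \<noteq> 0"
    have "tangent_vec A c p v c = v" by (rule tangent_vec_at[OF A c(1) p(1) v(1)])
    then have "tangent_vec A c p v \<noteq> 0" using v(2) by fastforce
    then have "0 < Re (g p (tangent_vec A c p v) (tangent_vec A c p v))"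
      by (rule hermitian_innerD(4)[OF H T[OF v(1)]])
    then show "0 < Re (sesq (chart_idx c) (\<lambda>k l. metric_comp A g c k l z) v v)"
      by (simp add: hermitian_metric_sesq[OF A g c(1) p(1) v(1) v(1)] p)
  qed
qed

definition local_rep :: "('a \<Rightarrow> 'b) \<Rightarrow> ('a, 'd::finite) chart \<Rightarrow> ('b, 'e::finite) chart \<Rightarrow> complex^'d \<Rightarrow> complex^'e"
  where "local_rep f c d = chart_map d \<circ> f \<circ> chart_inv c"

definition local_dom :: "('a \<Rightarrow> 'b) \<Rightarrow> ('a, 'd::finite) chart \<Rightarrow> ('b, 'e::finite) chart \<Rightarrow> (complex^'d) set"
  where "local_dom f c d = chart_map c ` {p \<in> chart_dom c. f p \<in> chart_dom d}"

lemma openin_atlas_basic: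
  assumes "c \<in> A" "open W"
  shows "openin (atlas_topology A) {p \<in> chart_dom c. chart_map c p \<in> W}"
  unfolding atlas_topology_def by (rule topology_generated_by_Basis) (use assms in blast)

lemma openin_chart_dom: "c \<in> A \<Longrightarrow> openin (atlas_topology A) (chart_dom c)"
  using openin_atlas_basic[of c A UNIV] by simp

text \<open>
  Charts are open maps. For a basic open set of another chart this holds because the transition map is
  continuous; the property is preserved by finite intersections (the chart is injective) and by unions.
\<close>

lemma openin_coord_chart_image:
  assumes A: "complex_manifold n A" and c: "c \<in> A" and U: "openin (atlas_topology A) U"
  shows "openin_coord (chart_idx c) (chart_map c ` (U \<inter> chart_dom c))"
proof -
  have "generate_topology_on {{p \<in> chart_dom c. chart_map c p \<in> W} | c W. c \<in> A \<and> open W} U"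
    using U by (simp add: atlas_topology_def openin_topology_generated_by_iff)
  then show ?thesis
  proof (induction rule: generate_topology_on.induct)
    case Empty
    then show ?case by simp
  next
    case (Int a b)
    have "chart_map c ` (a \<inter> b \<inter> chart_dom c) = chart_map c ` (a \<inter> chart_dom c) \<inter> chart_map c ` (b \<inter> chart_dom c)"
      using complex_manifoldD(1)[OF A c] by (auto simp: inj_on_def)
    then show ?case using Int.IH by (simp add: openin_Int)
  next
    case (UN K)
    have "chart_map c ` (\<Union>K \<inter> chart_dom c) = (\<Union>k\<in>K. chart_map c ` (k \<inter> chart_dom c))" by auto
    then show ?case using UN.IH by (auto intro!: openin_Union)
  next
    case (Basis s)
    then obtain d W where d: "d \<in> A" "open W" "s = {p \<in> chart_dom d. chart_map d p \<in> W}" by auto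
    let ?S = "chart_map c ` (chart_dom c \<inter> chart_dom d)"
    have "openin (top_of_set ?S) (?S \<inter> transition c d -` W)"
      by (rule continuous_openin_preimage_gen[OF cholomorphic_continuous_on[OF complex_manifoldD(4)[OF A c d(1)]] d(2)])
    then have "openin_coord (chart_idx c) (?S \<inter> transition c d -` W)"
      using complex_manifoldD(3)[OF A c d(1)] openin_trans by blast
    moreover have "?S \<inter> transition c d -` W = chart_map c ` (s \<inter> chart_dom c)"
      using d by (auto simp: transition_chart_map[OF A c] image_iff)
    ultimately show ?case by simp
  qed
qed

context
  fixes M :: "('a, 'm::finite) chart set" and N :: "('b, 'n::finite) chart set" and m n :: nat and f :: "'a \<Rightarrow> 'b"
  assumes M: "complex_manifold m M" and N: "complex_manifold n N" and f: "holomorphic_map M N f"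
begin

lemma local_dom_open:
  assumes "c \<in> M" "d \<in> N"
  shows "openin_coord (chart_idx c) (local_dom f c d)"
proof -
  have "continuous_map (atlas_topology M) (atlas_topology N) f" using f by (simp add: holomorphic_map_def)
  then have "openin (atlas_topology M) {p \<in> topspace (atlas_topology M). f p \<in> chart_dom d}"
    by (rule openin_continuous_map_preimage) (rule openin_chart_dom[OF assms(2)])
  from openin_coord_chart_image[OF M assms(1) this]
  have "openin_coord (chart_idx c) (chart_map c ` ({p \<in> topspace (atlas_topology M). f p \<in> chart_dom d} \<inter> chart_dom c))" .
  moreover have "{p \<in> topspace (atlas_topology M). f p \<in> chart_dom d} \<inter> chart_dom c = {p \<in> chart_dom c. f p \<in> chart_dom d}"
    using assms by (auto simp: topspace_atlas_topology carrier_of_def)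
  ultimately show ?thesis by (simp add: local_dom_def)
qed

lemma local_rep_cholomorphic:
  assumes "c \<in> M" "d \<in> N"
  shows "cholomorphic (local_dom f c d) (local_rep f c d)"
  using f assms by (simp add: holomorphic_map_def local_dom_def local_rep_def)

lemma local_rep_chart_map: "c \<in> M \<Longrightarrow> p \<in> chart_dom c \<Longrightarrow> local_rep f c d (chart_map c p) = chart_map d (f p)"
  by (simp add: local_rep_def chart_inv_chart_map[OF M])

lemma local_rep_image:
  assumes "c \<in> M" "d \<in> N" "z \<in> local_dom f c d"
  shows "local_rep f c d z \<in> chart_map d ` chart_dom d"
  using assms by (auto simp: local_dom_def local_rep_chart_map)

lemma local_rep_in_coord_space:
  assumes "c \<in> M" "d \<in> N" "z \<in> local_dom f c d"
  shows "local_rep f c d z \<in> coord_space (chart_idx d)"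
  using local_rep_image[OF assms] chart_map_in_coord_space[OF N assms(2)] by auto

lemma dirderiv_local_rep_in_coord_space:
  assumes "c \<in> M" "d \<in> N" "z \<in> local_dom f c d" "a \<in> coord_space (chart_idx c)"
  shows "dirderiv (local_rep f c d) a z \<in> coord_space (chart_idx d)"
  by (rule dirderiv_in_coord_space[OF local_dom_open[OF assms(1,2)] local_rep_cholomorphic[OF assms(1,2)] assms(3,4)])
     (rule local_rep_in_coord_space[OF assms(1,2)])

lemma dirderiv_local_rep_change_target:
  assumes c: "c \<in> M" "p \<in> chart_dom c" and d: "d \<in> N" "f p \<in> chart_dom d" and e: "e \<in> N" "f p \<in> chart_dom e"
    and a: "a \<in> coord_space (chart_idx c)"
  shows "dirderiv (local_rep f c e) a (chart_map c p) =
    dirderiv (transition d e) (dirderiv (local_rep f c d) a (chart_map c p)) (chart_map d (f p))"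
proof -
  have "dirderiv (local_rep f c e) a (chart_map c p) =
    dirderiv (transition d e) (dirderiv (local_rep f c d) a (chart_map c p)) (local_rep f c d (chart_map c p))"
  proof (rule dirderiv_compose_local[OF local_dom_open[OF c(1) d(1)] local_rep_cholomorphic[OF c(1) d(1)] _ complex_manifoldD(3,4)[OF N d(1) e(1)]])
    show "local_rep f c d y \<in> coord_space (chart_idx d)" if "y \<in> local_dom f c d" for y
      by (rule local_rep_in_coord_space[OF c(1) d(1) that])
    show "chart_map c p \<in> local_dom f c d" "local_rep f c d (chart_map c p) \<in> chart_map d ` (chart_dom d \<inter> chart_dom e)"
      using c d e by (auto simp: local_dom_def local_rep_chart_map)
    show "a \<in> coord_space (chart_idx c)" by (rule a)
    fix y assume "y \<in> local_dom f c d"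
    then obtain q where "y = chart_map c q" "q \<in> chart_dom c" "f q \<in> chart_dom d" by (auto simp: local_dom_def)
    then show "local_rep f c e y = transition d e (local_rep f c d y)"
      using c d by (simp add: local_rep_chart_map transition_chart_map[OF N])
  qed
  then show ?thesis by (simp add: local_rep_chart_map[OF c])
qed

lemma dirderiv_local_rep_change_source:
  assumes c: "c \<in> M" "p \<in> chart_dom c" and c': "c' \<in> M" "p \<in> chart_dom c'" and d: "d \<in> N" "f p \<in> chart_dom d"
    and a: "a \<in> coord_space (chart_idx c)"
  shows "dirderiv (local_rep f c d) a (chart_map c p) =
    dirderiv (local_rep f c' d) (dirderiv (transition c c') a (chart_map c p)) (chart_map c' p)"
proof -
  have "dirderiv (local_rep f c d) a (chart_map c p) =
    dirderiv (local_rep f c' d) (dirderiv (transition c c') a (chart_map c p)) (transition c c' (chart_map c p))"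
  proof (rule dirderiv_compose_local[OF complex_manifoldD(3,4)[OF M c(1) c'(1)] _ local_dom_open[OF c'(1) d(1)] local_rep_cholomorphic[OF c'(1) d(1)]])
    show "transition c c' y \<in> coord_space (chart_idx c')" if "y \<in> chart_map c ` (chart_dom c \<inter> chart_dom c')" for y
      using that c c' by (auto simp: transition_chart_map[OF M] chart_map_in_coord_space[OF M])
    show "chart_map c p \<in> chart_map c ` (chart_dom c \<inter> chart_dom c')" "transition c c' (chart_map c p) \<in> local_dom f c' d"
      using c c' d by (auto simp: transition_chart_map[OF M] local_dom_def)
    show "a \<in> coord_space (chart_idx c)" by (rule a)
    fix y assume "y \<in> chart_map c ` (chart_dom c \<inter> chart_dom c')"
    then obtain q where "y = chart_map c q" "q \<in> chart_dom c" "q \<in> chart_dom c'" by auto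
    then show "local_rep f c d y = local_rep f c' d (transition c c' y)"
      using c c' by (simp add: local_rep_chart_map transition_chart_map[OF M])
  qed
  then show ?thesis by (simp add: transition_chart_map[OF M c])
qed

text \<open>
  Changing the chart of the source is absorbed by the transformation rule of \<open>W\<close>, changing that of
  the target by the transformation rule of the resulting vector.
\<close>

lemma tangent_vec_dirderiv_local_rep_unique:
  assumes W: "W \<in> tangent_space M p"
    and c: "c \<in> M" "p \<in> chart_dom c" and c': "c' \<in> M" "p \<in> chart_dom c'"
    and d: "d \<in> N" "f p \<in> chart_dom d" and d': "d' \<in> N" "f p \<in> chart_dom d'"
  shows "tangent_vec N d (f p) (dirderiv (local_rep f c d) (W c) (chart_map c p)) =
    tangent_vec N d' (f p) (dirderiv (local_rep f c' d') (W c') (chart_map c' p))"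
proof -
  note a = tangent_space_component[OF W c] and a' = tangent_space_component[OF W c']
  have dom: "chart_map c p \<in> local_dom f c d" using c d by (auto simp: local_dom_def)
  have "dirderiv (local_rep f c' d') (W c') (chart_map c' p) = dirderiv (local_rep f c d') (W c) (chart_map c p)"
    using dirderiv_local_rep_change_source[OF c c' d' a] tangent_space_transform[OF W c c'] by simp
  also have "\<dots> = dirderiv (transition d d') (dirderiv (local_rep f c d) (W c) (chart_map c p)) (chart_map d (f p))"
    by (rule dirderiv_local_rep_change_target[OF c d d' a])
  finally show ?thesis
    using tangent_vec_change_chart[OF N d d' dirderiv_local_rep_in_coord_space[OF c(1) d(1) dom a]] by simp
qed

end

text \<open>
  The charts are arbitrary ones around the point and its image; all of them give the same vector.
\<close>

definition differential ::
    "('a, 'm::finite) chart set \<Rightarrow> ('b, 'n::finite) chart set \<Rightarrow> ('a \<Rightarrow> 'b) \<Rightarrow> 'a \<Rightarrow> ('a, 'm) tangent \<Rightarrow> ('b, 'n) tangent"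
  where "differential M N f p W =
    (let c = SOME c. c \<in> M \<and> p \<in> chart_dom c; d = SOME d. d \<in> N \<and> f p \<in> chart_dom d
     in tangent_vec N d (f p) (dirderiv (local_rep f c d) (W c) (chart_map c p)))"

lemma differential_in_charts:
  assumes "complex_manifold m M" "complex_manifold n N" "holomorphic_map M N f" "W \<in> tangent_space M p"
    and c: "c \<in> M" "p \<in> chart_dom c" and d: "d \<in> N" "f p \<in> chart_dom d"
  shows "differential M N f p W = tangent_vec N d (f p) (dirderiv (local_rep f c d) (W c) (chart_map c p))"
proof -
  have c': "(SOME c. c \<in> M \<and> p \<in> chart_dom c) \<in> M \<and> p \<in> chart_dom (SOME c. c \<in> M \<and> p \<in> chart_dom c)"
    by (rule someI[of "\<lambda>c. c \<in> M \<and> p \<in> chart_dom c" c]) (use c in simp)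
  have d': "(SOME d. d \<in> N \<and> f p \<in> chart_dom d) \<in> N \<and> f p \<in> chart_dom (SOME d. d \<in> N \<and> f p \<in> chart_dom d)"
    by (rule someI[of "\<lambda>d. d \<in> N \<and> f p \<in> chart_dom d" d]) (use d in simp)
  show ?thesis
    unfolding differential_def Let_def
    by (rule tangent_vec_dirderiv_local_rep_unique[OF assms(1-4)]) (use c d c' d' in auto)
qed

lemma differential_scale:
  assumes M: "complex_manifold m M" and N: "complex_manifold n N" and f: "holomorphic_map M N f"
    and W: "W \<in> tangent_space M p" "tscale a W \<in> tangent_space M p" and p: "p \<in> carrier_of M" "f p \<in> carrier_of N"
  shows "differential M N f p (tscale a W) = tscale a (differential M N f p W)"
proof -
  obtain c where c: "c \<in> M" "p \<in> chart_dom c" using p(1) by (auto simp: carrier_of_def)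
  obtain d where d: "d \<in> N" "f p \<in> chart_dom d" using p(2) by (auto simp: carrier_of_def)
  have dom: "chart_map c p \<in> local_dom f c d" using c d by (auto simp: local_dom_def)
  note Wc = tangent_space_component[OF W(1) c]
  show ?thesis
    unfolding differential_in_charts[OF M N f W(1) c d] differential_in_charts[OF M N f W(2) c d]
    unfolding tscale_def[of a W]
    unfolding dirderiv_scale[OF local_dom_open[OF M N f c(1) d(1)] local_rep_cholomorphic[OF M N f c(1) d(1)] dom Wc]
    by (rule tangent_vec_scale[OF N d dirderiv_local_rep_in_coord_space[OF M N f c(1) d(1) dom Wc]])
qed


section \<open>Coordinates on the projectivized tangent bundle\<close>

definition base_part :: "complex^('d::finite + 'd) \<Rightarrow> complex^'d"
  where "base_part z = (\<chi> k. z $ Inl k)"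

definition fibre_part :: "'d::finite \<Rightarrow> complex^('d + 'd) \<Rightarrow> complex^'d"
  where "fibre_part i z = (\<chi> k. if k = i then 0 else z $ Inr k)"

text \<open>
  The homogeneous fibre coordinates normalized by setting the i-th one to 1.
\<close>

definition homogeneous_vec :: "'d::finite \<Rightarrow> complex^('d + 'd) \<Rightarrow> complex^'d"
  where "homogeneous_vec i z = axis i 1 + fibre_part i z"

lemma homogeneous_vec_nth: "homogeneous_vec i z $ k = (if k = i then 1 else z $ Inr k)"
  by (simp add: homogeneous_vec_def fibre_part_def axis_def)

lemma base_part_line: "base_part (z + \<zeta> *s u) = base_part z + \<zeta> *s base_part u"
  by (simp add: base_part_def vec_eq_iff)

lemma homogeneous_vec_line: "homogeneous_vec i (z + \<zeta> *s u) = homogeneous_vec i z + \<zeta> *s fibre_part i u"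
  by (simp add: homogeneous_vec_def fibre_part_def vec_eq_iff)

abbreviation affine_idx :: "'d set \<Rightarrow> 'd \<Rightarrow> ('d + 'd) set"
  where "affine_idx I i \<equiv> Inl ` I \<union> Inr ` (I - {i})"

lemma base_part_in_coord_space:
  "z \<in> coord_space (affine_idx I i) \<Longrightarrow> base_part z \<in> coord_space I"
  by (auto simp: coord_space_def base_part_def)

lemma fibre_part_in_coord_space:
  "z \<in> coord_space (affine_idx I i) \<Longrightarrow> fibre_part i z \<in> coord_space I"
  by (auto simp: coord_space_def fibre_part_def)

lemma homogeneous_vec_in_coord_space:
  "z \<in> coord_space (affine_idx I i) \<Longrightarrow> i \<in> I \<Longrightarrow> homogeneous_vec i z \<in> coord_space I"
  unfolding homogeneous_vec_def by (intro coord_space_add coord_space_axis fibre_part_in_coord_space)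

lemma continuous_on_base_part: "continuous_on S base_part"
  unfolding base_part_def by (intro continuous_intros continuous_on_component)

lemma continuous_on_homogeneous_vec: "continuous_on S (homogeneous_vec i)"
proof -
  have "continuous_on S (\<lambda>z. if k = i then 0 else z $ Inr k)" for k
    by (cases "k = i") (auto intro!: continuous_intros continuous_on_component)
  then have "continuous_on S (\<lambda>z. axis i 1 + fibre_part i z)"
    unfolding fibre_part_def by (intro continuous_intros)
  then show ?thesis unfolding homogeneous_vec_def .
qed

definition affine_image :: "('a, 'd::finite) chart \<Rightarrow> 'd \<Rightarrow> (complex^('d + 'd)) set"
  where "affine_image c i = {z \<in> coord_space (affine_idx (chart_idx c) i). base_part z \<in> chart_map c ` chart_dom c}"

definition affine_vec :: "('a, 'd::finite) chart set \<Rightarrow> ('a, 'd) chart \<Rightarrow> 'd \<Rightarrow> complex^('d + 'd) \<Rightarrow> ('a, 'd) tangent"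
  where "affine_vec A c i z = tangent_vec A c (chart_inv c (base_part z)) (homogeneous_vec i z)"

definition affine_point :: "('a, 'd::finite) chart set \<Rightarrow> ('a, 'd) chart \<Rightarrow> 'd \<Rightarrow> complex^('d + 'd) \<Rightarrow> ('a, 'd) proj_tangent"
  where "affine_point A c i z = (chart_inv c (base_part z), complex_line (affine_vec A c i z))"

lemma tscale_one [simp]: "tscale 1 W = W"
  by (simp add: tscale_def)

lemma complex_line_self: "W \<in> complex_line W"
  unfolding complex_line_def using tscale_one by (metis (mono_tags, lifting) mem_Collect_eq)

lemma tscale_in_tangent_space:
  assumes A: "complex_manifold n A" and p: "p \<in> carrier_of A" and W: "W \<in> tangent_space A p"
  shows "tscale a W \<in> tangent_space A p"
proof -
  obtain c where c: "c \<in> A" "p \<in> chart_dom c" using p by (auto simp: carrier_of_def)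
  note Wc = tangent_space_component[OF W c]
  have "tscale a W = tangent_vec A c p (a *s W c)"
    using tangent_vec_scale[OF A c Wc] tangent_vec_component[OF W c] by simp
  then show ?thesis using tangent_vec_in_tangent_space[OF A c coord_space_scale[OF Wc]] by simp
qed

lemma proj_tangent_pointsD:
  assumes A: "complex_manifold n A" and x: "x \<in> proj_tangent_points A" and W: "W \<in> snd x"
  shows "fst x \<in> carrier_of A" "W \<in> tangent_space A (fst x)"
  using x W tscale_in_tangent_space[OF A] by (auto simp: proj_tangent_points_def complex_line_def)

lemma affine_dom_subset: "x \<in> affine_dom A c i \<Longrightarrow> x \<in> proj_tangent_points A"
  by (auto simp: affine_dom_def)

context
  fixes A :: "('a, 'd::finite) chart set" and n :: nat and c :: "('a, 'd) chart" and i :: 'd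
  assumes A: "complex_manifold n A" and c: "c \<in> A" and i: "i \<in> chart_idx c"
begin

lemma affine_vec_props:
  assumes z: "z \<in> affine_image c i"
  shows "chart_inv c (base_part z) \<in> chart_dom c" "chart_map c (chart_inv c (base_part z)) = base_part z"
    and "affine_vec A c i z \<in> tangent_space A (chart_inv c (base_part z))"
    and "affine_vec A c i z c = homogeneous_vec i z"
    and "affine_vec A c i z \<noteq> 0"
proof -
  have b: "base_part z \<in> chart_map c ` chart_dom c" using z by (simp add: affine_image_def)
  note p = chart_map_chart_inv(2)[OF b]
  have hv: "homogeneous_vec i z \<in> coord_space (chart_idx c)"
    by (rule homogeneous_vec_in_coord_space) (use z i in \<open>auto simp: affine_image_def\<close>)
  show "chart_inv c (base_part z) \<in> chart_dom c" by (rule p)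
  show "chart_map c (chart_inv c (base_part z)) = base_part z" by (rule chart_map_chart_inv(1)[OF b])
  show "affine_vec A c i z \<in> tangent_space A (chart_inv c (base_part z))"
    unfolding affine_vec_def by (rule tangent_vec_in_tangent_space[OF A c p hv])
  show at: "affine_vec A c i z c = homogeneous_vec i z"
    unfolding affine_vec_def by (rule tangent_vec_at[OF A c p hv])
  have "homogeneous_vec i z $ i \<noteq> 0" by (simp add: homogeneous_vec_nth)
  then show "affine_vec A c i z \<noteq> 0" using at by fastforce
qed

lemma affine_point_in_affine_dom:
  assumes z: "z \<in> affine_image c i"
  shows "affine_point A c i z \<in> affine_dom A c i"
proof -
  note V = affine_vec_props[OF z]
  have "chart_inv c (base_part z) \<in> carrier_of A" using V(1) c by (auto simp: carrier_of_def)
  then have "affine_point A c i z \<in> proj_tangent_points A"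
    using V(3,5) unfolding affine_point_def proj_tangent_points_def by blast
  moreover have "\<exists>W\<in>complex_line (affine_vec A c i z). W c $ i \<noteq> 0"
    using complex_line_self V(4) by (auto intro!: bexI[of _ "affine_vec A c i z"] simp: homogeneous_vec_nth)
  ultimately show ?thesis using V(1) by (simp add: affine_dom_def affine_point_def)
qed

lemma affine_frame_affine_point:
  assumes z: "z \<in> affine_image c i"
  shows "affine_frame c i (affine_point A c i z) = affine_vec A c i z"
proof -
  let ?E = "affine_frame c i (affine_point A c i z)"
  note E = affine_frame[OF affine_point_in_affine_dom[OF z]]
  obtain a where a: "?E = tscale a (affine_vec A c i z)"
    using E(1) by (auto simp: affine_point_def complex_line_def)
  have "?E c $ i = a" by (simp add: a tscale_def affine_vec_props(4)[OF z] homogeneous_vec_nth)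
  then have "a = 1" using E(2) by simp
  then show ?thesis using a by simp
qed

lemma affine_chart_map_affine_point:
  assumes z: "z \<in> affine_image c i"
  shows "chart_map (affine_chart A c i) (affine_point A c i z) = z"
proof -
  have fr: "affine_frame c i (affine_point A c i z) c = homogeneous_vec i z"
    using affine_frame_affine_point[OF z] affine_vec_props(4)[OF z] by simp
  have "z \<in> coord_space (affine_idx (chart_idx c) i)" using z by (simp add: affine_image_def)
  then have zi: "z $ Inr i = 0" by (auto simp: coord_space_def)
  have "chart_map (affine_chart A c i) (affine_point A c i z) $ s = z $ s" for s
  proof (cases s)
    case (Inl k)
    then show ?thesis
      using affine_vec_props(2)[OF z] by (simp add: affine_chart_def affine_point_def base_part_def)
  next
    case (Inr k)
    then show ?thesis using fr zi by (simp add: affine_chart_def homogeneous_vec_nth)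
  qed
  then show ?thesis by (simp add: vec_eq_iff)
qed

text \<open>
  Together with the preceding lemmas this inverts the affine chart explicitly: \<open>affine_image\<close> is its
  image and \<open>affine_point\<close> its inverse, which turns the squared norm of the frame into
  an explicit function of the coordinates.
\<close>

lemma affine_dom_coordinates:
  assumes x: "x \<in> affine_dom A c i"
  shows "chart_map (affine_chart A c i) x \<in> affine_image c i"
    and "affine_point A c i (chart_map (affine_chart A c i) x) = x"
proof -
  let ?z = "chart_map (affine_chart A c i) x" and ?E = "affine_frame c i x"
  have xP: "x \<in> proj_tangent_points A" and p: "fst x \<in> chart_dom c"
    using x by (auto simp: affine_dom_def)
  note E = affine_frame[OF x]
  have ET: "?E \<in> tangent_space A (fst x)" by (rule proj_tangent_pointsD(2)[OF A xP E(1)])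
  note Ec = tangent_space_component[OF ET c p]
  have base: "base_part ?z = chart_map c (fst x)"
    by (simp add: base_part_def affine_chart_def vec_eq_iff)
  have hom: "homogeneous_vec i ?z = ?E c"
    by (auto simp: homogeneous_vec_nth affine_chart_def vec_eq_iff E(2))
  have "?z \<in> coord_space (affine_idx (chart_idx c) i)"
    unfolding coord_space_def
  proof (intro CollectI allI impI)
    fix s assume s: "s \<notin> affine_idx (chart_idx c) i"
    show "?z $ s = 0"
    proof (cases s)
      case (Inl k)
      then show ?thesis using s chart_map_in_coord_space[OF A c p] by (auto simp: affine_chart_def coord_space_def)
    next
      case (Inr k)
      then show ?thesis using s Ec by (auto simp: affine_chart_def coord_space_def)
    qed
  qed
  then show z: "?z \<in> affine_image c i" using p by (simp add: affine_image_def base)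
  have inv: "chart_inv c (base_part ?z) = fst x" unfolding base by (rule chart_inv_chart_map[OF A c p])
  have "affine_vec A c i ?z = ?E"
    unfolding affine_vec_def inv hom by (rule tangent_vec_component[OF ET c p])
  then show "affine_point A c i ?z = x"
    unfolding affine_point_def inv using E(3) by (metis prod.collapse)
qed

lemma affine_chart_image: "chart_map (affine_chart A c i) ` chart_dom (affine_chart A c i) = affine_image c i"
proof (intro equalityI subsetI)
  fix z assume "z \<in> chart_map (affine_chart A c i) ` chart_dom (affine_chart A c i)"
  then show "z \<in> affine_image c i" using affine_dom_coordinates(1) by (auto simp: affine_chart_def)
next
  fix z assume z: "z \<in> affine_image c i"
  have "affine_point A c i z \<in> chart_dom (affine_chart A c i)"
    using affine_point_in_affine_dom[OF z] by (simp add: affine_chart_def)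
  then show "z \<in> chart_map (affine_chart A c i) ` chart_dom (affine_chart A c i)"
    using affine_chart_map_affine_point[OF z] by (metis image_eqI)
qed

lemma affine_chart_inv:
  assumes z: "z \<in> affine_image c i"
  shows "chart_inv (affine_chart A c i) z = affine_point A c i z"
proof -
  have "inj_on (chart_map (affine_chart A c i)) (chart_dom (affine_chart A c i))"
    by (rule inj_on_inverseI[of _ "affine_point A c i"]) (use affine_dom_coordinates(2) in \<open>auto simp: affine_chart_def\<close>)
  moreover have "affine_point A c i z \<in> chart_dom (affine_chart A c i)"
    using affine_point_in_affine_dom[OF z] by (simp add: affine_chart_def)
  ultimately have "chart_inv (affine_chart A c i) (chart_map (affine_chart A c i) (affine_point A c i z)) = affine_point A c i z"
    unfolding chart_inv_def by (rule inv_into_f_f)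
  then show ?thesis using affine_chart_map_affine_point[OF z] by simp
qed

lemma openin_coord_base_preimage:
  assumes "openin_coord (chart_idx c) S"
  shows "openin_coord (affine_idx (chart_idx c) i) {z \<in> coord_space (affine_idx (chart_idx c) i). base_part z \<in> S}"
  by (rule openin_coord_preimage[OF _ continuous_on_base_part assms base_part_in_coord_space]) auto

lemma openin_coord_affine_image: "openin_coord (affine_idx (chart_idx c) i) (affine_image c i)"
  unfolding affine_image_def by (rule openin_coord_base_preimage[OF complex_manifoldD(2)[OF A c]])

lemma affine_point_in_proj: "z \<in> affine_image c i \<Longrightarrow> affine_point A c i z \<in> proj_tangent_points A"
  by (rule affine_dom_subset) (rule affine_point_in_affine_dom)

end

lemma proj_tangent_points_cover:
  assumes x: "x \<in> proj_tangent_points A"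
  obtains c i where "c \<in> A" "i \<in> chart_idx c" "x \<in> affine_dom A c i"
proof -
  have "x \<in> carrier_of (proj_tangent_atlas A)" using x by (simp add: carrier_proj_tangent_atlas)
  then show ?thesis using that by (auto simp: carrier_of_def proj_tangent_atlas_def affine_chart_def)
qed

section \<open>The quotient of the two norms and its maximum\<close>

definition norm_quotient ::
    "('a, 'm::finite) chart set \<Rightarrow> ('b, 'n::finite) chart set \<Rightarrow> ('a \<Rightarrow> 'b) \<Rightarrow>
     ('b \<Rightarrow> ('b, 'n) tangent \<Rightarrow> ('b, 'n) tangent \<Rightarrow> complex) \<Rightarrow>
     (('a, 'm) proj_tangent \<Rightarrow> ('a, 'm) tangent \<Rightarrow> ('a, 'm) tangent \<Rightarrow> complex) \<Rightarrow> ('a, 'm) proj_tangent \<Rightarrow> real"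
  where "norm_quotient M N f g h x =
    (let W = SOME W. W \<in> snd x \<and> W \<noteq> 0; U = differential M N f (fst x) W
     in Re (g (f (fst x)) U U) / Re (h x W W))"

lemma hermitian_inner_scale_square:
  assumes H: "hermitian_inner sc V h" and u: "u \<in> V" "sc a u \<in> V"
  shows "Re (h (sc a u) (sc a u)) = (cmod a)\<^sup>2 * Re (h u u)"
proof -
  have "h (sc a u) (sc a u) = a * h u (sc a u)" by (rule hermitian_innerD(2)[OF H u])
  also have "h u (sc a u) = cnj (h (sc a u) u)" by (rule hermitian_innerD(3)[OF H u(2,1)])
  also have "h (sc a u) u = a * h u u" by (rule hermitian_innerD(2)[OF H u(1,1)])
  also have "a * cnj (a * h u u) = of_real ((cmod a)\<^sup>2) * cnj (h u u)"
    using complex_norm_square[of a] by (simp add: mult.assoc)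
  finally show ?thesis by (simp del: of_real_power)
qed

text \<open>
  The data common to all steps. The curvature assumptions enter only in the maximum principle.
\<close>

locale metric_setting =
  fixes M :: "('a, 'm::finite) chart set" and N :: "('b, 'n::finite) chart set"
    and m n :: nat and f :: "'a \<Rightarrow> 'b"
    and g :: "'b \<Rightarrow> ('b, 'n) tangent \<Rightarrow> ('b, 'n) tangent \<Rightarrow> complex"
    and h :: "('a, 'm) proj_tangent \<Rightarrow> ('a, 'm) tangent \<Rightarrow> ('a, 'm) tangent \<Rightarrow> complex"
  assumes M: "complex_manifold m M" and N: "complex_manifold n N" and f: "holomorphic_map M N f"
    and g: "hermitian_metric N g"
    and h: "line_bundle_metric (proj_tangent_atlas M) (tautological_bundle M) h"
begin

lemma f_carrier: "p \<in> carrier_of M \<Longrightarrow> f p \<in> carrier_of N"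
  using f unfolding holomorphic_map_def continuous_map_def by (auto simp: topspace_atlas_topology)

lemma h_hermitian: "x \<in> proj_tangent_points M \<Longrightarrow> hermitian_inner tscale (snd x) (h x)"
  using h by (simp add: line_bundle_metric_def tautological_bundle_def carrier_proj_tangent_atlas)

lemma differential_in_tangent_space:
  assumes p: "p \<in> carrier_of M" and W: "W \<in> tangent_space M p"
  shows "differential M N f p W \<in> tangent_space N (f p)"
proof -
  obtain c where c: "c \<in> M" "p \<in> chart_dom c" using p by (auto simp: carrier_of_def)
  obtain d where d: "d \<in> N" "f p \<in> chart_dom d" using f_carrier[OF p] by (auto simp: carrier_of_def)
  have dom: "chart_map c p \<in> local_dom f c d" using c d by (auto simp: local_dom_def)
  show ?thesis
    unfolding differential_in_charts[OF M N f W c d]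
    by (rule tangent_vec_in_tangent_space[OF N d])
       (rule dirderiv_local_rep_in_coord_space[OF M N f c(1) d(1) dom tangent_space_component[OF W c]])
qed

text \<open>
  Two nonzero vectors of a line differ by a scalar r, and numerator and denominator both scale by
  \<open>\<bar>r\<bar>\<^sup>2\<close>.
\<close>

lemma norm_quotient_eq:
  assumes x: "x \<in> proj_tangent_points M" and W: "W \<in> snd x" "W \<noteq> 0"
  shows "norm_quotient M N f g h x =
    Re (g (f (fst x)) (differential M N f (fst x) W) (differential M N f (fst x) W)) / Re (h x W W)"
proof -
  define W' where "W' = (SOME W. W \<in> snd x \<and> W \<noteq> 0)"
  have W': "W' \<in> snd x" "W' \<noteq> 0"
    using someI[of "\<lambda>W. W \<in> snd x \<and> W \<noteq> 0" W] W by (auto simp: W'_def)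
  obtain W0 where W0: "snd x = complex_line W0" using x by (auto simp: proj_tangent_points_def)
  obtain a b where ab: "W = tscale a W0" "W' = tscale b W0" using W W' W0 by (auto simp: complex_line_def)
  have a: "a \<noteq> 0" using W(2) ab(1) by (auto simp: tscale_def fun_eq_iff)
  have b: "b \<noteq> 0" using W'(2) ab(2) by (auto simp: tscale_def fun_eq_iff)
  define r where "r = b / a"
  have r: "r \<noteq> 0" using a b by (simp add: r_def)
  have W'r: "W' = tscale r W" using a by (simp add: ab r_def tscale_def fun_eq_iff vec_eq_iff)
  note p = proj_tangent_pointsD(1)[OF M x W(1)]
  note WT = proj_tangent_pointsD(2)[OF M x W(1)] and WT' = proj_tangent_pointsD(2)[OF M x W'(1)]
  let ?U = "differential M N f (fst x) W"
  have U': "differential M N f (fst x) W' = tscale r ?U"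
    unfolding W'r by (rule differential_scale[OF M N f WT WT'[unfolded W'r] p f_carrier[OF p]])
  obtain d where d: "d \<in> N" "f (fst x) \<in> chart_dom d" using f_carrier[OF p] by (auto simp: carrier_of_def)
  have num: "Re (g (f (fst x)) (tscale r ?U) (tscale r ?U)) = (cmod r)\<^sup>2 * Re (g (f (fst x)) ?U ?U)"
    by (rule hermitian_inner_scale_square[OF hermitian_metricD(1)[OF g d] differential_in_tangent_space[OF p WT]])
       (use differential_in_tangent_space[OF p WT'] U' in simp)
  have den: "Re (h x (tscale r W) (tscale r W)) = (cmod r)\<^sup>2 * Re (h x W W)"
    by (rule hermitian_inner_scale_square[OF h_hermitian[OF x] W(1) W'(1)[unfolded W'r]])
  have "norm_quotient M N f g h x = Re (g (f (fst x)) (tscale r ?U) (tscale r ?U)) / Re (h x (tscale r W) (tscale r W))"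
    unfolding norm_quotient_def Let_def W'_def[symmetric] U' by (simp add: W'r)
  then show ?thesis unfolding num den using r by simp
qed

definition numerator :: "('a, 'm) chart \<Rightarrow> 'm \<Rightarrow> ('b, 'n) chart \<Rightarrow> complex^('m + 'm) \<Rightarrow> complex"
  where "numerator c i d z =
    sesq (chart_idx d) (\<lambda>k l. metric_comp N g d k l (local_rep f c d (base_part z)))
      (dirderiv (local_rep f c d) (homogeneous_vec i z) (base_part z))
      (dirderiv (local_rep f c d) (homogeneous_vec i z) (base_part z))"

abbreviation denominator :: "('a, 'm) chart \<Rightarrow> 'm \<Rightarrow> complex^('m + 'm) \<Rightarrow> complex"
  where "denominator c i \<equiv> frame_norm2 h (affine_frame c i) (affine_chart M c i)"

lemma denominator_eq:
  assumes "c \<in> M" "i \<in> chart_idx c" "z \<in> affine_image c i"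
  shows "denominator c i z = h (affine_point M c i z) (affine_vec M c i z) (affine_vec M c i z)"
  by (simp add: frame_norm2_def affine_chart_inv[OF M assms] affine_frame_affine_point[OF M assms])

lemma denominator_pos:
  assumes "c \<in> M" "i \<in> chart_idx c" "z \<in> affine_image c i"
  shows "0 < Re (denominator c i z)"
proof -
  have "affine_vec M c i z \<in> snd (affine_point M c i z)" by (simp add: affine_point_def complex_line_self)
  from hermitian_innerD(4)[OF h_hermitian[OF affine_point_in_proj[OF M assms]] this affine_vec_props(5)[OF M assms]]
  show ?thesis by (simp add: denominator_eq[OF assms])
qed

lemma denominator_C2:
  assumes "c \<in> M" "i \<in> chart_idx c"
  shows "C2_on (affine_idx (chart_idx c) i) (affine_image c i) (denominator c i)"
proof (rule smooth_fun_on_imp_C2_on[OF openin_coord_affine_image[OF M assms]])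
  have "affine_chart M c i \<in> proj_tangent_atlas M" "(affine_dom M c i, affine_frame c i) \<in> frames (tautological_bundle M)"
    using assms by (auto simp: proj_tangent_atlas_def tautological_bundle_def)
  then have "smooth_fun_on (chart_idx (affine_chart M c i))
      (chart_map (affine_chart M c i) ` (chart_dom (affine_chart M c i) \<inter> affine_dom M c i)) (denominator c i)"
    using h unfolding line_bundle_metric_def by blast
  moreover have "chart_dom (affine_chart M c i) \<inter> affine_dom M c i = chart_dom (affine_chart M c i)"
    by (simp add: affine_chart_def)
  ultimately show "smooth_fun_on (affine_idx (chart_idx c) i) (affine_image c i) (denominator c i)"
    using affine_chart_image[OF M assms] by (simp add: affine_chart_def)
qed

lemma norm_quotient_affine:
  assumes c: "c \<in> M" and i: "i \<in> chart_idx c" and d: "d \<in> N"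
    and z: "z \<in> affine_image c i" "base_part z \<in> local_dom f c d"
  shows "norm_quotient M N f g h (affine_point M c i z) = Re (numerator c i d z) / Re (denominator c i z)"
proof -
  let ?p = "chart_inv c (base_part z)" and ?W = "affine_vec M c i z"
  note V = affine_vec_props[OF M c i z(1)]
  have fd: "f ?p \<in> chart_dom d" using z(2) chart_inv_chart_map[OF M c] by (auto simp: local_dom_def)
  have WS: "?W \<in> snd (affine_point M c i z)" by (simp add: affine_point_def complex_line_self)
  note X = affine_point_in_proj[OF M c i z(1)]
  have hv: "homogeneous_vec i z \<in> coord_space (chart_idx c)"
    by (rule homogeneous_vec_in_coord_space) (use z i in \<open>auto simp: affine_image_def\<close>)
  note dJ = dirderiv_local_rep_in_coord_space[OF M N f c d z(2) hv]
  have U: "differential M N f ?p ?W = tangent_vec N d (f ?p) (dirderiv (local_rep f c d) (homogeneous_vec i z) (base_part z))"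
    using differential_in_charts[OF M N f V(3) c V(1) d fd] V(2,4) by simp
  have lr: "local_rep f c d (base_part z) = chart_map d (f ?p)" by (simp add: local_rep_def)
  have "g (f ?p) (differential M N f ?p ?W) (differential M N f ?p ?W) = numerator c i d z"
    unfolding U numerator_def lr by (rule hermitian_metric_sesq[OF N g d fd dJ dJ])
  then show ?thesis
    using norm_quotient_eq[OF X WS V(5)] by (simp add: denominator_eq[OF c i z(1)] affine_point_def)
qed

text \<open>
  The formula in a fixed chart \<open>d\<close> of the target is valid only where \<open>f\<close> maps into its domain, so
  continuity is proved near one point at a time.
\<close>

lemma continuous_on_norm_quotient_affine:
  assumes c: "c \<in> M" and i: "i \<in> chart_idx c"
  shows "continuous_on (affine_image c i) (\<lambda>z. norm_quotient M N f g h (affine_point M c i z))"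
  unfolding continuous_on_eq_continuous_within
proof
  fix z0 assume z0: "z0 \<in> affine_image c i"
  let ?p = "chart_inv c (base_part z0)" and ?I = "affine_idx (chart_idx c) i"
  have p: "?p \<in> carrier_of M" using affine_vec_props(1)[OF M c i z0] c by (auto simp: carrier_of_def)
  obtain d where d: "d \<in> N" "f ?p \<in> chart_dom d" using f_carrier[OF p] by (auto simp: carrier_of_def)
  define D where "D = local_dom f c d"
  define U where "U = {z \<in> coord_space ?I. base_part z \<in> D}"
  have D: "openin_coord (chart_idx c) D" unfolding D_def by (rule local_dom_open[OF M N f c d(1)])
  have U: "openin_coord ?I U" unfolding U_def by (rule openin_coord_base_preimage[OF M c i D])
  have UI: "U \<subseteq> affine_image c i" by (auto simp: U_def D_def affine_image_def local_dom_def)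
  have z0U: "z0 \<in> U"
  proof -
    have "base_part z0 = chart_map c ?p" using affine_vec_props(2)[OF M c i z0] by simp
    then have "base_part z0 \<in> D" unfolding D_def local_dom_def using affine_vec_props(1)[OF M c i z0] d(2) by blast
    then show ?thesis using z0 by (simp add: U_def affine_image_def)
  qed
  have baseD: "base_part ` U \<subseteq> D" by (auto simp: U_def)
  have cont_lr: "continuous_on U (\<lambda>z. local_rep f c d (base_part z))"
    by (rule continuous_on_compose2[OF cholomorphic_continuous_on[OF local_rep_cholomorphic[OF M N f c d(1)]] continuous_on_base_part])
       (use baseD in \<open>simp add: D_def\<close>)
  have cont_dd: "continuous_on U (\<lambda>z. dirderiv (local_rep f c d) (homogeneous_vec i z) (base_part z) $ k)" for k
  proof -
    have "continuous_on U (\<lambda>z. (\<lambda>(x, w). dirderiv (local_rep f c d) w x $ k) (base_part z, homogeneous_vec i z))"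
    proof (rule continuous_on_compose2[OF continuous_on_holomorphic_dirderiv[OF D]])
      show "cholomorphic D (local_rep f c d)" unfolding D_def by (rule local_rep_cholomorphic[OF M N f c d(1)])
      show "continuous_on U (\<lambda>z. (base_part z, homogeneous_vec i z))"
        by (intro continuous_on_Pair continuous_on_base_part continuous_on_homogeneous_vec)
      show "(\<lambda>z. (base_part z, homogeneous_vec i z)) ` U \<subseteq> D \<times> coord_space (chart_idx c)"
        using homogeneous_vec_in_coord_space[OF _ i] by (auto simp: U_def)
    qed
    then show ?thesis by simp
  qed
  have cont_g: "continuous_on U (\<lambda>z. metric_comp N g d k l (local_rep f c d (base_part z)))"
    if kl: "k \<in> chart_idx d" "l \<in> chart_idx d" for k l
  proof (rule continuous_on_compose2[OF _ cont_lr])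
    have "smooth_fun_on (chart_idx d) (chart_map d ` chart_dom d) (metric_comp N g d k l)"
      by (rule hermitian_metricD(2)[OF g d(1) kl])
    then have "Ck_on 0 (chart_idx d) (chart_map d ` chart_dom d) (metric_comp N g d k l)"
      unfolding smooth_fun_on_def by blast
    then show "continuous_on (chart_map d ` chart_dom d) (metric_comp N g d k l)" by simp
    show "(\<lambda>z. local_rep f c d (base_part z)) ` U \<subseteq> chart_map d ` chart_dom d"
      using local_rep_image[OF M N f c d(1)] baseD by (auto simp: D_def)
  qed
  have "continuous_on U (\<lambda>z. Re (numerator c i d z))"
    unfolding numerator_def sesq_def
    by (intro continuous_on_Re continuous_on_sum continuous_on_mult continuous_on_cnj cont_g cont_dd)
  moreover have "continuous_on U (\<lambda>z. Re (denominator c i z))"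
  proof (intro continuous_on_Re)
    have "continuous_on (affine_image c i) (denominator c i)"
      using denominator_C2[OF c i] differentiable_imp_continuous_on unfolding C2_on_def by blast
    then show "continuous_on U (denominator c i)" using UI by (rule continuous_on_subset)
  qed
  ultimately have "continuous_on U (\<lambda>z. Re (numerator c i d z) / Re (denominator c i z))"
    by (rule continuous_on_divide) (use denominator_pos[OF c i] UI in force)
  moreover have "Re (numerator c i d z) / Re (denominator c i z) = norm_quotient M N f g h (affine_point M c i z)" if "z \<in> U" for z
    by (rule norm_quotient_affine[OF c i d(1), symmetric]) (use that UI in \<open>auto simp: U_def D_def\<close>)
  ultimately have "continuous_on U (\<lambda>z. norm_quotient M N f g h (affine_point M c i z))"
    by (simp cong: continuous_on_cong)
  then have "continuous (at z0 within U) (\<lambda>z. norm_quotient M N f g h (affine_point M c i z))"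
    using z0U by (simp add: continuous_on_eq_continuous_within)
  moreover have "at z0 within U = at z0 within affine_image c i"
  proof -
    obtain V where V: "open V" "U = coord_space ?I \<inter> V" using U by (auto simp: openin_open)
    have I: "affine_image c i \<subseteq> coord_space ?I" by (auto simp: affine_image_def)
    show ?thesis by (rule at_within_nhd[of _ V]) (use z0U V UI I in auto)
  qed
  ultimately show "continuous (at z0 within affine_image c i) (\<lambda>z. norm_quotient M N f g h (affine_point M c i z))"
    by simp
qed

end

lemma attains_max_finite_cover:
  fixes \<Phi> :: "'x \<Rightarrow> real"
  assumes fin: "finite \<K>" and cover: "X = \<Union>\<K>" and ne: "X \<noteq> {}"
    and max: "\<And>K. K \<in> \<K> \<Longrightarrow> K \<noteq> {} \<Longrightarrow> \<exists>x\<in>K. \<forall>y\<in>K. \<Phi> y \<le> \<Phi> x"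
  obtains x where "x \<in> X" "\<And>y. y \<in> X \<Longrightarrow> \<Phi> y \<le> \<Phi> x"
proof -
  define \<K>' where "\<K>' = {K \<in> \<K>. K \<noteq> {}}"
  have "\<forall>K\<in>\<K>'. \<exists>x. x \<in> K \<and> (\<forall>y\<in>K. \<Phi> y \<le> \<Phi> x)" using max by (auto simp: \<K>'_def)
  then obtain s where s: "\<And>K. K \<in> \<K>' \<Longrightarrow> s K \<in> K \<and> (\<forall>y\<in>K. \<Phi> y \<le> \<Phi> (s K))" by metis
  have fin': "finite (\<Phi> ` s ` \<K>')" using fin by (simp add: \<K>'_def)
  have "\<K>' \<noteq> {}" using ne cover by (auto simp: \<K>'_def)
  then have "Max (\<Phi> ` s ` \<K>') \<in> \<Phi> ` s ` \<K>'" using fin' by (intro Max_in) auto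
  then obtain K where K: "K \<in> \<K>'" "Max (\<Phi> ` s ` \<K>') = \<Phi> (s K)" by auto
  show ?thesis
  proof (rule that[of "s K"])
    show "s K \<in> X" using s[OF K(1)] K(1) cover by (auto simp: \<K>'_def)
    fix y assume "y \<in> X"
    then obtain L where L: "L \<in> \<K>'" "y \<in> L" using cover by (auto simp: \<K>'_def)
    have "\<Phi> y \<le> \<Phi> (s L)" using s[OF L(1)] L(2) by blast
    also have "\<dots> \<le> Max (\<Phi> ` s ` \<K>')" using L(1) fin' by (intro Max_ge) auto
    finally show "\<Phi> y \<le> \<Phi> (s K)" using K(2) by simp
  qed
qed

text \<open>
  Allowing only fibre coordinates of modulus at most 1 keeps a piece over a compact base compact. The
  fibre is still covered, by normalizing a component of largest modulus.
\<close>

lemma compact_affine_piece: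
  fixes B :: "(complex^'d::finite) set"
  assumes "compact B"
  shows "compact {z \<in> coord_space J. base_part z \<in> B \<and> (\<forall>k. cmod (z $ Inr k) \<le> 1)}"
proof -
  let ?S = "{z \<in> coord_space J. base_part z \<in> B \<and> (\<forall>k. cmod (z $ Inr k) \<le> 1)}"
  have "closed (base_part -` B)"
    by (rule closed_vimage[OF compact_imp_closed[OF assms] continuous_on_base_part])
  moreover have "closed {z :: complex^('d + 'd). \<forall>k. cmod (z $ Inr k) \<le> 1}"
    by (intro closed_Collect_all closed_Collect_le continuous_intros)
  ultimately have "closed (coord_space J \<inter> (base_part -` B \<inter> {z. \<forall>k. cmod (z $ Inr k) \<le> 1}))"
    by (intro closed_Int closed_coord_space)
  moreover have "?S = coord_space J \<inter> (base_part -` B \<inter> {z. \<forall>k. cmod (z $ Inr k) \<le> 1})" by auto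
  ultimately have closed: "closed ?S" by simp
  obtain R where R: "\<And>b. b \<in> B \<Longrightarrow> norm b \<le> R" using compact_imp_bounded[OF assms] by (auto simp: bounded_iff)
  have "norm z \<le> (\<Sum>s\<in>(UNIV :: ('d + 'd) set). R + 1)" if z: "z \<in> ?S" for z :: "complex^('d + 'd)"
  proof -
    have R0: "0 \<le> R" using order_trans[OF norm_ge_zero R[of "base_part z"]] z by simp
    have "norm z \<le> (\<Sum>s\<in>UNIV. cmod (z $ s))" unfolding norm_vec_def by (rule L2_set_le_sum) simp
    also have "\<dots> \<le> (\<Sum>s\<in>(UNIV :: ('d + 'd) set). R + 1)"
    proof (rule sum_mono)
      fix s :: "'d + 'd"
      show "cmod (z $ s) \<le> R + 1"
      proof (cases s)
        case (Inl k)
        have "cmod (base_part z $ k) \<le> norm (base_part z)" by (rule Finite_Cartesian_Product.norm_nth_le)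
        then show ?thesis using R[of "base_part z"] z Inl by (simp add: base_part_def)
      next
        case (Inr k)
        then show ?thesis using z R0 by (simp add: add_increasing)
      qed
    qed
    finally show ?thesis .
  qed
  then have "bounded ?S" unfolding bounded_iff by blast
  then show ?thesis using closed by (simp add: compact_eq_bounded_closed)
qed

context metric_setting
begin

lemma proj_point_normalized:
  assumes x: "x \<in> proj_tangent_points M" and c: "c \<in> M" "fst x \<in> chart_dom c"
  obtains i z where "i \<in> chart_idx c" "z \<in> affine_image c i" "x = affine_point M c i z"
    "base_part z = chart_map c (fst x)" "\<forall>k. cmod (z $ Inr k) \<le> 1"
proof -
  obtain W where W: "snd x = complex_line W" "W \<in> tangent_space M (fst x)" "W \<noteq> 0"
    using x by (auto simp: proj_tangent_points_def)
  have "W c \<noteq> 0"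
  proof
    assume "W c = 0"
    then have "W = 0" using tangent_vec_component[OF W(2) c] by (metis tangent_vec_zero)
    then show False using W(3) by simp
  qed
  have "Max (range (\<lambda>k. cmod (W c $ k))) \<in> range (\<lambda>k. cmod (W c $ k))" by (intro Max_in) auto
  then obtain i where "Max (range (\<lambda>k. cmod (W c $ k))) = cmod (W c $ i)" by blast
  then have i: "cmod (W c $ k) \<le> cmod (W c $ i)" for k
    using Max_ge[of "range (\<lambda>k. cmod (W c $ k))" "cmod (W c $ k)"] by auto
  have nz: "W c $ i \<noteq> 0"
  proof
    assume "W c $ i = 0"
    then have "W c $ k = 0" for k using i[of k] by simp
    then show False using \<open>W c \<noteq> 0\<close> by (simp add: vec_eq_iff)
  qed
  have iI: "i \<in> chart_idx c" using nz tangent_space_component[OF W(2) c] by (auto simp: coord_space_def)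
  have dom: "x \<in> affine_dom M c i"
    using x c(2) nz W(1) complex_line_self[of W] by (cases x) (auto simp: affine_dom_def)
  let ?z = "chart_map (affine_chart M c i) x"
  have fr: "affine_frame c i x = tscale (1 / W c $ i) W"
  proof -
    obtain a where a: "affine_frame c i x = tscale a W"
      using affine_frame(1)[OF dom] W(1) by (auto simp: complex_line_def)
    then have "a * W c $ i = 1" using affine_frame(2)[OF dom] by (simp add: tscale_def)
    then have "a = 1 / W c $ i" using nz by (simp add: field_simps)
    then show ?thesis using a by simp
  qed
  show ?thesis
  proof (rule that[OF iI affine_dom_coordinates(1)[OF M c(1) iI dom] affine_dom_coordinates(2)[OF M c(1) iI dom, symmetric]])
    show "base_part ?z = chart_map c (fst x)" by (simp add: base_part_def affine_chart_def vec_eq_iff)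
    show "\<forall>k. cmod (?z $ Inr k) \<le> 1"
      using i nz by (simp add: affine_chart_def fr tscale_def norm_mult norm_divide)
  qed
qed

text \<open>
  Finitely many charts with compact closed balls cover \<open>M\<close>, and over each ball finitely many compact
  affine pieces cover the bundle; the quotient attains a maximum on each piece.
\<close>

lemma norm_quotient_attains_max:
  assumes compact: "compact_space (atlas_topology M)" and ne: "proj_tangent_points M \<noteq> {}"
  obtains x where "x \<in> proj_tangent_points M"
    "\<And>y. y \<in> proj_tangent_points M \<Longrightarrow> norm_quotient M N f g h y \<le> norm_quotient M N f g h x"
proof -
  have "\<forall>p\<in>carrier_of M. \<exists>c e. c \<in> M \<and> p \<in> chart_dom c \<and> e > 0 \<and>
      cball (chart_map c p) e \<inter> coord_space (chart_idx c) \<subseteq> chart_map c ` chart_dom c"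
  proof
    fix p assume "p \<in> carrier_of M"
    then obtain c where c: "c \<in> M" "p \<in> chart_dom c" by (auto simp: carrier_of_def)
    obtain e where e: "e > 0" "\<And>y. y \<in> coord_space (chart_idx c) \<Longrightarrow> dist y (chart_map c p) < e \<Longrightarrow> y \<in> chart_map c ` chart_dom c"
      using openin_coord_ball[OF complex_manifoldD(2)[OF M c(1)] imageI[OF c(2)]] by blast
    have "cball (chart_map c p) (e/2) \<inter> coord_space (chart_idx c) \<subseteq> chart_map c ` chart_dom c"
      using e by (auto simp: dist_commute)
    then show "\<exists>c e. c \<in> M \<and> p \<in> chart_dom c \<and> e > 0 \<and>
      cball (chart_map c p) e \<inter> coord_space (chart_idx c) \<subseteq> chart_map c ` chart_dom c"
      using c e(1) half_gt_zero by blast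
  qed
  then obtain ch rad where ch: "\<And>p. p \<in> carrier_of M \<Longrightarrow> ch p \<in> M \<and> p \<in> chart_dom (ch p) \<and> rad p > 0 \<and>
      cball (chart_map (ch p) p) (rad p) \<inter> coord_space (chart_idx (ch p)) \<subseteq> chart_map (ch p) ` chart_dom (ch p)"
    by metis
  define V where "V = (\<lambda>p. {q \<in> chart_dom (ch p). chart_map (ch p) q \<in> ball (chart_map (ch p) p) (rad p)})"
  have Vopen: "openin (atlas_topology M) (V p)" if "p \<in> carrier_of M" for p
    unfolding V_def using ch[OF that] by (intro openin_atlas_basic) auto
  have "compactin (atlas_topology M) (carrier_of M)"
    using compact by (simp add: compact_space_def topspace_atlas_topology)
  moreover have "carrier_of M \<subseteq> \<Union> (V ` carrier_of M)" using ch by (fastforce simp: V_def)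
  ultimately obtain \<F> where \<F>: "finite \<F>" "\<F> \<subseteq> V ` carrier_of M" "carrier_of M \<subseteq> \<Union>\<F>"
    using Vopen unfolding compactin_def by (metis (no_types, lifting) imageE)
  then obtain F where F: "finite F" "F \<subseteq> carrier_of M" "\<F> = V ` F" by (meson finite_subset_image)
  define B where "B = (\<lambda>p. cball (chart_map (ch p) p) (rad p) \<inter> coord_space (chart_idx (ch p)))"
  define Z where "Z = (\<lambda>(p, i). {z \<in> coord_space (affine_idx (chart_idx (ch p)) i). base_part z \<in> B p \<and> (\<forall>k. cmod (z $ Inr k) \<le> 1)})"
  define P where "P = (\<lambda>(p, i). affine_point M (ch p) i ` Z (p, i))"
  define Ix where "Ix = (SIGMA p:F. chart_idx (ch p))"
  have Zsub: "Z (p, i) \<subseteq> affine_image (ch p) i" if "p \<in> F" for p i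
  proof -
    have "B p \<subseteq> chart_map (ch p) ` chart_dom (ch p)" using ch[of p] F(2) that unfolding B_def by blast
    then show ?thesis by (auto simp: Z_def affine_image_def)
  qed
  have cover: "proj_tangent_points M = \<Union> (P ` Ix)"
  proof (intro equalityI subsetI)
    fix x assume x: "x \<in> proj_tangent_points M"
    then have "fst x \<in> carrier_of M" by (auto simp: proj_tangent_points_def)
    then obtain p where p: "p \<in> F" "fst x \<in> V p" using \<F>(3) F(3) by auto
    have chp: "ch p \<in> M" using ch F(2) p(1) by auto
    have pd: "fst x \<in> chart_dom (ch p)" using p(2) by (simp add: V_def)
    obtain i z where iz: "i \<in> chart_idx (ch p)" "z \<in> affine_image (ch p) i" "x = affine_point M (ch p) i z"
      "base_part z = chart_map (ch p) (fst x)" "\<forall>k. cmod (z $ Inr k) \<le> 1"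
      using proj_point_normalized[OF x chp pd] by metis
    have "z \<in> Z (p, i)"
      using iz p(2) chart_map_in_coord_space[OF M chp pd]
      by (auto simp: Z_def B_def V_def affine_image_def)
    then show "x \<in> \<Union> (P ` Ix)"
      using iz p(1) by (auto simp: P_def Ix_def intro!: bexI[of _ "(p, i)"])
  next
    fix x assume "x \<in> \<Union> (P ` Ix)"
    then obtain p i z where "p \<in> F" "i \<in> chart_idx (ch p)" "z \<in> Z (p, i)" "x = affine_point M (ch p) i z"
      by (auto simp: P_def Ix_def)
    then show "x \<in> proj_tangent_points M"
      using affine_point_in_proj[OF M, of "ch p" i z] ch[of p] F(2) Zsub[of p i] by auto
  qed
  have fin: "finite (P ` Ix)" using F(1) by (auto simp: Ix_def)
  show ?thesis
  proof (rule attains_max_finite_cover[OF fin cover ne, of "norm_quotient M N f g h"])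
    fix K assume "K \<in> P ` Ix" and K: "K \<noteq> {}"
    then obtain p i where pi: "p \<in> F" "i \<in> chart_idx (ch p)" "K = affine_point M (ch p) i ` Z (p, i)"
      by (auto simp: P_def Ix_def)
    have chp: "ch p \<in> M" using ch F(2) pi(1) by auto
    have "compact (B p)" unfolding B_def by (intro compact_Int_closed compact_cball closed_coord_space)
    then have comp: "compact (Z (p, i))" unfolding Z_def by (simp add: compact_affine_piece)
    have cont: "continuous_on (Z (p, i)) (\<lambda>z. norm_quotient M N f g h (affine_point M (ch p) i z))"
      by (rule continuous_on_subset[OF continuous_on_norm_quotient_affine[OF chp pi(2)] Zsub[OF pi(1)]])
    have "Z (p, i) \<noteq> {}" using K pi(3) by auto
    from continuous_attains_sup[OF comp this cont]
    show "\<exists>x\<in>K. \<forall>y\<in>K. norm_quotient M N f g h y \<le> norm_quotient M N f g h x"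
      unfolding pi(3) by auto
  qed (rule that)
qed

end


section \<open>The maximum principle\<close>

lemma second_derivative_nonneg_at_min:
  fixes q :: "real \<Rightarrow> real"
  assumes r: "r > 0" and q1: "\<And>t. \<bar>t\<bar> < r \<Longrightarrow> (q has_real_derivative q' t) (at t)"
    and q2: "(q' has_real_derivative q'') (at 0)" and min: "\<And>t. \<bar>t\<bar> < r \<Longrightarrow> q 0 \<le> q t"
  shows "q' 0 = 0" "0 \<le> q''"
proof -
  show q0: "q' 0 = 0"
    by (rule DERIV_local_min[OF q1[of 0] r]) (use r min in auto)
  show "0 \<le> q''"
  proof (rule ccontr)
    assume "\<not> 0 \<le> q''"
    then obtain d where d: "d > 0" "\<And>t. t > 0 \<Longrightarrow> t < d \<Longrightarrow> q' t < q' 0"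
      using DERIV_neg_dec_right[OF q2] by auto
    define b where "b = min d r / 2"
    have b: "0 < b" "b < d" "b < r" using d r by (auto simp: b_def min_def)
    have "\<exists>t. 0 < t \<and> t < b \<and> q b - q 0 = (b - 0) * q' t"
      by (rule MVT2) (use b q1 in auto)
    then obtain t where t: "0 < t" "t < b" "q b - q 0 = b * q' t" by auto
    have "q' t < 0" using d(2)[of t] t b q0 by auto
    then have "b * q' t < 0" using b(1) by (simp add: mult_pos_neg)
    then show False using t(3) min[of b] b by auto
  qed
qed

text \<open>
  The direction is the conjugate of an eigenvector: the eigenvector equation contracts the second index,
  whereas the Levi form conjugates the component that goes with it.
\<close>

lemma positive_eigenvalue_direction:
  fixes E :: "'d::finite \<Rightarrow> 'd \<Rightarrow> complex"
  assumes "matrix_eigenvalue I E (complex_of_real \<mu>)" "\<mu> > 0"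
  obtains u where "u \<in> coord_space I" "0 < Re (\<Sum>i\<in>I. \<Sum>j\<in>I. E i j * u $ i * cnj (u $ j))"
proof -
  obtain v where v: "v \<in> coord_space I" "v \<noteq> 0" "\<And>i. i \<in> I \<Longrightarrow> (\<Sum>j\<in>I. E i j * v $ j) = of_real \<mu> * v $ i"
    using assms(1) unfolding matrix_eigenvalue_def by blast
  define u where "u = (\<chi> i. cnj (v $ i))"
  have u: "u \<in> coord_space I" using v(1) by (simp add: u_def coord_space_def)
  have "(\<Sum>i\<in>I. \<Sum>j\<in>I. E i j * u $ i * cnj (u $ j)) = (\<Sum>i\<in>I. cnj (v $ i) * (\<Sum>j\<in>I. E i j * v $ j))"
    unfolding sum_distrib_left by (intro sum.cong refl) (simp add: u_def mult_ac)
  also have "\<dots> = (\<Sum>i\<in>I. of_real (\<mu> * (cmod (v $ i))\<^sup>2))"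
  proof (intro sum.cong refl)
    fix i assume "i \<in> I"
    have "complex_of_real (\<mu> * (cmod (v $ i))\<^sup>2) = of_real \<mu> * (v $ i * cnj (v $ i))"
      by (simp only: of_real_mult complex_norm_square)
    then show "cnj (v $ i) * (\<Sum>j\<in>I. E i j * v $ j) = of_real (\<mu> * (cmod (v $ i))\<^sup>2)"
      by (simp only: v(3)[OF \<open>i \<in> I\<close>] mult_ac)
  qed
  also have "\<dots> = of_real (\<Sum>i\<in>I. \<mu> * (cmod (v $ i))\<^sup>2)" by simp
  finally have eq: "Re (\<Sum>i\<in>I. \<Sum>j\<in>I. E i j * u $ i * cnj (u $ j)) = (\<Sum>i\<in>I. \<mu> * (cmod (v $ i))\<^sup>2)"
    by (simp only: Re_complex_of_real)
  obtain k where k: "v $ k \<noteq> 0" using v(2) by (auto simp: vec_eq_iff)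
  then have kI: "k \<in> I" using v(1) by (auto simp: coord_space_def)
  have "0 < (\<Sum>i\<in>I. \<mu> * (cmod (v $ i))\<^sup>2)"
    by (rule sum_pos2[OF _ kI]) (use assms(2) k in auto)
  then show ?thesis using that[OF u] eq by simp
qed

context metric_setting
begin

text \<open>
  At a positive maximum \<open>\<Phi>\<close>, the difference \<open>\<Phi> * H - G\<close> has a minimum at 0 along both rays, which
  transfers the inequality \<open>G \<Delta>G \<ge> \<bar>\<nabla>G\<bar>\<^sup>2\<close> to \<open>H\<close> and contradicts the choice of \<open>u\<close>.
\<close>

lemma norm_quotient_max_nonpos:
  assumes x: "x \<in> proj_tangent_points M"
    and max: "\<And>y. y \<in> proj_tangent_points M \<Longrightarrow> norm_quotient M N f g h y \<le> norm_quotient M N f g h x"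
    and RC: "\<And>c i. c \<in> M \<Longrightarrow> i \<in> chart_idx c \<Longrightarrow> x \<in> affine_dom M c i \<Longrightarrow>
      \<exists>\<mu>>0. matrix_eigenvalue (affine_idx (chart_idx c) i)
        (line_curvature h (affine_frame c i) (affine_chart M c i) (chart_map (affine_chart M c i) x)) (complex_of_real \<mu>)"
    and curv: "nonpos_bisectional_curvature N g"
  shows "norm_quotient M N f g h x \<le> 0"
proof (rule ccontr)
  define \<Phi> where "\<Phi> = norm_quotient M N f g h x"
  assume "\<not> norm_quotient M N f g h x \<le> 0"
  then have \<Phi>: "\<Phi> > 0" by (simp add: \<Phi>_def)
  obtain c i where c: "c \<in> M" and i: "i \<in> chart_idx c" and xd: "x \<in> affine_dom M c i"
    using proj_tangent_points_cover[OF x] by blast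
  let ?I = "affine_idx (chart_idx c) i"
  define S where "S = affine_image c i"
  define H where "H = denominator c i"
  define z0 where "z0 = chart_map (affine_chart M c i) x"
  have S: "openin_coord ?I S" unfolding S_def by (rule openin_coord_affine_image[OF M c i])
  have z0: "z0 \<in> S" and xz0: "affine_point M c i z0 = x"
    unfolding z0_def S_def using affine_dom_coordinates[OF M c i xd] by auto
  have z0': "z0 \<in> coord_space ?I" using z0 by (simp add: S_def affine_image_def)
  have H2: "C2_on ?I S H" unfolding H_def S_def by (rule denominator_C2[OF c i])
  have H1: "H differentiable_on S" using H2 by (simp add: C2_on_def)
  have Hpos: "0 < Re (H z)" if "z \<in> S" for z
    using denominator_pos[OF c i, of z] that by (simp add: H_def S_def)
  obtain \<mu> where \<mu>: "\<mu> > 0" "matrix_eigenvalue ?I (line_curvature h (affine_frame c i) (affine_chart M c i) z0) (complex_of_real \<mu>)"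
    using RC[OF c i xd] by (auto simp: z0_def)
  obtain u where u: "u \<in> coord_space ?I"
    and upos: "0 < Re (\<Sum>k\<in>?I. \<Sum>l\<in>?I. line_curvature h (affine_frame c i) (affine_chart M c i) z0 k l * u $ k * cnj (u $ l))"
    by (rule positive_eigenvalue_direction[OF \<mu>(2,1)]) (rule that)
  define \<eta>1 where "\<eta>1 = (\<lambda>\<theta>. Re (dirderiv H (\<theta> *s u) z0))"
  define \<eta>2 where "\<eta>2 = (\<lambda>\<theta>. Re (dirderiv (dirderiv H (\<theta> *s u)) (\<theta> *s u) z0))"
  have neg: "(\<eta>2 1 / Re (H z0) - (\<eta>1 1 / Re (H z0))\<^sup>2) + (\<eta>2 \<i> / Re (H z0) - (\<eta>1 \<i> / Re (H z0))\<^sup>2) < 0"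
  proof -
    have "(\<Sum>k\<in>?I. \<Sum>l\<in>?I. line_curvature h (affine_frame c i) (affine_chart M c i) z0 k l * u $ k * cnj (u $ l))
      = - (\<Sum>k\<in>?I. \<Sum>l\<in>?I. d_dz k (d_dzbar l (\<lambda>y. complex_of_real (ln (Re (H y))))) z0 * u $ k * cnj (u $ l))"
      by (simp only: line_curvature_def H_def[symmetric] mult_minus_left sum_negf)
    then have "Re (\<Sum>k\<in>?I. \<Sum>l\<in>?I. d_dz k (d_dzbar l (\<lambda>y. complex_of_real (ln (Re (H y))))) z0 * u $ k * cnj (u $ l)) < 0"
      using upos by (simp only: uminus_complex.sel neg_0_less_iff_less)
    moreover have "Re (\<Sum>k\<in>?I. \<Sum>l\<in>?I. d_dz k (d_dzbar l (\<lambda>y. complex_of_real (ln (Re (H y))))) z0 * u $ k * cnj (u $ l)) =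
      ((\<eta>2 1 / Re (H z0) - (\<eta>1 1 / Re (H z0))\<^sup>2) + (\<eta>2 \<i> / Re (H z0) - (\<eta>1 \<i> / Re (H z0))\<^sup>2)) / 4"
      by (rule trans[OF Levi_contraction_ln[OF S H2 z0 u]]) (simp_all add: Hpos \<eta>1_def \<eta>2_def)
    moreover have "y < 0 \<Longrightarrow> y = t / 4 \<Longrightarrow> t < 0" for y t :: real by simp
    ultimately show ?thesis by blast
  qed
  let ?p = "chart_inv c (base_part z0)"
  have p: "?p \<in> carrier_of M" using affine_vec_props(1)[OF M c i z0[unfolded S_def]] c by (auto simp: carrier_of_def)
  obtain d where d: "d \<in> N" "f ?p \<in> chart_dom d" using f_carrier[OF p] by (auto simp: carrier_of_def)
  define D where "D = local_dom f c d"
  define F where "F = local_rep f c d"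
  let ?J = "chart_idx d"
  define T where "T = chart_map d ` chart_dom d"
  have D: "openin_coord (chart_idx c) D" unfolding D_def by (rule local_dom_open[OF M N f c d(1)])
  have F: "cholomorphic D F" unfolding D_def F_def by (rule local_rep_cholomorphic[OF M N f c d(1)])
  have T: "openin_coord ?J T" unfolding T_def by (rule complex_manifoldD(2)[OF N d(1)])
  define U where "U = {z \<in> coord_space ?I. base_part z \<in> D}"
  have U: "openin_coord ?I U" unfolding U_def by (rule openin_coord_base_preimage[OF M c i D])
  have US: "U \<subseteq> S" by (auto simp: U_def D_def S_def affine_image_def local_dom_def)
  have z0U: "z0 \<in> U"
  proof -
    have "base_part z0 = chart_map c ?p" using affine_vec_props(2)[OF M c i z0[unfolded S_def]] by simp
    then have "base_part z0 \<in> D" unfolding D_def local_dom_def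
      using affine_vec_props(1)[OF M c i z0[unfolded S_def]] d(2) by blast
    then show ?thesis using z0' by (simp add: U_def)
  qed
  have "open {\<zeta> \<in> UNIV. z0 + \<zeta> *s u \<in> U}"
    by (rule open_preimage_coord[OF U open_UNIV continuous_on_scale_left]) (intro coord_space_intros z0' u)
  moreover have "0 \<in> {\<zeta> \<in> UNIV. z0 + \<zeta> *s u \<in> U}" using z0U by simp
  ultimately obtain r where r: "r > 0" "ball 0 r \<subseteq> {\<zeta> \<in> UNIV. z0 + \<zeta> *s u \<in> U}"
    by (rule openE) (rule that)
  have lineU: "z0 + \<zeta> *s u \<in> U" if "\<zeta> \<in> ball 0 r" for \<zeta> using r(2) that by auto
  define \<phi> where "\<phi> = (\<lambda>\<zeta>. F (base_part z0 + \<zeta> *s base_part u))"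
  define s where "s = (\<lambda>\<zeta>. dirderiv F (homogeneous_vec i z0 + \<zeta> *s fibre_part i u) (base_part z0 + \<zeta> *s base_part u))"
  have bD: "base_part z0 + \<zeta> *s base_part u \<in> D" if "\<zeta> \<in> ball 0 r" for \<zeta>
    using lineU[OF that] by (simp add: U_def base_part_line)
  have bz: "base_part z0 \<in> coord_space (chart_idx c)" "base_part u \<in> coord_space (chart_idx c)"
    using z0' u by (auto intro: base_part_in_coord_space)
  have hz: "homogeneous_vec i z0 \<in> coord_space (chart_idx c)" "fibre_part i u \<in> coord_space (chart_idx c)"
    using homogeneous_vec_in_coord_space[OF z0' i] fibre_part_in_coord_space[OF u] by auto
  let ?G = "\<lambda>\<zeta>. sesq ?J (\<lambda>k l. metric_comp N g d k l (\<phi> \<zeta>)) (s \<zeta>) (s \<zeta>)"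
  have G: "?G \<zeta> = numerator c i d (z0 + \<zeta> *s u)" for \<zeta>
    by (simp add: numerator_def \<phi>_def s_def F_def base_part_line homogeneous_vec_line)
  obtain G1 G2 where
    G1: "\<And>\<theta> t. \<theta> \<in> {1, \<i>} \<Longrightarrow> \<bar>t\<bar> < r \<Longrightarrow> ((\<lambda>t. Re (?G (of_real t * \<theta>))) has_real_derivative G1 \<theta> t) (at t)"
    and G2: "\<And>\<theta>. \<theta> \<in> {1, \<i>} \<Longrightarrow> (G1 \<theta> has_real_derivative G2 \<theta>) (at 0)"
    and GG: "(G1 1 0)\<^sup>2 + (G1 \<i> 0)\<^sup>2 \<le> Re (?G 0) * (G2 1 + G2 \<i>)"
  proof (rule bisectional_log_convexity[OF T _ _ r(1), of "metric_comp N g d" \<phi> s])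
    show "C2_on ?J T (metric_comp N g d k l)" if "k \<in> ?J" "l \<in> ?J" for k l
      by (rule smooth_fun_on_imp_C2_on[OF T]) (unfold T_def, rule hermitian_metricD(2)[OF g d(1) that])
    show "pos_hermitian ?J (\<lambda>k l. metric_comp N g d k l y)" if "y \<in> T" for y
      by (rule hermitian_metric_pos_hermitian[OF N g d(1)]) (use that in \<open>simp add: T_def\<close>)
    show "\<phi> \<zeta> \<in> T" if "\<zeta> \<in> ball 0 r" for \<zeta>
      unfolding \<phi>_def T_def F_def by (rule local_rep_image[OF M N f c d(1)]) (use bD[OF that] in \<open>simp add: D_def\<close>)
    show "(\<lambda>\<zeta>. \<phi> \<zeta> $ k) holomorphic_on ball 0 r" for k
      unfolding holomorphic_on_open[OF open_ball] \<phi>_def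
      using holomorphic_line[OF D F bz] bD by blast
    show "s \<zeta> \<in> coord_space ?J" if "\<zeta> \<in> ball 0 r" for \<zeta>
      unfolding s_def F_def
      by (rule dirderiv_local_rep_in_coord_space[OF M N f c d(1)])
         (use bD[OF that] hz in \<open>auto simp: D_def intro!: coord_space_add coord_space_scale\<close>)
    show "(\<lambda>\<zeta>. s \<zeta> $ k) holomorphic_on ball 0 r" for k
      unfolding s_def by (rule holomorphic_dirderiv_along_line[OF D F bz hz open_ball bD])
    fix v w assume v: "v \<in> coord_space ?J" and w: "w \<in> coord_space ?J"
    have y: "\<phi> 0 = chart_map d (f ?p)" by (simp add: \<phi>_def F_def local_rep_def)
    have fp: "f ?p \<in> carrier_of N" by (rule f_carrier[OF p])
    note at = tangent_vec_at[OF N d]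
    have "Re (\<Sum>i\<in>?J. \<Sum>j\<in>?J. \<Sum>k\<in>?J. \<Sum>l\<in>?J. chern_curvature N g d (chart_map d (f ?p)) i j k l *
        (tangent_vec N d (f ?p) v d $ i) * cnj (tangent_vec N d (f ?p) v d $ j) *
        (tangent_vec N d (f ?p) w d $ k) * cnj (tangent_vec N d (f ?p) w d $ l)) \<le> 0"
      using curv fp d tangent_vec_in_tangent_space[OF N d v] tangent_vec_in_tangent_space[OF N d w]
      unfolding nonpos_bisectional_curvature_def by blast
    then show "Re (\<Sum>i\<in>?J. \<Sum>j\<in>?J. \<Sum>k\<in>?J. \<Sum>l\<in>?J.
         (- d_dz i (d_dzbar j (metric_comp N g d k l)) (\<phi> 0) + (\<Sum>p\<in>?J. \<Sum>q\<in>?J.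
            inverse_metric ?J (\<lambda>a b. metric_comp N g d a b (\<phi> 0)) p q *
              d_dz i (metric_comp N g d k q) (\<phi> 0) * d_dzbar j (metric_comp N g d p l) (\<phi> 0))) *
         v $ i * cnj (v $ j) * w $ k * cnj (w $ l)) \<le> 0"
      unfolding at[OF v] at[OF w] chern_curvature_def y .
  qed (rule that)
  have quot: "norm_quotient M N f g h (affine_point M c i z) = Re (numerator c i d z) / Re (H z)" if "z \<in> U" for z
    unfolding H_def by (rule norm_quotient_affine[OF c i d(1)]) (use that US in \<open>auto simp: U_def S_def D_def\<close>)
  have le: "Re (?G \<zeta>) \<le> \<Phi> * Re (H (z0 + \<zeta> *s u))" if "\<zeta> \<in> ball 0 r" for \<zeta>
  proof -
    let ?z = "z0 + \<zeta> *s u"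
    have zU: "?z \<in> U" by (rule lineU[OF that])
    then have zS: "?z \<in> S" using US by auto
    have "Re (?G \<zeta>) / Re (H ?z) \<le> \<Phi>"
      unfolding G quot[OF zU, symmetric] \<Phi>_def by (intro max affine_point_in_proj[OF M c i] zS[unfolded S_def])
    then show ?thesis using Hpos[OF zS] by (simp add: field_simps)
  qed
  have eq0: "Re (?G 0) = \<Phi> * Re (H z0)"
    using quot[OF z0U] Hpos[OF z0] by (simp add: G \<Phi>_def xz0)
  have key: "G1 \<theta> 0 = \<Phi> * \<eta>1 \<theta> \<and> G2 \<theta> \<le> \<Phi> * \<eta>2 \<theta>" if \<theta>: "\<theta> \<in> {1, \<i>}" for \<theta>
  proof -
    have nth: "cmod \<theta> = 1" using \<theta> by auto
    have thu: "\<theta> *s u \<in> coord_space ?I" using u by (rule coord_space_scale)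
    define \<gamma> where "\<gamma> = (\<lambda>t::real. z0 + t *\<^sub>R (\<theta> *s u))"
    have \<gamma>eq: "\<gamma> t = z0 + (of_real t * \<theta>) *s u" for t
      by (simp add: \<gamma>_def scaleR_vec_eq_scale)
    have ball: "of_real t * \<theta> \<in> ball 0 r" if "\<bar>t\<bar> < r" for t using that nth by (simp add: norm_mult)
    define I where "I = {-r<..<r}"
    have I: "open I" "0 \<in> I" using r by (auto simp: I_def)
    have \<gamma>S: "\<gamma> t \<in> S" if "t \<in> I" for t
      using lineU[OF ball, of t] US that by (auto simp: \<gamma>eq I_def)
    have \<gamma>': "(\<gamma> has_vector_derivative \<theta> *s u) (at t)" for t
      unfolding \<gamma>_def by (auto intro!: derivative_eq_intros)
    have d1: "((\<lambda>t. Re (H (\<gamma> t))) has_real_derivative Re (dirderiv H (\<theta> *s u) (\<gamma> t))) (at t)" if "\<bar>t\<bar> < r" for t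
    proof -
      have "((\<lambda>t. H (\<gamma> t)) has_vector_derivative dirderiv H (\<theta> *s u) (\<gamma> t)) (at t)"
        by (rule has_vector_derivative_along_curve[OF S H1 I(1) _ \<gamma>S \<gamma>' thu]) (use that in \<open>auto simp: I_def\<close>)
      from bounded_linear.has_vector_derivative[OF bounded_linear_Re this]
      show ?thesis by (simp add: has_real_derivative_iff_has_vector_derivative)
    qed
    have d2: "((\<lambda>t. Re (dirderiv H (\<theta> *s u) (\<gamma> t))) has_real_derivative \<eta>2 \<theta>) (at 0)"
    proof -
      have "dirderiv H (\<theta> *s u) differentiable_on S" using H2 thu by (simp add: C2_on_def)
      then have "((\<lambda>t. dirderiv H (\<theta> *s u) (\<gamma> t)) has_vector_derivative dirderiv (dirderiv H (\<theta> *s u)) (\<theta> *s u) (\<gamma> 0)) (at 0)"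
        by (rule has_vector_derivative_along_curve[OF S _ I \<gamma>S \<gamma>' thu])
      from bounded_linear.has_vector_derivative[OF bounded_linear_Re this]
      show ?thesis by (simp add: has_real_derivative_iff_has_vector_derivative \<eta>2_def \<gamma>_def)
    qed
    define q where "q = (\<lambda>t. \<Phi> * Re (H (\<gamma> t)) - Re (?G (of_real t * \<theta>)))"
    define q' where "q' = (\<lambda>t. \<Phi> * Re (dirderiv H (\<theta> *s u) (\<gamma> t)) - G1 \<theta> t)"
    have q1: "(q has_real_derivative q' t) (at t)" if "\<bar>t\<bar> < r" for t
      unfolding q_def q'_def by (intro DERIV_diff DERIV_cmult d1 G1 \<theta> that)
    have q2: "(q' has_real_derivative (\<Phi> * \<eta>2 \<theta> - G2 \<theta>)) (at 0)"
      unfolding q'_def by (intro DERIV_diff DERIV_cmult d2 G2 \<theta>)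
    have min: "q 0 \<le> q t" if "\<bar>t\<bar> < r" for t
      using le[OF ball[OF that]] eq0 by (simp add: q_def \<gamma>eq)
    have "q' 0 = 0"
      by (rule second_derivative_nonneg_at_min(1)[OF r(1) q1 q2 min])
    moreover have "0 \<le> \<Phi> * \<eta>2 \<theta> - G2 \<theta>"
      by (rule second_derivative_nonneg_at_min(2)[where q = q and q' = q', OF r(1) q1 q2 min])
    ultimately show ?thesis by (simp add: q'_def \<eta>1_def \<gamma>_def)
  qed
  have hp: "0 < Re (H z0)" by (rule Hpos[OF z0])
  have "\<Phi>\<^sup>2 * ((\<eta>1 1)\<^sup>2 + (\<eta>1 \<i>)\<^sup>2) = (G1 1 0)\<^sup>2 + (G1 \<i> 0)\<^sup>2"
    using key by (simp add: power_mult_distrib algebra_simps)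
  also have "\<dots> \<le> \<Phi> * Re (H z0) * (G2 1 + G2 \<i>)" using GG unfolding eq0 .
  also have "\<dots> \<le> \<Phi> * Re (H z0) * (\<Phi> * \<eta>2 1 + \<Phi> * \<eta>2 \<i>)"
    using \<Phi> hp key by (intro mult_left_mono add_mono) auto
  also have "\<dots> = \<Phi>\<^sup>2 * (Re (H z0) * (\<eta>2 1 + \<eta>2 \<i>))" by (simp add: power2_eq_square algebra_simps)
  finally have "(\<eta>1 1)\<^sup>2 + (\<eta>1 \<i>)\<^sup>2 \<le> Re (H z0) * (\<eta>2 1 + \<eta>2 \<i>)"
    using \<Phi> by (simp add: mult_le_cancel_left)
  then have "((\<eta>1 1)\<^sup>2 + (\<eta>1 \<i>)\<^sup>2) / (Re (H z0))\<^sup>2 \<le> Re (H z0) * (\<eta>2 1 + \<eta>2 \<i>) / (Re (H z0))\<^sup>2"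
    by (intro divide_right_mono) auto
  also have "\<dots> = \<eta>2 1 / Re (H z0) + \<eta>2 \<i> / Re (H z0)" using hp by (simp add: power2_eq_square field_simps)
  finally show False using neg by (simp add: power_divide add_divide_distrib)
qed

section \<open>Maps with vanishing differential\<close>

lemma dirderiv_local_rep_zero:
  assumes nonpos: "\<And>x. x \<in> proj_tangent_points M \<Longrightarrow> norm_quotient M N f g h x \<le> 0"
    and c: "c \<in> M" and d: "d \<in> N" and z: "z \<in> local_dom f c d" and a: "a \<in> coord_space (chart_idx c)"
  shows "dirderiv (local_rep f c d) a z = 0"
proof (cases "a = 0")
  case False
  obtain p where p: "p \<in> chart_dom c" "f p \<in> chart_dom d" "z = chart_map c p" using z by (auto simp: local_dom_def)
  define W where "W = tangent_vec M c p a"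
  have W: "W \<in> tangent_space M p" unfolding W_def by (rule tangent_vec_in_tangent_space[OF M c p(1) a])
  have Wc: "W c = a" unfolding W_def by (rule tangent_vec_at[OF M c p(1) a])
  have W0: "W \<noteq> 0" using Wc False by fastforce
  have pM: "p \<in> carrier_of M" using c p by (auto simp: carrier_of_def)
  let ?x = "(p, complex_line W)" and ?b = "dirderiv (local_rep f c d) a z"
  have x: "?x \<in> proj_tangent_points M" using pM W W0 by (auto simp: proj_tangent_points_def)
  have WS: "W \<in> snd ?x" by (simp add: complex_line_self)
  have hpos: "0 < Re (h ?x W W)" by (rule hermitian_innerD(4)[OF h_hermitian[OF x] WS W0])
  have U: "differential M N f p W = tangent_vec N d (f p) ?b"
    using differential_in_charts[OF M N f W c p(1) d p(2)] by (simp add: Wc p(3))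
  have b: "?b \<in> coord_space (chart_idx d)" by (rule dirderiv_local_rep_in_coord_space[OF M N f c d z a])
  let ?U = "tangent_vec N d (f p) ?b"
  have "Re (g (f p) ?U ?U) / Re (h ?x W W) \<le> 0"
    using nonpos[OF x] norm_quotient_eq[OF x WS W0] by (simp add: U)
  then have "Re (g (f p) ?U ?U) \<le> 0" using hpos by (simp add: divide_le_0_iff)
  then have "?U = 0"
    using hermitian_innerD(4)[OF hermitian_metricD(1)[OF g d p(2)] tangent_vec_in_tangent_space[OF N d p(2) b]] by linarith
  then have "?U d = 0" by simp
  then show ?thesis using tangent_vec_at[OF N d p(2) b] by simp
qed simp

text \<open>
  Near \<open>p\<close> the local representative is constant along segments in the coordinate subspace, and charts
  are injective.
\<close>

lemma locally_constant:
  assumes zero: "\<And>c d z a. c \<in> M \<Longrightarrow> d \<in> N \<Longrightarrow> z \<in> local_dom f c d \<Longrightarrow> a \<in> coord_space (chart_idx c) \<Longrightarrow>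
      dirderiv (local_rep f c d) a z = 0"
    and p: "p \<in> carrier_of M"
  obtains V where "openin (atlas_topology M) V" "p \<in> V" "\<And>q. q \<in> V \<Longrightarrow> f q = f p"
proof -
  obtain c where c: "c \<in> M" "p \<in> chart_dom c" using p by (auto simp: carrier_of_def)
  obtain d where d: "d \<in> N" "f p \<in> chart_dom d" using f_carrier[OF p] by (auto simp: carrier_of_def)
  let ?D = "local_dom f c d" and ?F = "local_rep f c d" and ?x = "chart_map c p"
  have D: "openin_coord (chart_idx c) ?D" by (rule local_dom_open[OF M N f c(1) d(1)])
  have F: "?F differentiable_on ?D"
    by (rule cholomorphic_differentiable_on[OF local_rep_cholomorphic[OF M N f c(1) d(1)]])
  have x: "?x \<in> ?D" using c d by (auto simp: local_dom_def)
  obtain e where e: "e > 0" "\<And>y. y \<in> coord_space (chart_idx c) \<Longrightarrow> dist y ?x < e \<Longrightarrow> y \<in> ?D"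
    using openin_coord_ball[OF D x] by blast
  define V where "V = {q \<in> chart_dom c. chart_map c q \<in> ball ?x e}"
  show ?thesis
  proof (rule that[of V])
    show "openin (atlas_topology M) V" unfolding V_def by (rule openin_atlas_basic[OF c(1) open_ball])
    show "p \<in> V" using c e by (simp add: V_def)
    fix q assume "q \<in> V"
    then have q: "q \<in> chart_dom c" "dist (chart_map c q) ?x < e" by (auto simp: V_def dist_commute)
    let ?y = "chart_map c q"
    have xc: "?x \<in> coord_space (chart_idx c)" and yc: "?y \<in> coord_space (chart_idx c)"
      using chart_map_in_coord_space[OF M c(1)] c(2) q(1) by auto
    define \<gamma> where "\<gamma> = (\<lambda>t::real. ?x + t *\<^sub>R (?y - ?x))"
    have \<gamma>c: "\<gamma> t \<in> coord_space (chart_idx c)" for t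
      unfolding \<gamma>_def by (intro coord_space_intros xc yc)
    define T where "T = {t \<in> UNIV. \<gamma> t \<in> ?D}"
    have T: "open T" unfolding T_def
      by (rule open_preimage_coord[OF D open_UNIV _ \<gamma>c]) (auto simp: \<gamma>_def intro!: continuous_intros)
    have sub: "t \<in> T" if "t \<in> {0..1}" for t
    proof -
      have "dist (\<gamma> t) ?x = t * dist ?y ?x" using that by (simp add: \<gamma>_def dist_norm)
      also have "\<dots> \<le> 1 * dist ?y ?x" using that by (intro mult_right_mono) auto
      finally have "dist (\<gamma> t) ?x < e" using q(2) by simp
      then show ?thesis using e(2)[OF \<gamma>c] by (simp add: T_def)
    qed
    have "((\<lambda>t. ?F (\<gamma> t)) has_vector_derivative 0) (at t within {0..1})" if t: "t \<in> {0..1}" for t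
    proof -
      have \<gamma>': "(\<gamma> has_vector_derivative (?y - ?x)) (at t)"
        unfolding \<gamma>_def by (auto intro!: derivative_eq_intros)
      have yx: "?y - ?x \<in> coord_space (chart_idx c)" by (rule coord_space_diff[OF yc xc])
      have "((\<lambda>t. ?F (\<gamma> t)) has_vector_derivative dirderiv ?F (?y - ?x) (\<gamma> t)) (at t)"
        by (rule has_vector_derivative_along_curve[OF D F T sub[OF t] _ \<gamma>' yx]) (simp add: T_def)
      moreover have "dirderiv ?F (?y - ?x) (\<gamma> t) = 0"
        by (rule zero[OF c(1) d(1) _ yx]) (use sub[OF t] in \<open>simp add: T_def\<close>)
      ultimately show ?thesis by (simp add: has_vector_derivative_at_within)
    qed
    then obtain k where k: "\<And>t. t \<in> {0..1} \<Longrightarrow> ?F (\<gamma> t) = k"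
      using has_vector_derivative_zero_constant[of "{0..1::real}" "\<lambda>t. ?F (\<gamma> t)"] by (metis convex_real_interval(5))
    have "?F ?y = ?F ?x" using k[of 0] k[of 1] by (simp add: \<gamma>_def)
    then have eq: "chart_map d (f q) = chart_map d (f p)"
      by (simp add: local_rep_chart_map[OF M N f c(1) q(1)] local_rep_chart_map[OF M N f c])
    have "?y \<in> ?D" using e(2)[OF yc q(2)] .
    then obtain q' where "q' \<in> chart_dom c" "f q' \<in> chart_dom d" "chart_map c q' = ?y" by (auto simp: local_dom_def)
    then have "f q \<in> chart_dom d" using inj_onD[OF complex_manifoldD(1)[OF M c(1)], of q' q] q(1) by simp
    then show "f q = f p" using inj_onD[OF complex_manifoldD(1)[OF N d(1)] eq] d(2) by simp
  qed
qed

end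

lemma constant_on_connected_space:
  assumes conn: "connected_space X"
    and loc: "\<And>p. p \<in> topspace X \<Longrightarrow> \<exists>V. openin X V \<and> p \<in> V \<and> (\<forall>q\<in>V. f q = f p)"
  shows "f constant_on topspace X"
proof (cases "topspace X = {}")
  case True
  then show ?thesis by (simp add: constant_on_def)
next
  case False
  then obtain p where p: "p \<in> topspace X" by blast
  define E1 where "E1 = {q \<in> topspace X. f q = f p}"
  define E2 where "E2 = {q \<in> topspace X. f q \<noteq> f p}"
  have level: "openin X {q \<in> topspace X. P (f q)}" for P
  proof (subst openin_subopen, intro ballI)
    fix q assume q: "q \<in> {q \<in> topspace X. P (f q)}"
    then obtain V where V: "openin X V" "q \<in> V" "\<forall>r\<in>V. f r = f q" using loc by blast
    have "V \<subseteq> {q \<in> topspace X. P (f q)}"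
    proof
      fix r assume r: "r \<in> V"
      have "r \<in> topspace X" using r openin_subset[OF V(1)] by blast
      moreover have "P (f r)" unfolding bspec[OF V(3) r] using q by simp
      ultimately show "r \<in> {q \<in> topspace X. P (f q)}" by simp
    qed
    then show "\<exists>T. openin X T \<and> q \<in> T \<and> T \<subseteq> {q \<in> topspace X. P (f q)}" using V by blast
  qed
  have op: "openin X E1" "openin X E2" unfolding E1_def E2_def by (rule level[of "\<lambda>y. y = f p"], rule level[of "\<lambda>y. y \<noteq> f p"])
  have "E2 = {}"
  proof (rule ccontr)
    assume "E2 \<noteq> {}"
    moreover have "topspace X \<subseteq> E1 \<union> E2" "E1 \<inter> E2 = {}" "E1 \<noteq> {}" using p by (auto simp: E1_def E2_def)
    ultimately show False using conn op unfolding connected_space_def by blast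
  qed
  then show ?thesis unfolding constant_on_def E2_def by blast
qed

theorem corollary1p3:
  fixes M :: "('a, 'm::finite) chart set"
    and N :: "('b, 'n::finite) chart set"
    and m n :: nat
    and f :: "'a \<Rightarrow> 'b"
  assumes "complex_manifold m M" and "compact_space (atlas_topology M)"
    and "complex_manifold n N"
    and "holomorphic_map M N f"
    and "RC_positive (proj_tangent_atlas M) (tautological_bundle M)"
    and "\<exists>g. hermitian_metric N g \<and> nonpos_bisectional_curvature N g"
  shows "f constant_on (carrier_of M)"
proof -
  obtain g where g_metric: "hermitian_metric N g" and g_curv: "nonpos_bisectional_curvature N g" using assms(6) by blast
  obtain h where h_metric: "line_bundle_metric (proj_tangent_atlas M) (tautological_bundle M) h"
    and RC: "\<forall>x\<in>carrier_of (proj_tangent_atlas M). \<forall>c\<in>proj_tangent_atlas M. \<forall>(V, e)\<in>frames (tautological_bundle M).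
        x \<in> chart_dom c \<and> x \<in> V \<longrightarrow>
        (\<exists>\<mu>>0. matrix_eigenvalue (chart_idx c) (line_curvature h e c (chart_map c x)) (complex_of_real \<mu>))"
    using assms(5) unfolding RC_positive_def by blast
  interpret metric_setting M N m n f g h
    by unfold_locales (fact assms(1,3,4) g_metric h_metric)+
  have pos: "\<exists>\<mu>>0. matrix_eigenvalue (affine_idx (chart_idx c) i)
        (line_curvature h (affine_frame c i) (affine_chart M c i) (chart_map (affine_chart M c i) x)) (complex_of_real \<mu>)"
    if c: "c \<in> M" and i: "i \<in> chart_idx c" and x: "x \<in> affine_dom M c i" for c i x
  proof -
    have "x \<in> carrier_of (proj_tangent_atlas M)"
      using affine_dom_subset[OF x] by (simp add: carrier_proj_tangent_atlas)
    moreover have "affine_chart M c i \<in> proj_tangent_atlas M" "(affine_dom M c i, affine_frame c i) \<in> frames (tautological_bundle M)"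
      using c i by (auto simp: proj_tangent_atlas_def tautological_bundle_def)
    moreover have "x \<in> chart_dom (affine_chart M c i)" "chart_idx (affine_chart M c i) = affine_idx (chart_idx c) i"
      using x by (auto simp: affine_chart_def)
    ultimately show ?thesis using RC x by fastforce
  qed
  have nonpos: "norm_quotient M N f g h x \<le> 0" if x: "x \<in> proj_tangent_points M" for x
  proof -
    obtain y where y: "y \<in> proj_tangent_points M"
      "\<And>x. x \<in> proj_tangent_points M \<Longrightarrow> norm_quotient M N f g h x \<le> norm_quotient M N f g h y"
      using norm_quotient_attains_max[OF assms(2)] x by blast
    have "norm_quotient M N f g h y \<le> 0"
      by (rule norm_quotient_max_nonpos[OF y pos g_curv])
    then show ?thesis using y(2)[OF x] by simp
  qed
  have "f constant_on topspace (atlas_topology M)"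
  proof (rule constant_on_connected_space)
    show "connected_space (atlas_topology M)" using assms(1) by (simp add: complex_manifold_def)
    fix p assume "p \<in> topspace (atlas_topology M)"
    then have "p \<in> carrier_of M" by (simp add: topspace_atlas_topology)
    then obtain V where "openin (atlas_topology M) V" "p \<in> V" "\<And>q. q \<in> V \<Longrightarrow> f q = f p"
      using locally_constant dirderiv_local_rep_zero nonpos by metis
    then show "\<exists>V. openin (atlas_topology M) V \<and> p \<in> V \<and> (\<forall>q\<in>V. f q = f p)" by blast
  qed
  then show ?thesis by (simp add: topspace_atlas_topology)
qed

end
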